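(* There is an algorithm which, given a skew-merged permutation $\tau$ of size $n$ and a skew-merged permutation $\pi$ of size $k$, determines whether $\tau$ contains $\pi$, and whose running time is $O(kn)$.
   Context: A permutation of size $n$ is a bijection $\sigma:[n]\to[n]$, identified with its set of points $\{(i,\sigma(i))\}$; $(i,\sigma(i))$ lies to the left of $(j,\sigma(j))$ if $i<j$ and below it if $\sigma(i)<\sigma(j)$. An embedding of $\pi$ into $\tau$ is an injective map from points of $\pi$ to points of $\tau$ preserving the relative horizontal and vertical order of every pair of points; $\tau$ contains $\pi$ if an embedding exists. A permutation is skew-merged if its set of points can be partitioned into an increasing subsequence and a decreasing subsequence (equivalently, it contains neither $3412$ nor $2143$). Running time is measured in the standard RAM model with inputs in one-line notation. *)

theory Defs
  imports Main
begin

text \<open>A permutation of size n is a list of length n whose entries are exactly 1..n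
  (one-line notation); the point of index i (0-based) is (i, s!i).\<close>

definition is_perm :: "nat list \<Rightarrow> bool" where
  "is_perm s \<longleftrightarrow> distinct s \<and> set s = {1..length s}"

definition embedding :: "nat list \<Rightarrow> nat list \<Rightarrow> (nat \<Rightarrow> nat) \<Rightarrow> bool" where
  "embedding p t f \<longleftrightarrow>
     (\<forall>i < length p. f i < length t) \<and> inj_on f {..<length p} \<and>
     (\<forall>i < length p. \<forall>j < length p.
        (i < j \<longleftrightarrow> f i < f j) \<and> (p ! i < p ! j \<longleftrightarrow> t ! (f i) < t ! (f j)))"

definition contains :: "nat list \<Rightarrow> nat list \<Rightarrow> bool" where
  "contains t p \<longleftrightarrow> (\<exists>f. embedding p t f)"

definition skew_merged :: "nat list \<Rightarrow> bool" where
  "skew_merged s \<longleftrightarrow> (\<exists>A \<subseteq> {..<length s}.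
      (\<forall>i\<in>A. \<forall>j\<in>A. i < j \<longrightarrow> s ! i < s ! j) \<and>
      (\<forall>i\<in>{..<length s} - A. \<forall>j\<in>{..<length s} - A. i < j \<longrightarrow> s ! i > s ! j))"

text \<open>Registers indexed by nat, memory indexed by int, all holding integers.
  Every executed instruction costs one time unit. The machine halts when the
  program counter leaves the program.\<close>

datatype instr =
    Const nat int
  | Add nat nat nat
  | Sub nat nat nat
  | Load nat nat
  | Store nat nat
  | Jz nat nat
  | Jlt nat nat nat

type_synonym config = "nat \<times> (nat \<Rightarrow> int) \<times> (int \<Rightarrow> int)"

fun step :: "instr list \<Rightarrow> config \<Rightarrow> config" where
  "step P (pc, r, m) =
    (if length P \<le> pc then (pc, r, m) else
     (case P ! pc of
        Const d c \<Rightarrow> (pc + 1, r(d := c), m)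
      | Add d a b \<Rightarrow> (pc + 1, r(d := r a + r b), m)
      | Sub d a b \<Rightarrow> (pc + 1, r(d := r a - r b), m)
      | Load d a \<Rightarrow> (pc + 1, r(d := m (r a)), m)
      | Store a b \<Rightarrow> (pc + 1, r, m(r a := r b))
      | Jz a t \<Rightarrow> (if r a = 0 then t else pc + 1, r, m)
      | Jlt a b t \<Rightarrow> (if r a < r b then t else pc + 1, r, m)))"

definition run :: "instr list \<Rightarrow> nat \<Rightarrow> config \<Rightarrow> config" where
  "run P t c = (step P ^^ t) c"

definition halted :: "instr list \<Rightarrow> config \<Rightarrow> bool" where
  "halted P c \<longleftrightarrow> length P \<le> fst c"

definition ram_output :: "config \<Rightarrow> int" where
  "ram_output c = fst (snd c) 0"

definition input_mem :: "nat list \<Rightarrow> nat list \<Rightarrow> int \<Rightarrow> int" where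
  "input_mem t p a =
    (let n = int (length t); k = int (length p) in
     if a = 0 then n
     else if 1 \<le> a \<and> a \<le> n then int (t ! nat (a - 1))
     else if a = n + 1 then k
     else if n + 2 \<le> a \<and> a \<le> n + k + 1 then int (p ! nat (a - n - 2))
     else 0)"

definition init_config :: "nat list \<Rightarrow> nat list \<Rightarrow> config" where
  "init_config t p = (0, (\<lambda>_. 0), input_mem t p)"

end

theory Submission
  imports Defs
begin

text \<open>
  A skew-merged permutation has a centre: a vertical and a horizontal line such that the points in the
  south-west and north-east quadrants increase and those in the other two decrease. Ordered from
  the centre outwards, the four quadrants are arms, and only adjacent arms interact. Fix a
  centre of the text. An embedding of the pattern pulls it back to a centre of the pattern and maps arms to arms.
  Conversely, if \<open>p\<close> lies in a given arm, then its next outward neighbours in both directions lie in arms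
  that do not depend on the centre, and their images must lie further out than the image of \<open>p\<close>. Propagating
  these constraints from the outside inwards gives, for every pattern point and every arm, the
  outermost position that the point may take; there are at most \<open>4 k n\<close> decrements in total.
  All constraints have a single premise, so they are jointly satisfiable for a
  given centre of the pattern as soon as no point has run out of positions. For a fixed vertical line this, and
  the requirement that the lines form a centre, confine the horizontal line to an interval, which
  one pass over the pattern computes.
\<close>

section \<open>A structured language on the RAM\<close>

text \<open>The obstacle is that a pattern may have many cuts, and propagating anew for each of them
  would be too slow. Bounds are therefore indexed by arms, not by cuts: comparing an outward
  neighbour with \<open>p\<close> already tells its arm, so the same constraints hold for every cut
  that puts \<open>p\<close> into the given arm, and one propagation serves all of them. A
  constraint asks one neighbour to be far enough out, so it only gets easier when that neighbour
  moves outwards. Hence the outermost positions surviving the propagation satisfy all constraints at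
  once, and no combination of positions is ever searched. The factor 4 in the number of decrements
  counts the arms; one decrement can invalidate conditions at five points only, which keeps the
  worklist within O(k n). Trying the k + 1 vertical lines of the pattern costs O(k) each, and k^2 is
  at most k n because k > n is answered at once. The empty pattern is also answered separately,
  since reading the text would exceed a bound proportional to k n + 1. To make the time bound
  checkable, programs are written in a small language whose semantics counts exactly the
  instructions that the compiled code executes.\<close>

datatype exp = N int | V nat | Plus exp exp | Minus exp exp | Arr nat exp

datatype com =
    Skip
  | Assign nat exp  (\<open>_ ::= _\<close> [1000, 61] 61)
  | Write nat exp exp
  | Seq com com  (infixr \<open>;;\<close> 60)
  | Cond exp exp com com
  | While exp exp com

type_synonym store = "nat \<Rightarrow> int"
type_synonym arrays = "nat \<Rightarrow> int \<Rightarrow> int"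

fun ev :: "exp \<Rightarrow> store \<Rightarrow> arrays \<Rightarrow> int" where
  "ev (N c) s A = c"
| "ev (V x) s A = s x"
| "ev (Plus a b) s A = ev a s A + ev b s A"
| "ev (Minus a b) s A = ev a s A - ev b s A"
| "ev (Arr j e) s A = A j (ev e s A)"

fun safe :: "exp \<Rightarrow> store \<Rightarrow> arrays \<Rightarrow> bool" where
  "safe (N c) s A = True"
| "safe (V x) s A = True"
| "safe (Plus a b) s A = (safe a s A \<and> safe b s A)"
| "safe (Minus a b) s A = (safe a s A \<and> safe b s A)"
| "safe (Arr j e) s A = (safe e s A \<and> j < 8 \<and> 0 \<le> ev e s A)"

text \<open>Variable \<open>x\<close> lives in register \<open>2 * x\<close>; the odd registers form the evaluation stack for
  expressions.\<close>

definition addr_code :: "nat \<Rightarrow> nat \<Rightarrow> instr list" where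
  "addr_code j d = (if j = 0 then [] else
     [Add (2*d+1) (2*d+1) (2*d+1), Add (2*d+1) (2*d+1) (2*d+1), Add (2*d+1) (2*d+1) (2*d+1),
      Const (2*d+3) (- int j), Sub (2*d+1) (2*d+3) (2*d+1)])"

text \<open>The machine has no move instruction, so a variable is copied by adding it to a register
  that was just cleared.\<close>

fun exp_code :: "exp \<Rightarrow> nat \<Rightarrow> instr list" where
  "exp_code (N c) d = [Const (2*d+1) c]"
| "exp_code (V x) d = [Const (2*d+1) 0, Add (2*d+1) (2*x) (2*d+1)]"
| "exp_code (Plus a b) d = exp_code a d @ exp_code b (d+1) @ [Add (2*d+1) (2*d+1) (2*d+3)]"
| "exp_code (Minus a b) d = exp_code a d @ exp_code b (d+1) @ [Sub (2*d+1) (2*d+1) (2*d+3)]"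
| "exp_code (Arr j e) d = exp_code e d @ addr_code j d @ [Load (2*d+1) (2*d+1)]"

text \<open>Five instructions because the machine cannot multiply: three doublings form
  \<open>8 * i\<close>, and two more instructions negate and add the array number. The input array
  is addressed directly.\<close>

definition acost :: "nat \<Rightarrow> nat" where
  "acost j = (if j = 0 then 0 else 5)"

text \<open>Expressions compile to straight-line code, so this one number serves as code length and
  as running time.\<close>

fun ecost :: "exp \<Rightarrow> nat" where
  "ecost (N c) = 1"
| "ecost (V x) = 2"
| "ecost (Plus a b) = ecost a + ecost b + 1"
| "ecost (Minus a b) = ecost a + ecost b + 1"
| "ecost (Arr j e) = ecost e + acost j + 1"

text \<open>There is no unconditional jump. Register 1 may be cleared for this purpose because no
  value stays on the evaluation stack between commands.\<close>

definition goto :: "nat \<Rightarrow> instr list" where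
  "goto l = [Const 1 0, Jz 1 l]"

definition branch_code :: "exp \<Rightarrow> exp \<Rightarrow> nat \<Rightarrow> instr list" where
  "branch_code e1 e2 l = exp_code e1 0 @ exp_code e2 1 @ [Jlt 1 3 l]"

definition tcost :: "exp \<Rightarrow> exp \<Rightarrow> nat" where
  "tcost e1 e2 = ecost e1 + ecost e2 + 1"

fun csize :: "com \<Rightarrow> nat" where
  "csize Skip = 0"
| "csize (x ::= e) = ecost e + 2"
| "csize (Write j e1 e2) = ecost e1 + acost j + ecost e2 + 1"
| "csize (c1 ;; c2) = csize c1 + csize c2"
| "csize (Cond e1 e2 c1 c2) = tcost e1 e2 + csize c2 + 2 + csize c1"
| "csize (While e1 e2 c) = tcost e1 e2 + 2 + csize c + 2"

fun com_code :: "com \<Rightarrow> nat \<Rightarrow> instr list" where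
  "com_code Skip l = []"
| "com_code (x ::= e) l = exp_code e 0 @ [Const 3 0, Add (2*x) 1 3]"
| "com_code (Write j e1 e2) l = exp_code e1 0 @ addr_code j 0 @ exp_code e2 1 @ [Store 1 3]"
| "com_code (c1 ;; c2) l = com_code c1 l @ com_code c2 (l + csize c1)"
| "com_code (Cond e1 e2 c1 c2) l =
     branch_code e1 e2 (l + tcost e1 e2 + csize c2 + 2)
     @ com_code c2 (l + tcost e1 e2)
     @ goto (l + tcost e1 e2 + csize c2 + 2 + csize c1)
     @ com_code c1 (l + tcost e1 e2 + csize c2 + 2)"
| "com_code (While e1 e2 c) l =
     branch_code e1 e2 (l + tcost e1 e2 + 2)
     @ goto (l + tcost e1 e2 + 2 + csize c + 2)
     @ com_code c (l + tcost e1 e2 + 2)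
     @ goto l"

section \<open>Timed execution of commands\<close>

text \<open>The extra 2 in \<open>CondF\<close>, \<open>WhileF\<close> and \<open>WhileT\<close> is
  a \<open>goto\<close>: over the other branch, out of the loop, or back to the test.
  \<open>CondT\<close> ends by falling through.\<close>

inductive exec :: "com \<Rightarrow> store \<Rightarrow> arrays \<Rightarrow> nat \<Rightarrow> store \<Rightarrow> arrays \<Rightarrow> bool" where
  Skip: "exec Skip s A 0 s A"
| Assign: "safe e s A \<Longrightarrow> exec (x ::= e) s A (ecost e + 2) (s(x := ev e s A)) A"
| Write: "\<lbrakk>safe e1 s A; safe e2 s A; 0 \<le> ev e1 s A; j < 8\<rbrakk> \<Longrightarrow>
    exec (Write j e1 e2) s A (ecost e1 + acost j + ecost e2 + 1)
      s (A(j := (A j)(ev e1 s A := ev e2 s A)))"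
| Seq: "\<lbrakk>exec c1 s A t s' A'; exec c2 s' A' t' s'' A''\<rbrakk> \<Longrightarrow> exec (c1 ;; c2) s A (t + t') s'' A''"
| CondT: "\<lbrakk>safe e1 s A; safe e2 s A; ev e1 s A < ev e2 s A; exec c1 s A t s' A'\<rbrakk> \<Longrightarrow>
    exec (Cond e1 e2 c1 c2) s A (tcost e1 e2 + t) s' A'"
| CondF: "\<lbrakk>safe e1 s A; safe e2 s A; \<not> ev e1 s A < ev e2 s A; exec c2 s A t s' A'\<rbrakk> \<Longrightarrow>
    exec (Cond e1 e2 c1 c2) s A (tcost e1 e2 + t + 2) s' A'"
| WhileF: "\<lbrakk>safe e1 s A; safe e2 s A; \<not> ev e1 s A < ev e2 s A\<rbrakk> \<Longrightarrow>
    exec (While e1 e2 c) s A (tcost e1 e2 + 2) s A"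
| WhileT: "\<lbrakk>safe e1 s A; safe e2 s A; ev e1 s A < ev e2 s A; exec c s A t s' A';
     exec (While e1 e2 c) s' A' t' s'' A''\<rbrakk> \<Longrightarrow>
    exec (While e1 e2 c) s A (tcost e1 e2 + t + 2 + t') s'' A''"

text \<open>Array 0 is the memory holding the input; arrays 1 to 7 are interleaved on the negative
  addresses. Indices must be nonnegative, which is what \<open>safe\<close> records.\<close>

definition addr :: "nat \<Rightarrow> int \<Rightarrow> int" where
  "addr j i = (if j = 0 then i else - (8 * i + int j))"

lemma addr_eq_iff:
  assumes "j < 8" "j' < 8" "0 \<le> i" "0 \<le> i'"
  shows "addr j i = addr j' i' \<longleftrightarrow> j = j' \<and> i = i'"
proof
  assume eq: "addr j i = addr j' i'"
  show "j = j' \<and> i = i'"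
  proof (cases "j = 0 \<or> j' = 0")
    case True
    then show ?thesis using assms eq by (auto simp: addr_def split: if_splits)
  next
    case False
    then have "8 * i + int j = 8 * i' + int j'" using eq by (simp add: addr_def)
    moreover have "int j < 8" "int j' < 8" using assms by auto
    moreover from calculation have "\<not> i < i'" "\<not> i' < i" by linarith+
    ultimately show ?thesis by simp
  qed
qed simp

definition represents :: "store \<Rightarrow> arrays \<Rightarrow> (nat \<Rightarrow> int) \<Rightarrow> (int \<Rightarrow> int) \<Rightarrow> bool" where
  "represents s A r m \<longleftrightarrow>
     (\<forall>x. r (2 * x) = s x) \<and> (\<forall>j<8. \<forall>i\<ge>0. m (addr j i) = A j i)"

section \<open>Correctness of the compiled code\<close>

definition code_at :: "instr list \<Rightarrow> nat \<Rightarrow> instr list \<Rightarrow> bool" where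
  "code_at P l is \<longleftrightarrow> (\<forall>i<length is. l + i < length P \<and> P ! (l + i) = is ! i)"

lemma code_at_Nil [simp]: "code_at P l []"
  by (simp add: code_at_def)

lemma code_at_Cons [simp]:
  "code_at P l (i # is) \<longleftrightarrow> l < length P \<and> P ! l = i \<and> code_at P (Suc l) is"
  by (auto simp: code_at_def less_Suc_eq_0_disj)

lemma code_at_append [simp]:
  "code_at P l (xs @ ys) \<longleftrightarrow> code_at P l xs \<and> code_at P (l + length xs) ys"
  by (induction xs arbitrary: l) auto

lemma length_exp_code [simp]: "length (exp_code e d) = ecost e"
  by (induction e arbitrary: d) (auto simp: addr_code_def acost_def)

lemma length_addr_code [simp]: "length (addr_code j d) = acost j"
  by (simp add: addr_code_def acost_def)

lemma length_branch_code [simp]: "length (branch_code e1 e2 l) = tcost e1 e2"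
  by (simp add: branch_code_def tcost_def)

lemma length_goto [simp]: "length (goto l) = 2"
  by (simp add: goto_def)

lemma length_com_code [simp]: "length (com_code c l) = csize c"
  by (induction c arbitrary: l) auto

lemma run_0 [simp]: "run P 0 c = c"
  by (simp add: run_def)

lemma run_Suc: "run P (Suc t) c = run P t (step P c)"
  by (simp add: run_def funpow_swap1)

lemma run_add: "run P (t + t') c = run P t' (run P t c)"
  by (induction t arbitrary: c) (simp_all add: run_Suc)

text \<open>The frame condition for evaluation at stack depth \<open>d\<close>: operands waiting
  lower on the stack and all variables must survive, while the odd registers from there on are
  scratch space.\<close>

definition keeps :: "nat \<Rightarrow> (nat \<Rightarrow> int) \<Rightarrow> (nat \<Rightarrow> int) \<Rightarrow> bool" where
  "keeps d r r' \<longleftrightarrow> (\<forall>x. r' (2*x) = r (2*x)) \<and> (\<forall>e<d. r' (2*e+1) = r (2*e+1))"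

lemma keeps_trans: "keeps d r r' \<Longrightarrow> keeps d' r' r'' \<Longrightarrow> d \<le> d' \<Longrightarrow> keeps d r r''"
  by (simp add: keeps_def)

lemma keeps_upd: "d \<le> e \<Longrightarrow> keeps d r (r(2*e+1 := v))"
proof -
  have "2 * x \<noteq> 2 * e + 1" for x by presburger
  then show "d \<le> e \<Longrightarrow> keeps d r (r(2*e+1 := v))" by (auto simp: keeps_def)
qed

lemma represents_keeps: "represents s A r m \<Longrightarrow> keeps d r r' \<Longrightarrow> represents s A r' m"
  by (simp add: represents_def keeps_def)

lemma run_addr_code:
  assumes "code_at P l (addr_code j d)"
  shows "\<exists>r'. run P (acost j) (l, r, m) = (l + acost j, r', m) \<and>
    r' (2*d+1) = addr j (r (2*d+1)) \<and> keeps d r r'"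
proof (cases "j = 0")
  case True
  then show ?thesis by (auto simp: acost_def addr_def keeps_def)
next
  case False
  let ?x = "r (2*d+1)"
  let ?r = "r(2*d+1 := ?x+?x, 2*d+1 := ?x+?x+(?x+?x), 2*d+1 := ?x+?x+(?x+?x)+(?x+?x+(?x+?x)),
    2*(d+1)+1 := - int j, 2*d+1 := - int j - (?x+?x+(?x+?x)+(?x+?x+(?x+?x))))"
  have num: "acost j = Suc (Suc (Suc (Suc (Suc 0))))" using False by (simp add: acost_def)
  have "run P (acost j) (l, r, m) = (l + acost j, ?r, m)"
    using False assms unfolding num by (simp add: addr_code_def run_Suc numeral_3_eq_3)
  moreover have "?r (2*d+1) = addr j ?x" using False by (simp add: addr_def)
  moreover have "keeps d r ?r"
    by (intro keeps_trans[OF _ keeps_upd[of d]] keeps_upd) simp_all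
  ultimately show ?thesis by blast
qed

lemma run_exp_code:
  assumes "code_at P l (exp_code e d)" "safe e s A" "represents s A r m"
  shows "\<exists>r'. run P (ecost e) (l, r, m) = (l + ecost e, r', m) \<and>
    r' (2*d+1) = ev e s A \<and> keeps d r r'"
  using assms
proof (induction e arbitrary: d l r)
  case (N c)
  have "run P (ecost (N c)) (l, r, m) = (l + ecost (N c), r(2*d+1 := c), m)"
    using N by (simp add: run_Suc)
  moreover have "(r(2*d+1 := c)) (2*d+1) = ev (N c) s A" by simp
  ultimately show ?case using keeps_upd by blast
next
  case (V x)
  have "2 * x \<noteq> 2 * d + 1" by presburger
  then have "run P (Suc (Suc 0)) (l, r, m) = (l + Suc (Suc 0), r(2*d+1 := s x), m)"
    using V by (simp add: run_Suc represents_def)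
  then have "run P (ecost (V x)) (l, r, m) = (l + ecost (V x), r(2*d+1 := s x), m)"
    by (simp only: ecost.simps numeral_2_eq_2)
  moreover have "(r(2*d+1 := s x)) (2*d+1) = ev (V x) s A" by simp
  ultimately show ?case using keeps_upd by blast
next
  case (Plus a b)
  obtain r1 where r1: "run P (ecost a) (l, r, m) = (l + ecost a, r1, m)"
    "r1 (2*d+1) = ev a s A" "keeps d r r1"
    using Plus.IH(1)[of l d r] Plus.prems by auto
  have "represents s A r1 m" using represents_keeps[OF Plus.prems(3) r1(3)] .
  then obtain r2 where r2: "run P (ecost b) (l + ecost a, r1, m) = (l + ecost a + ecost b, r2, m)"
    "r2 (2*(d+1)+1) = ev b s A" "keeps (d+1) r1 r2"
    using Plus.IH(2)[of "l + ecost a" "d+1" r1] Plus.prems by auto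
  have val: "r2 (2*d+1) = ev a s A" "r2 (2*d+3) = ev b s A"
    using r1(2) r2(2,3) by (simp_all add: keeps_def numeral_3_eq_3)
  let ?r = "r2(2*d+1 := ev (Plus a b) s A)"
  have "l + ecost a + ecost b < length P"
    "P ! (l + ecost a + ecost b) = Add (2*d+1) (2*d+1) (2*d+3)"
    using Plus.prems(1) by (simp_all add: add.assoc)
  then have "step P (l + ecost a + ecost b, r2, m) = (l + ecost (Plus a b), ?r, m)"
    using val by simp
  moreover have "run P (ecost (Plus a b)) (l, r, m) = step P (l + ecost a + ecost b, r2, m)"
    by (simp only: ecost.simps run_add r1 r2) (simp add: run_Suc)
  moreover have "keeps d r ?r"
    by (rule keeps_trans[OF keeps_trans[OF r1(3) r2(3)] keeps_upd[of d d]]) simp_all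
  moreover have "?r (2*d+1) = ev (Plus a b) s A" by simp
  ultimately show ?case by metis
next
  case (Minus a b)
  obtain r1 where r1: "run P (ecost a) (l, r, m) = (l + ecost a, r1, m)"
    "r1 (2*d+1) = ev a s A" "keeps d r r1"
    using Minus.IH(1)[of l d r] Minus.prems by auto
  have "represents s A r1 m" using represents_keeps[OF Minus.prems(3) r1(3)] .
  then obtain r2 where r2: "run P (ecost b) (l + ecost a, r1, m) = (l + ecost a + ecost b, r2, m)"
    "r2 (2*(d+1)+1) = ev b s A" "keeps (d+1) r1 r2"
    using Minus.IH(2)[of "l + ecost a" "d+1" r1] Minus.prems by auto
  have val: "r2 (2*d+1) = ev a s A" "r2 (2*d+3) = ev b s A"
    using r1(2) r2(2,3) by (simp_all add: keeps_def numeral_3_eq_3)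
  let ?r = "r2(2*d+1 := ev (Minus a b) s A)"
  have "l + ecost a + ecost b < length P"
    "P ! (l + ecost a + ecost b) = Sub (2*d+1) (2*d+1) (2*d+3)"
    using Minus.prems(1) by (simp_all add: add.assoc)
  then have "step P (l + ecost a + ecost b, r2, m) = (l + ecost (Minus a b), ?r, m)"
    using val by simp
  moreover have "run P (ecost (Minus a b)) (l, r, m) = step P (l + ecost a + ecost b, r2, m)"
    by (simp only: ecost.simps run_add r1 r2) (simp add: run_Suc)
  moreover have "keeps d r ?r"
    by (rule keeps_trans[OF keeps_trans[OF r1(3) r2(3)] keeps_upd[of d d]]) simp_all
  moreover have "?r (2*d+1) = ev (Minus a b) s A" by simp
  ultimately show ?case by metis
next
  case (Arr j e)
  obtain r1 where r1: "run P (ecost e) (l, r, m) = (l + ecost e, r1, m)"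
    "r1 (2*d+1) = ev e s A" "keeps d r r1"
    using Arr.IH[of l d r] Arr.prems by auto
  obtain r2 where r2: "run P (acost j) (l + ecost e, r1, m) = (l + ecost e + acost j, r2, m)"
    "r2 (2*d+1) = addr j (r1 (2*d+1))" "keeps d r1 r2"
    using run_addr_code[of P "l + ecost e" j d r1 m] Arr.prems(1) by auto
  let ?r = "r2(2*d+1 := ev (Arr j e) s A)"
  have "l + ecost e + acost j < length P"
    "P ! (l + ecost e + acost j) = Load (2*d+1) (2*d+1)"
    using Arr.prems(1) by (simp_all add: add.assoc)
  moreover have "m (r2 (2*d+1)) = ev (Arr j e) s A"
    using r1(2) r2(2) Arr.prems by (simp add: represents_def)
  ultimately have "step P (l + ecost e + acost j, r2, m) = (l + ecost (Arr j e), ?r, m)"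
    by simp
  moreover have "run P (ecost (Arr j e)) (l, r, m) = step P (l + ecost e + acost j, r2, m)"
    by (simp only: ecost.simps run_add r1 r2) (simp add: run_Suc)
  moreover have "keeps d r ?r"
    by (rule keeps_trans[OF keeps_trans[OF r1(3) r2(3)] keeps_upd[of d d]]) simp_all
  moreover have "?r (2*d+1) = ev (Arr j e) s A" by simp
  ultimately show ?case by metis
qed

lemma run_branch_code:
  assumes "code_at P l (branch_code e1 e2 l')" "safe e1 s A" "safe e2 s A" "represents s A r m"
  shows "\<exists>r'. run P (tcost e1 e2) (l, r, m) =
      (if ev e1 s A < ev e2 s A then l' else l + tcost e1 e2, r', m) \<and> represents s A r' m"
proof -
  obtain r1 where r1: "run P (ecost e1) (l, r, m) = (l + ecost e1, r1, m)"
    "r1 1 = ev e1 s A" "keeps 0 r r1"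
    using run_exp_code[of P l e1 0 s A r m] assms by (auto simp: branch_code_def)
  have rep1: "represents s A r1 m" using represents_keeps[OF assms(4) r1(3)] .
  then obtain r2 where r2: "run P (ecost e2) (l + ecost e1, r1, m) = (l + ecost e1 + ecost e2, r2, m)"
    "r2 3 = ev e2 s A" "keeps 1 r1 r2"
    using run_exp_code[of P "l + ecost e1" e2 1 s A r1 m] assms
    by (auto simp: branch_code_def numeral_3_eq_3)
  have rep2: "represents s A r2 m" using represents_keeps[OF rep1 r2(3)] .
  have "r2 1 = ev e1 s A" using r1(2) r2(3) by (simp add: keeps_def)
  moreover have "l + ecost e1 + ecost e2 < length P" "P ! (l + ecost e1 + ecost e2) = Jlt 1 3 l'"
    using assms(1) by (simp_all add: branch_code_def add.assoc)
  moreover have "run P (tcost e1 e2) (l, r, m) = step P (l + ecost e1 + ecost e2, r2, m)"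
    by (simp only: tcost_def run_add r1 r2) (simp add: run_Suc)
  ultimately have "run P (tcost e1 e2) (l, r, m) =
      (if ev e1 s A < ev e2 s A then l' else l + tcost e1 e2, r2, m)"
    using r2(2) by (simp add: tcost_def)
  then show ?thesis using rep2 by blast
qed

lemma run_goto:
  assumes "code_at P l (goto l')" "represents s A r m"
  shows "\<exists>r'. run P 2 (l, r, m) = (l', r', m) \<and> represents s A r' m"
proof -
  have "run P (Suc (Suc 0)) (l, r, m) = (l', r(1 := 0), m)"
    using assms(1) by (simp add: goto_def run_Suc)
  moreover have "represents s A (r(1 := 0)) m"
    using represents_keeps[OF assms(2) keeps_upd[of 0 0]] by simp
  ultimately show ?thesis unfolding numeral_2_eq_2 by blast
qed

text \<open>Induction follows the timed execution rather than the syntax, because a loop unfolds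
  into an execution of the same loop. The start address is arbitrary so that the hypotheses apply to
  nested code.\<close>

lemma run_com_code:
  assumes "exec c s A t s' A'" "code_at P l (com_code c l)" "represents s A r m"
  shows "\<exists>r' m'. run P t (l, r, m) = (l + csize c, r', m') \<and> represents s' A' r' m'"
  using assms
proof (induction arbitrary: l r m rule: exec.induct)
  case (Skip s A)
  then show ?case by auto
next
  case (Assign e s A x)
  obtain r1 where r1: "run P (ecost e) (l, r, m) = (l + ecost e, r1, m)"
    "r1 1 = ev e s A" "keeps 0 r r1"
    using run_exp_code[of P l e 0 s A r m] Assign by auto
  have "run P (ecost e + Suc (Suc 0)) (l, r, m) =
      (l + ecost e + Suc (Suc 0), r1(3 := 0, 2 * x := ev e s A), m)"
    unfolding run_add r1(1) using Assign.prems(1) r1(2) by (simp add: run_Suc)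
  then have "run P (ecost e + 2) (l, r, m) =
      (l + csize (x ::= e), r1(3 := 0, 2 * x := ev e s A), m)"
    unfolding numeral_2_eq_2 csize.simps by (simp only: add.assoc)
  moreover have "represents (s(x := ev e s A)) A (r1(3 := 0, 2 * x := ev e s A)) m"
  proof -
    have "represents s A (r1(2*1+1 := 0)) m"
      using represents_keeps[OF represents_keeps[OF Assign.prems(2) r1(3)] keeps_upd[of 1 1]] by simp
    then show ?thesis by (simp add: represents_def)
  qed
  ultimately show ?case by blast
next
  case (Write e1 s A e2 j)
  obtain r1 where r1: "run P (ecost e1) (l, r, m) = (l + ecost e1, r1, m)"
    "r1 1 = ev e1 s A" "keeps 0 r r1"
    using run_exp_code[of P l e1 0 s A r m] Write by auto
  obtain r2 where r2: "run P (acost j) (l + ecost e1, r1, m) = (l + ecost e1 + acost j, r2, m)"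
    "r2 1 = addr j (r1 1)" "keeps 0 r1 r2"
    using run_addr_code[of P "l + ecost e1" j 0 r1 m] Write.prems(1) by auto
  have rep2: "represents s A r2 m"
    using represents_keeps[OF represents_keeps[OF Write.prems(2) r1(3)] r2(3)] .
  obtain r3 where r3: "run P (ecost e2) (l + ecost e1 + acost j, r2, m) =
      (l + ecost e1 + acost j + ecost e2, r3, m)"
    "r3 3 = ev e2 s A" "keeps 1 r2 r3"
    using run_exp_code[of P "l + ecost e1 + acost j" e2 1 s A r2 m] Write rep2
    by (auto simp: add.assoc numeral_3_eq_3)
  have rep3: "represents s A r3 m" using represents_keeps[OF rep2 r3(3)] .
  let ?m = "m(addr j (ev e1 s A) := ev e2 s A)"
  have "r3 1 = addr j (ev e1 s A)" using r1(2) r2(2) r3(3) by (simp add: keeps_def)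
  moreover have "l + ecost e1 + acost j + ecost e2 < length P"
    "P ! (l + ecost e1 + acost j + ecost e2) = Store 1 3"
    using Write.prems(1) by (simp_all add: add.assoc)
  moreover have "run P (ecost e1 + acost j + ecost e2 + 1) (l, r, m) =
      step P (l + ecost e1 + acost j + ecost e2, r3, m)"
    by (simp only: run_add r1 r2 r3) (simp add: run_Suc)
  ultimately have "run P (ecost e1 + acost j + ecost e2 + 1) (l, r, m) =
      (l + csize (Write j e1 e2), r3, ?m)"
    using r3(2) by simp
  moreover have "represents s (A(j := (A j)(ev e1 s A := ev e2 s A))) r3 ?m"
    using rep3 Write.hyps by (auto simp: represents_def addr_eq_iff)
  ultimately show ?case by blast
next
  case (Seq c1 s A t s' A' c2 t' s'' A'')
  obtain r1 m1 where 1: "run P t (l, r, m) = (l + csize c1, r1, m1)" "represents s' A' r1 m1"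
    using Seq.IH(1) Seq.prems by fastforce
  obtain r2 m2 where 2: "run P t' (l + csize c1, r1, m1) = (l + csize c1 + csize c2, r2, m2)"
    "represents s'' A'' r2 m2"
    using Seq.IH(2)[OF _ 1(2)] Seq.prems by fastforce
  show ?case using 1 2 by (simp add: run_add add.assoc)
next
  case (CondT e1 s A e2 c1 t s' A' c2)
  obtain r1 where 1: "run P (tcost e1 e2) (l, r, m) = (l + tcost e1 e2 + csize c2 + 2, r1, m)"
    "represents s A r1 m"
    using run_branch_code[of P l e1 e2 _ s A r m] CondT.hyps CondT.prems by auto
  obtain r2 m2 where 2: "run P t (l + tcost e1 e2 + csize c2 + 2, r1, m) =
      (l + tcost e1 e2 + csize c2 + 2 + csize c1, r2, m2)" "represents s' A' r2 m2"
    using CondT.IH[OF _ 1(2)] CondT.prems by (fastforce simp: add.assoc)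
  show ?case using 1 2 by (simp add: run_add add.assoc)
next
  case (CondF e1 s A e2 c2 t s' A' c1)
  obtain r1 where 1: "run P (tcost e1 e2) (l, r, m) = (l + tcost e1 e2, r1, m)"
    "represents s A r1 m"
    using run_branch_code[of P l e1 e2 _ s A r m] CondF.hyps CondF.prems by auto
  obtain r2 m2 where 2: "run P t (l + tcost e1 e2, r1, m) =
      (l + tcost e1 e2 + csize c2, r2, m2)" "represents s' A' r2 m2"
    using CondF.IH[OF _ 1(2)] CondF.prems by fastforce
  obtain r3 where 3: "run P 2 (l + tcost e1 e2 + csize c2, r2, m2) =
      (l + tcost e1 e2 + csize c2 + 2 + csize c1, r3, m2)" "represents s' A' r3 m2"
    using run_goto[OF _ 2(2)] CondF.prems by (fastforce simp: add.assoc)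
  show ?case using 1 2 3 by (simp only: run_add) (simp add: add.assoc)
next
  case (WhileF e1 s A e2 c)
  obtain r1 where 1: "run P (tcost e1 e2) (l, r, m) = (l + tcost e1 e2, r1, m)"
    "represents s A r1 m"
    using run_branch_code[of P l e1 e2 _ s A r m] WhileF.hyps WhileF.prems by auto
  obtain r2 where 2: "run P 2 (l + tcost e1 e2, r1, m) =
      (l + tcost e1 e2 + 2 + csize c + 2, r2, m)" "represents s A r2 m"
    using run_goto[OF _ 1(2)] WhileF.prems by (fastforce simp: add.assoc)
  show ?case using 1 2 by (simp only: run_add) (simp add: add.assoc)
next
  case (WhileT e1 s A e2 c t s' A' t' s'' A'')
  obtain r1 where 1: "run P (tcost e1 e2) (l, r, m) = (l + tcost e1 e2 + 2, r1, m)"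
    "represents s A r1 m"
    using run_branch_code[of P l e1 e2 _ s A r m] WhileT.hyps WhileT.prems by auto
  obtain r2 m2 where 2: "run P t (l + tcost e1 e2 + 2, r1, m) =
      (l + tcost e1 e2 + 2 + csize c, r2, m2)" "represents s' A' r2 m2"
    using WhileT.IH(1)[OF _ 1(2)] WhileT.prems by fastforce
  obtain r3 where 3: "run P 2 (l + tcost e1 e2 + 2 + csize c, r2, m2) = (l, r3, m2)"
    "represents s' A' r3 m2"
    using run_goto[OF _ 2(2)] WhileT.prems by (fastforce simp: add.assoc)
  obtain r4 m4 where 4: "run P t' (l, r3, m2) = (l + csize (While e1 e2 c), r4, m4)"
    "represents s'' A'' r4 m4"
    using WhileT.IH(2)[OF WhileT.prems(1) 3(2)] by blast
  show ?case using 1 2 3 4 by (simp only: run_add) simp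
qed

section \<open>Weakest preconditions with running time\<close>

text \<open>Existence of one terminating run is total correctness here, since
  \<open>run_com_code\<close> turns it into the run of the machine, which is a function of the start
  configuration. Elapsed time is an argument of the postcondition so that costs add up along
  \<open>wp_Seq\<close>.\<close>

definition wp :: "com \<Rightarrow> (nat \<Rightarrow> store \<Rightarrow> arrays \<Rightarrow> bool) \<Rightarrow> store \<Rightarrow> arrays \<Rightarrow> bool" where
  "wp c Q s A \<longleftrightarrow> (\<exists>t s' A'. exec c s A t s' A' \<and> Q t s' A')"

inductive_cases exec_cases [elim!]:
  "exec Skip s A t s' A'"
  "exec (x ::= e) s A t s' A'"
  "exec (Write j e1 e2) s A t s' A'"
  "exec (c1 ;; c2) s A t s' A'"
  "exec (Cond e1 e2 c1 c2) s A t s' A'"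

lemma wp_Skip [simp]: "wp Skip Q s A \<longleftrightarrow> Q 0 s A"
  unfolding wp_def by (blast intro: exec.intros)

lemma wp_Assign [simp]:
  "wp (x ::= e) Q s A \<longleftrightarrow> safe e s A \<and> Q (ecost e + 2) (s(x := ev e s A)) A"
proof
  assume "safe e s A \<and> Q (ecost e + 2) (s(x := ev e s A)) A"
  then show "wp (x ::= e) Q s A" unfolding wp_def using exec.Assign by blast
qed (auto simp: wp_def)

lemma wp_Write [simp]:
  "wp (Write j e1 e2) Q s A \<longleftrightarrow> safe e1 s A \<and> safe e2 s A \<and> 0 \<le> ev e1 s A \<and> j < 8 \<and>
     Q (ecost e1 + acost j + ecost e2 + 1) s (A(j := (A j)(ev e1 s A := ev e2 s A)))"
 (is "_ \<longleftrightarrow> ?R")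
proof
  assume ?R
  then show "wp (Write j e1 e2) Q s A" unfolding wp_def using exec.Write by blast
qed (auto simp: wp_def)

lemma wp_Seq [simp]:
  "wp (c1 ;; c2) Q s A \<longleftrightarrow> wp c1 (\<lambda>t s A. wp c2 (\<lambda>t'. Q (t + t')) s A) s A"
  unfolding wp_def by (blast intro: exec.intros)

lemma wp_Cond [simp]:
  "wp (Cond e1 e2 c1 c2) Q s A \<longleftrightarrow> safe e1 s A \<and> safe e2 s A \<and>
     (if ev e1 s A < ev e2 s A then wp c1 (\<lambda>t. Q (tcost e1 e2 + t)) s A
      else wp c2 (\<lambda>t. Q (tcost e1 e2 + t + 2)) s A)"
proof (cases "ev e1 s A < ev e2 s A")
  case True
  then show ?thesis unfolding wp_def by (simp only: if_True) (blast intro: exec.CondT)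
next
  case False
  have "wp (Cond e1 e2 c1 c2) Q s A"
    if "safe e1 s A \<and> safe e2 s A \<and> wp c2 (\<lambda>t. Q (tcost e1 e2 + t + 2)) s A"
    using that exec.CondF[OF _ _ False] unfolding wp_def by blast
  moreover have "safe e1 s A \<and> safe e2 s A \<and> wp c2 (\<lambda>t. Q (tcost e1 e2 + t + 2)) s A"
    if "wp (Cond e1 e2 c1 c2) Q s A"
    using that False unfolding wp_def by (elim exE conjE exec_cases) (blast | simp)+
  ultimately show ?thesis unfolding if_not_P[OF False] by blast
qed

lemma wp_mono:
  assumes "wp c Q s A" "\<And>t s' A'. Q t s' A' \<Longrightarrow> Q' t s' A'"
  shows "wp c Q' s A"
  using assms unfolding wp_def by blast

text \<open>The measure bounds the number of rounds; the \<open>+ 1\<close> accounts for the last,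
  failing test. The measure need not drop by exactly one, which the worklist exploits.\<close>

lemma wp_While:
  fixes f :: "store \<Rightarrow> arrays \<Rightarrow> nat"
  assumes "I s A"
    and "\<And>s A. I s A \<Longrightarrow> safe e1 s A \<and> safe e2 s A"
    and "\<And>s A. I s A \<Longrightarrow> ev e1 s A < ev e2 s A \<Longrightarrow>
      wp c (\<lambda>t s' A'. t \<le> T \<and> I s' A' \<and> f s' A' < f s A) s A"
  shows "wp (While e1 e2 c) (\<lambda>t s' A'. t \<le> (T + tcost e1 e2 + 2) * (f s A + 1) \<and>
    I s' A' \<and> \<not> ev e1 s' A' < ev e2 s' A') s A"
  using assms(1)
proof (induction "f s A" arbitrary: s A rule: less_induct)
  case less
  note safe = assms(2)[OF less.prems]
  let ?C = "T + tcost e1 e2 + 2"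
  show ?case
  proof (cases "ev e1 s A < ev e2 s A")
    case False
    have "exec (While e1 e2 c) s A (tcost e1 e2 + 2) s A"
      using safe False by (blast intro: exec.WhileF)
    moreover have "tcost e1 e2 + 2 \<le> ?C * (f s A + 1)" by simp
    ultimately show ?thesis using False less.prems unfolding wp_def by blast
  next
    case True
    obtain t s' A' where 1: "exec c s A t s' A'" "t \<le> T" "I s' A'" "f s' A' < f s A"
      using assms(3)[OF less.prems True] unfolding wp_def by blast
    obtain t' s'' A'' where 2: "exec (While e1 e2 c) s' A' t' s'' A''"
      "t' \<le> ?C * (f s' A' + 1)" "I s'' A''" "\<not> ev e1 s'' A'' < ev e2 s'' A''"
      using less.hyps[OF 1(4,3)] unfolding wp_def by blast
    have "?C * (f s' A' + 1) \<le> ?C * f s A"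
      using 1(4) by (intro mult_le_mono2) simp
    then have "tcost e1 e2 + t + 2 + t' \<le> ?C * (f s A + 1)"
      using 1(2) 2(2) by (simp add: algebra_simps)
    moreover have "exec (While e1 e2 c) s A (tcost e1 e2 + t + 2 + t') s'' A''"
      using safe True 1(1) 2(1) by (blast intro: exec.WhileT)
    ultimately show ?thesis using 2(3,4) unfolding wp_def by blast
  qed
qed

fun loop_free :: "com \<Rightarrow> bool" where
  "loop_free (c1 ;; c2) \<longleftrightarrow> loop_free c1 \<and> loop_free c2"
| "loop_free (Cond e1 e2 c1 c2) \<longleftrightarrow> loop_free c1 \<and> loop_free c2"
| "loop_free (While e1 e2 c) \<longleftrightarrow> False"
| "loop_free c \<longleftrightarrow> True"

lemma exec_loop_free_le: "exec c s A t s' A' \<Longrightarrow> loop_free c \<Longrightarrow> t \<le> csize c"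
  by (induction rule: exec.induct) auto

text \<open>Separates time from function: without loops no instruction is executed twice, so the
  code length bounds the time and symbolic execution of a loop body may forget it.\<close>

lemma wp_loop_free:
  assumes "loop_free c" "wp c (\<lambda>_. Q) s A"
  shows "wp c (\<lambda>t s' A'. t \<le> csize c \<and> Q s' A') s A"
  using assms exec_loop_free_le unfolding wp_def by blast

section \<open>Cuts of skew-merged permutations and propagation of bounds\<close>

text \<open>Orders each side of the vertical line by distance from it, \<open>j\<close> being the
  nearer point. Along an arm the values move away from the horizontal line, so comparing a point
  with any point inner to it reveals in which of the two arms on its side it lies.\<close>

definition inner :: "int \<Rightarrow> int \<Rightarrow> int \<Rightarrow> bool" where
  "inner x i j \<longleftrightarrow> i < j \<and> j \<le> x \<or> x < j \<and> j < i"

text \<open>The lines between \<open>x\<close> and \<open>x + 1\<close> and between \<open>y\<close> and \<open>y + 1\<close> leave increasing points in the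
  south-west and north-east quadrants and decreasing points in the other two. The condition is
  written so that, for fixed \<open>x\<close>, it visibly confines \<open>y\<close> to an interval.\<close>

definition cut :: "(int \<Rightarrow> int) \<Rightarrow> int \<Rightarrow> int \<Rightarrow> int \<Rightarrow> bool" where
  "cut s n x y \<longleftrightarrow> (\<forall>i\<in>{1..n}. \<forall>j\<in>{1..n}. inner x i j \<longrightarrow>
     (s i < s j \<longrightarrow> s i \<le> y) \<and> (s j < s i \<longrightarrow> y < s i))"

text \<open>The part of \<open>cut\<close> that concerns the left side. It only gets harder as
  \<open>x\<close> grows, so a largest feasible \<open>x\<close> can be found by reading from the
  left end.\<close>

definition left_cut :: "(int \<Rightarrow> int) \<Rightarrow> int \<Rightarrow> int \<Rightarrow> bool" where
  "left_cut s x y \<longleftrightarrow> (\<forall>i j. 1 \<le> i \<and> i < j \<and> j \<le> x \<longrightarrow>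
     (s i < s j \<longrightarrow> s i \<le> y) \<and> (s j < s i \<longrightarrow> y < s i))"

definition side :: "int \<Rightarrow> int \<Rightarrow> int" where
  "side x i = (if i \<le> x then -1 else 1)"

definition sg :: "int \<Rightarrow> int" where
  "sg z = (if 0 < z then 1 else -1)"

definition perm_on :: "(int \<Rightarrow> int) \<Rightarrow> int \<Rightarrow> bool" where
  "perm_on s n \<longleftrightarrow> bij_betw s {1..n} {1..n}"

lemma perm_onD:
  assumes "perm_on s n"
  shows perm_on_range: "1 \<le> i \<Longrightarrow> i \<le> n \<Longrightarrow> 1 \<le> s i \<and> s i \<le> n"
    and perm_on_eq: "1 \<le> i \<Longrightarrow> i \<le> n \<Longrightarrow> 1 \<le> j \<Longrightarrow> j \<le> n \<Longrightarrow> s i = s j \<longleftrightarrow> i = j"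
proof -
  show "1 \<le> i \<Longrightarrow> i \<le> n \<Longrightarrow> 1 \<le> s i \<and> s i \<le> n"
    using assms bij_betwE[of s "{1..n}" "{1..n}"] by (auto simp: perm_on_def)
  show "1 \<le> i \<Longrightarrow> i \<le> n \<Longrightarrow> 1 \<le> j \<Longrightarrow> j \<le> n \<Longrightarrow> s i = s j \<longleftrightarrow> i = j"
    using assms by (auto simp: perm_on_def bij_betw_def inj_on_def)
qed

section \<open>Existence of a cut in a skew-merged permutation\<close>

definition merged :: "(int \<Rightarrow> int) \<Rightarrow> int \<Rightarrow> int set \<Rightarrow> bool" where
  "merged s n S \<longleftrightarrow> (\<forall>i j. 1 \<le> i \<and> i < j \<and> j \<le> n \<longrightarrow>
     (i \<in> S \<and> j \<in> S \<longrightarrow> s i < s j) \<and> (i \<notin> S \<and> j \<notin> S \<longrightarrow> s j < s i))"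

text \<open>If no increasing point of the prefix lies above a decreasing one, the former are
  south-west and the latter north-west of a line at the height of the highest increasing point. The
  contrapositive is what \<open>merged_cut\<close> uses: an inseparable prefix has an increasing
  point above a decreasing one.\<close>

lemma merged_left_cut:
  assumes perm: "perm_on s n" and S: "merged s n S" and "x \<le> n"
    and nocross: "\<And>e d. \<lbrakk>1 \<le> e; e \<le> x; 1 \<le> d; d \<le> x; e \<in> S; d \<notin> S\<rbrakk> \<Longrightarrow> s e \<le> s d"
  shows "\<exists>y. left_cut s x y"
proof -
  define y where "y = Max (insert 0 (s ` (S \<inter> {1..x})))"
  have y_ge: "s i \<le> y" if "1 \<le> i" "i \<le> x" "i \<in> S" for i
    using that by (auto simp: y_def)
  have y_less: "y < s i" if "1 \<le> i" "i \<le> x" "i \<notin> S" for i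
  proof -
    have "s e < s i" if "e \<in> S" "1 \<le> e" "e \<le> x" for e
      using nocross[of e i] perm_on_eq[OF perm, of e i] that \<open>1 \<le> i\<close> \<open>i \<le> x\<close> \<open>i \<notin> S\<close> \<open>x \<le> n\<close>
      by force
    moreover have "0 < s i" using perm_on_range[OF perm, of i] that \<open>x \<le> n\<close> by auto
    ultimately show ?thesis by (auto simp: y_def)
  qed
  have "(s i < s j \<longrightarrow> s i \<le> y) \<and> (s j < s i \<longrightarrow> y < s i)" if "1 \<le> i" "i < j" "j \<le> x" for i j
  proof -
    have m: "i \<in> S \<and> j \<in> S \<longrightarrow> s i < s j" "i \<notin> S \<and> j \<notin> S \<longrightarrow> s j < s i"
      using S that \<open>x \<le> n\<close> by (auto simp: merged_def)
    have "s i \<le> s j" if "i \<in> S" "j \<notin> S" using nocross[of i j] that \<open>1 \<le> i\<close> \<open>i < j\<close> \<open>j \<le> x\<close> by auto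
    moreover have "s j \<le> s i" if "i \<notin> S" "j \<in> S" using nocross[of j i] that \<open>1 \<le> i\<close> \<open>i < j\<close> \<open>j \<le> x\<close> by auto
    ultimately show ?thesis using m y_ge[of i] y_less[of i] that by force
  qed
  then show ?thesis unfolding left_cut_def by blast
qed

text \<open>Any \<open>x\<close> that is admissible from both sides works, because a conflict between the two sides would
  be an occurrence of 3412 or 2143.\<close>

lemma merged_cut:
  assumes perm: "perm_on s n" and S: "merged s n S" and x: "0 \<le> x" "x \<le> n"
    and left: "left_cut s x y0" and maximal: "x = n \<or> \<not> (\<exists>y. left_cut s (x + 1) y)"
  shows "\<exists>y. 0 \<le> y \<and> y \<le> n \<and> cut s n x y"
proof -
  have inc: "s i < s j" if "i \<in> S" "j \<in> S" "1 \<le> i" "i < j" "j \<le> n" for i j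
    using S that by (auto simp: merged_def)
  have dec: "s j < s i" if "i \<notin> S" "j \<notin> S" "1 \<le> i" "i < j" "j \<le> n" for i j
    using S that by (auto simp: merged_def)
  \<comment> \<open>\<open>Lo\<close> holds the points that must be below the horizontal line and
    \<open>Hi\<close> those that must be above it, so a line exists once every value of
    \<open>Lo\<close> is smaller than every value of \<open>Hi\<close>.\<close>
  define Lo where "Lo = {i\<in>{1..n}. \<exists>j\<in>{1..n}. inner x i j \<and> s i < s j}"
  define Hi where "Hi = {i\<in>{1..n}. \<exists>j\<in>{1..n}. inner x i j \<and> s j < s i}"
  have Lo_Hi: "s i < s i'" if i: "i \<in> Lo" and i': "i' \<in> Hi" for i i'
  proof -
    obtain j where j: "1 \<le> i" "i \<le> n" "1 \<le> j" "j \<le> n" "inner x i j" "s i < s j"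
      using i by (auto simp: Lo_def)
    obtain j' where j': "1 \<le> i'" "i' \<le> n" "1 \<le> j'" "j' \<le> n" "inner x i' j'" "s j' < s i'"
      using i' by (auto simp: Hi_def)
    show ?thesis
    proof (cases "i \<le> x"; cases "i' \<le> x")
      assume sides: "i \<le> x" "i' \<le> x"
      then have "s i \<le> y0" using left j by (auto simp: left_cut_def inner_def)
      moreover have "y0 < s i'" using left j' sides by (auto simp: left_cut_def inner_def)
      ultimately show ?thesis by simp
    next
      assume "\<not> i \<le> x" "\<not> i' \<le> x"
      then have right: "x < j" "j < i" "x < j'" "j' < i'" using j j' by (auto simp: inner_def)
      then have "x + 1 \<le> n" "x \<noteq> n" using j by auto
      \<comment> \<open>Maximality of \<open>x\<close> enters here. Both points have index at most
        \<open>x + 1\<close>, so to the right of \<open>x\<close> decreasing points are no higher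
        than \<open>d\<close> and increasing ones no lower than \<open>e\<close>; this separates the
        right side.\<close>
      then obtain e d where ed: "1 \<le> e" "e \<le> x + 1" "1 \<le> d" "d \<le> x + 1" "e \<in> S" "d \<notin> S" "s d < s e"
        using maximal merged_left_cut[OF perm S] by (meson not_le)
      have D: "s z \<le> s d" if "z \<notin> S" "x < z" "z \<le> n" for z
        using dec[of d z] ed that by (cases "d = z") auto
      have I: "s e \<le> s z" if "z \<in> S" "x < z" "z \<le> n" for z
        using inc[of e z] ed that by (cases "e = z") auto
      have "s i \<le> s d"
        using D[of i] D[of j] inc[of j i] right j by force
      moreover have "s e \<le> s i'"
        using I[of i'] I[of j'] dec[of j' i'] right j' by force
      ultimately show ?thesis using ed by simp
    next
      assume "i \<le> x" "\<not> i' \<le> x"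
      then have pos: "i < j" "j < j'" "j' < i'" using j j' by (auto simp: inner_def)
      show ?thesis
      proof (rule ccontr)
        assume "\<not> s i < s i'"
        then have "s i' < s i" using perm_on_eq[OF perm, of i i'] pos j j' by force
        \<comment> \<open>The points \<open>i\<close>, \<open>j\<close>, \<open>j'\<close>,
          \<open>i'\<close> now form 3412. Each ascent has a member of \<open>S\<close>, yet the
          left ascent lies above the right one.\<close>
        obtain z where "z \<in> {i, j}" "z \<in> S" using dec[of i j] pos j by force
        moreover obtain z' where "z' \<in> {i', j'}" "z' \<in> S" using dec[of j' i'] pos j' by force
        ultimately show False using inc[of z z'] pos j j' \<open>s i' < s i\<close> by force
      qed
    next
      assume "\<not> i \<le> x" "i' \<le> x"
      then have pos: "i' < j'" "j' < j" "j < i" using j j' by (auto simp: inner_def)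
      show ?thesis
      proof (rule ccontr)
        assume "\<not> s i < s i'"
        then have "s i' < s i" using perm_on_eq[OF perm, of i i'] pos j j' by force
        \<comment> \<open>Here \<open>i'\<close>, \<open>j'\<close>, \<open>j\<close>,
          \<open>i\<close> form 2143, and each descent has a point outside \<open>S\<close>.\<close>
        obtain z where "z \<in> {i, j}" "z \<notin> S" using inc[of j i] pos j by force
        moreover obtain z' where "z' \<in> {i', j'}" "z' \<notin> S" using inc[of i' j'] pos j' by force
        ultimately show False using dec[of z' z] pos j j' \<open>s i' < s i\<close> by force
      qed
    qed
  qed
  define y where "y = Max (insert 0 (s ` Lo))"
  have "Lo \<subseteq> {1..n}" by (auto simp: Lo_def)
  then have fin: "finite (insert 0 (s ` Lo))" using finite_subset by auto
  have "y \<in> insert 0 (s ` Lo)" unfolding y_def using fin by (intro Max_in) auto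
  moreover have "0 < s i" if "i \<in> Hi" for i
    using perm_on_range[OF perm, of i] that by (auto simp: Hi_def)
  ultimately have less: "y < s i" if "i \<in> Hi" for i
    using Lo_Hi that by blast
  have "0 \<le> s i \<and> s i \<le> n" if "i \<in> Lo" for i
    using perm_on_range[OF perm, of i] that by (auto simp: Lo_def)
  then have range: "0 \<le> y \<and> y \<le> n"
    using \<open>y \<in> insert 0 (s ` Lo)\<close> x by auto
  have "s i \<le> y" if "i \<in> Lo" for i using fin that by (auto simp: y_def)
  then have "cut s n x y" using less unfolding cut_def Lo_def Hi_def by blast
  then show ?thesis using range by blast
qed

section \<open>Constraints between the arms and their solutions\<close>

lemma less_if_step_less:
  fixes h :: "int \<Rightarrow> int" and k :: int
  assumes "\<And>i. \<lbrakk>1 \<le> i; i + 1 \<le> k\<rbrakk> \<Longrightarrow> h i < h (i + 1)" "1 \<le> i" "i < j" "j \<le> k"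
  shows "h i < h j"
proof -
  have "i + 1 \<le> j" using assms by simp
  then show ?thesis using assms(4)
  proof (induction j rule: int_ge_induct)
    case base
    then show ?case using assms(1)[of i] assms(2) by simp
  next
    case (step j)
    then show ?case using assms(1)[of j] assms(2) by simp
  qed
qed

text \<open>An arm is a pair of signs \<open>(sx, sy)\<close>; its bounds are kept in array \<open>aid sx sy\<close>. In the locale, \<open>G\<close> is the
  text with its centre inserted as an extra point at index \<open>g\<close>, and \<open>Q\<close> is the inverse of the pattern \<open>P\<close>.\<close>

definition aid :: "int \<Rightarrow> int \<Rightarrow> nat" where
  "aid sx sy = (if sx = 1 then 6 else 4) + (if sy = 1 then 1 else 0)"

locale matching =
  fixes G :: "int \<Rightarrow> int" and g n :: int and P Q :: "int \<Rightarrow> int" and k :: int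
  assumes g: "0 \<le> g" "g \<le> n"
    and G_centre: "\<And>j. \<lbrakk>0 \<le> j; j \<le> n; j \<noteq> g\<rbrakk> \<Longrightarrow> G j \<noteq> G g"
    and arm_mono: "\<And>sx sy i j. \<lbrakk>sx \<in> {1, -1}; sy \<in> {1, -1}; 0 \<le> i; i \<le> n; 0 \<le> j; j \<le> n;
      0 < sx * (i - g); sx * i < sx * j; sy * G g < sy * G i; sy * G g < sy * G j\<rbrakk>
      \<Longrightarrow> sy * G i < sy * G j"
    and perm: "perm_on P k"
    and Q: "\<And>v. \<lbrakk>1 \<le> v; v \<le> k\<rbrakk> \<Longrightarrow> 1 \<le> Q v \<and> Q v \<le> k \<and> P (Q v) = v"
begin

lemma Q_P: "1 \<le> p \<Longrightarrow> p \<le> k \<Longrightarrow> Q (P p) = p"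
  using perm_on_range[OF perm, of p] Q[of "P p"] perm_on_eq[OF perm, of p "Q (P p)"] by auto

definition embed :: "(int \<Rightarrow> int) \<Rightarrow> bool" where
  "embed f \<longleftrightarrow> (\<forall>p\<in>{1..k}. 0 \<le> f p \<and> f p \<le> n \<and> f p \<noteq> g) \<and>
     (\<forall>p\<in>{1..k}. \<forall>q\<in>{1..k}. (p < q \<longrightarrow> f p < f q) \<and> (P p < P q \<longrightarrow> G (f p) < G (f q)))"

definition splits_at :: "(int \<Rightarrow> int) \<Rightarrow> int \<Rightarrow> int \<Rightarrow> bool" where
  "splits_at f px py \<longleftrightarrow> (\<forall>p\<in>{1..k}. (p \<le> px \<longleftrightarrow> f p < g) \<and> (P p \<le> py \<longleftrightarrow> G (f p) < G g))"

text \<open>\<open>A (aid sx sy) p\<close> is the outermost text index to which \<open>p\<close> may be mapped if it belongs to the arm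
  \<open>(sx, sy)\<close>, and \<open>g\<close> if there is none. The arm of an outward neighbour of \<open>p\<close> depends only on the arm
  of \<open>p\<close> and the relative position of the two points, not on the cut. The vertical condition ignores
  a neighbour whose current bound lies outside its arm, since the value there means nothing.\<close>

definition ok :: "arrays \<Rightarrow> int \<Rightarrow> int \<Rightarrow> int \<Rightarrow> bool" where
  "ok A sx sy p \<longleftrightarrow> (let u = A (aid sx sy) p in u = g \<or>
     sy * G g < sy * G u \<and>
     (1 \<le> p + sx \<and> p + sx \<le> k \<longrightarrow>
        sx * u < sx * A (aid sx (sg (P (p + sx) - P p))) (p + sx)) \<and>
     (1 \<le> P p + sy \<and> P p + sy \<le> k \<longrightarrow>
        (let q = Q (P p + sy); w = G (A (aid (sg (q - p)) sy) q)
         in \<not> (sy * G g \<le> sy * w \<and> sy * w \<le> sy * G u))))"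

definition in_range :: "arrays \<Rightarrow> bool" where
  "in_range A \<longleftrightarrow> (\<forall>p\<in>{1..k}. \<forall>sx\<in>{1,-1}. \<forall>sy\<in>{1,-1}.
     0 \<le> A (aid sx sy) p \<and> A (aid sx sy) p \<le> n \<and> 0 \<le> sx * (A (aid sx sy) p - g))"

text \<open>The bounds must not lose an embedding. Only the arm that the pulled-back lines assign to
  a point is compared, since the embedding gives no information about its other three arms.\<close>

definition covers :: "arrays \<Rightarrow> bool" where
  "covers A \<longleftrightarrow> (\<forall>f px py. embed f \<and> splits_at f px py \<longrightarrow>
     (\<forall>p\<in>{1..k}. 0 \<le> side px p * (A (aid (side px p) (side py (P p))) p - f p)))"

definition stable :: "arrays \<Rightarrow> bool" where
  "stable A \<longleftrightarrow> (\<forall>p\<in>{1..k}. \<forall>sx\<in>{1,-1}. \<forall>sy\<in>{1,-1}. ok A sx sy p)"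

definition accepting :: "arrays \<Rightarrow> int \<Rightarrow> int \<Rightarrow> bool" where
  "accepting A px py \<longleftrightarrow> cut P k px py \<and>
     (\<forall>p\<in>{1..k}. A (aid (side px p) (side py (P p))) p \<noteq> g)"

lemma side_cases: "side x i \<in> {1, -1}"
  by (simp add: side_def)

text \<open>The point \<open>p\<close> is inner to its outward horizontal neighbour, so
  \<open>cut\<close> decides the arm of the neighbour by comparison with \<open>p\<close>.\<close>

lemma arm_x:
  assumes "cut P k px py" "1 \<le> p" "p \<le> k" "q = p + side px p" "1 \<le> q" "q \<le> k"
  shows "side px q = side px p" "side py (P q) = sg (P q - P p)"
proof -
  show "side px q = side px p" using assms(4) by (auto simp: side_def split: if_splits)
  have "inner px q p" using assms(4) by (auto simp: side_def inner_def split: if_splits)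
  then have "P q < P p \<longrightarrow> P q \<le> py" "P p < P q \<longrightarrow> py < P q"
    using assms unfolding cut_def by (metis atLeastAtMost_iff)+
  moreover have "P q \<noteq> P p"
    using perm_on_eq[OF perm, of p q] assms by (auto simp: side_def)
  ultimately show "side py (P q) = sg (P q - P p)" by (auto simp: side_def sg_def)
qed

text \<open>If the outward vertical neighbour were inner to \<open>p\<close>, then
  \<open>cut\<close> would put \<open>p\<close> on the other side of the horizontal line. So the
  neighbour is not between \<open>p\<close> and the vertical line, and the direction in which it
  lies from \<open>p\<close> is its side.\<close>

lemma arm_y:
  assumes "cut P k px py" "1 \<le> p" "p \<le> k" "1 \<le> P p + side py (P p)" "P p + side py (P p) \<le> k"
    and q: "q = Q (P p + side py (P p))"
  shows "side py (P q) = side py (P p)" "side px q = sg (q - p)"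
proof -
  have Pq: "1 \<le> q" "q \<le> k" "P q = P p + side py (P p)" using Q[OF assms(4,5)] q by auto
  then show "side py (P q) = side py (P p)" by (auto simp: side_def split: if_splits)
  have "q \<noteq> p" using Pq(3) by (auto simp: side_def split: if_splits)
  have "\<not> inner px p q"
  proof
    assume "inner px p q"
    then have "P p < P q \<longrightarrow> P p \<le> py" "P q < P p \<longrightarrow> py < P p"
      using assms(1-3) Pq unfolding cut_def by (metis atLeastAtMost_iff)+
    then show False using Pq(3) by (auto simp: side_def split: if_splits)
  qed
  then show "side px q = sg (q - p)" using \<open>q \<noteq> p\<close> by (auto simp: side_def sg_def inner_def)
qed

text \<open>Order needs checking only between consecutive indices and consecutive values. A pair on
  one side of a line is handled by stability of its inner point, a pair separated by the line by the
  sides of the two images.\<close>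

lemma embed_if_accepting:
  assumes "stable A" "in_range A" "accepting A px py"
  shows "embed (\<lambda>p. A (aid (side px p) (side py (P p))) p)" (is "embed ?f")
proof -
  have cut: "cut P k px py" and nz: "\<And>p. 1 \<le> p \<Longrightarrow> p \<le> k \<Longrightarrow> ?f p \<noteq> g"
    using assms(3) by (auto simp: accepting_def)
  have ok: "ok A (side px p) (side py (P p)) p" if "1 \<le> p" "p \<le> k" for p
    using assms(1) side_cases that unfolding stable_def by (metis atLeastAtMost_iff)
  have rng: "0 \<le> ?f p" "?f p \<le> n" "0 \<le> side px p * (?f p - g)" if "1 \<le> p" "p \<le> k" for p
    using assms(2) side_cases that unfolding in_range_def by (metis atLeastAtMost_iff)+
  have x_half: "if p \<le> px then ?f p < g else g < ?f p" if "1 \<le> p" "p \<le> k" for p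
    using rng(3)[OF that] nz[OF that] by (auto simp: side_def split: if_splits)
  have y_arm: "side py (P p) * G g < side py (P p) * G (?f p)" if "1 \<le> p" "p \<le> k" for p
    using ok[OF that] nz[OF that] by (simp add: ok_def Let_def)
  have x_step: "side px p * ?f p < side px p * ?f (p + side px p)"
    if "1 \<le> p" "p \<le> k" "1 \<le> p + side px p" "p + side px p \<le> k" for p
    using ok[OF that(1,2)] nz[OF that(1,2)] arm_x[OF cut that(1,2) refl that(3,4)] that
    by (simp add: ok_def Let_def)
  have y_step: "side py (P p) * G (?f p) < side py (P p) * G (?f (Q (P p + side py (P p))))"
    if "1 \<le> p" "p \<le> k" "1 \<le> P p + side py (P p)" "P p + side py (P p) \<le> k" for p
  proof -
    let ?q = "Q (P p + side py (P p))"
    note q = arm_y[OF cut that refl] Q[OF that(3,4)]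
    \<comment> \<open>The neighbour is not void, so its own stability puts its bound inside its arm.
      This excludes the exemption in the vertical condition and leaves the strict
      inequality.\<close>
    have "side py (P p) * G g < side py (P p) * G (?f ?q)"
      using y_arm[of ?q] q by simp
    then show ?thesis
      using ok[OF that(1,2)] nz[OF that(1,2)] q that by (simp add: ok_def Let_def)
  qed
  have "?f p < ?f (p + 1)" if "1 \<le> p" "p + 1 \<le> k" for p
  proof -
    consider "px < p" | "p + 1 \<le> px" | "p \<le> px" "px < p + 1" by linarith
    then show ?thesis
    proof cases
      case 1
      then show ?thesis using x_step[of p] that by (simp add: side_def)
    next
      case 2
      then show ?thesis using x_step[of "p + 1"] that by (simp add: side_def)
    next
      case 3
      then show ?thesis using x_half[of p] x_half[of "p + 1"] that by simp
    qed
  qed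
  then have x_less: "?f p < ?f q" if "1 \<le> p" "p < q" "q \<le> k" for p q
    using less_if_step_less[where h = ?f and i = p and j = q and k = k] that by simp
  have "G (?f (Q v)) < G (?f (Q (v + 1)))" if "1 \<le> v" "v + 1 \<le> k" for v
  proof -
    have Qv: "1 \<le> Q v" "Q v \<le> k" "P (Q v) = v"
      and Qv': "1 \<le> Q (v + 1)" "Q (v + 1) \<le> k" "P (Q (v + 1)) = v + 1"
      using Q[of v] Q[of "v + 1"] that by auto
    consider "py < v" | "v + 1 \<le> py" | "v \<le> py" "py < v + 1" by linarith
    then show ?thesis
    proof cases
      case 1
      then show ?thesis using y_step[OF Qv(1,2)] that Qv by (simp add: side_def)
    next
      case 2
      then show ?thesis using y_step[OF Qv'(1,2)] that Qv' by (simp add: side_def)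
    next
      case 3
      then show ?thesis using y_arm[OF Qv(1,2)] y_arm[OF Qv'(1,2)] Qv Qv' by (simp add: side_def)
    qed
  qed
  then have "G (?f (Q v)) < G (?f (Q w))" if "1 \<le> v" "v < w" "w \<le> k" for v w
    using less_if_step_less[where h = "\<lambda>v. G (?f (Q v))" and i = v and j = w and k = k] that by simp
  then have y_less: "G (?f p) < G (?f q)" if "1 \<le> p" "p \<le> k" "1 \<le> q" "q \<le> k" "P p < P q" for p q
    using that perm_on_range[OF perm, of p] perm_on_range[OF perm, of q] Q_P by metis
  show ?thesis unfolding embed_def using rng nz x_less y_less by auto
qed

lemma embedD:
  assumes "embed f" "1 \<le> p" "p \<le> k"
  shows "0 \<le> f p" "f p \<le> n" "f p \<noteq> g" "G (f p) \<noteq> G g"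
    and "\<lbrakk>p < q; q \<le> k\<rbrakk> \<Longrightarrow> f p < f q"
    and "\<lbrakk>1 \<le> q; q \<le> k; P p < P q\<rbrakk> \<Longrightarrow> G (f p) < G (f q)"
  using assms G_centre[of "f p"] by (auto simp: embed_def)

lemma splits_atD:
  assumes "splits_at f px py" "1 \<le> p" "p \<le> k"
  shows "p \<le> px \<longleftrightarrow> f p < g" "P p \<le> py \<longleftrightarrow> G (f p) < G g"
  using assms by (auto simp: splits_at_def)

text \<open>An embedding keeps the order of distance from the vertical line on each side. A violated
  cut condition would thus give two image points in one arm of the text whose heights contradict
  \<open>arm_mono\<close>.\<close>

lemma cut_if_embed:
  assumes f: "embed f" and split: "splits_at f px py"
  shows "cut P k px py"
proof -
  have order: "f i < f j \<and> f j < g \<or> g < f j \<and> f j < f i"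
    if "1 \<le> i" "i \<le> k" "1 \<le> j" "j \<le> k" "inner px i j" for i j
  proof (cases "i < j")
    case True
    then have "j \<le> px" using that(5) by (auto simp: inner_def)
    then show ?thesis using embedD(5)[OF f that(1,2) True that(4)] splits_atD(1)[OF split that(3,4)]
      by simp
  next
    case False
    then have "j < i" "\<not> j \<le> px" using that(5) by (auto simp: inner_def)
    then show ?thesis
      using embedD(5)[OF f that(3,4) _ that(2)] embedD(3)[OF f that(3,4)] splits_atD(1)[OF split that(3,4)]
      by simp
  qed
  have "P i \<le> py" if ij: "1 \<le> i" "i \<le> k" "1 \<le> j" "j \<le> k" "inner px i j" "P i < P j" for i j
  proof (rule ccontr)
    assume "\<not> P i \<le> py"
    then have "G g < G (f i)" "G (f i) < G (f j)"
      using splits_atD(2)[OF split ij(1,2)] embedD(4)[OF f ij(1,2)] embedD(6)[OF f ij(1,2,3,4,6)]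
      by simp_all
    then show False
      using arm_mono[of "-1" 1 "f j" "f i"] arm_mono[of 1 1 "f j" "f i"] order[OF ij(1-5)]
        embedD(1,2)[OF f ij(1,2)] embedD(1,2)[OF f ij(3,4)] by auto
  qed
  moreover have "py < P i" if ij: "1 \<le> i" "i \<le> k" "1 \<le> j" "j \<le> k" "inner px i j" "P j < P i" for i j
  proof (rule ccontr)
    assume "\<not> py < P i"
    then have "G (f i) < G g" "G (f j) < G (f i)"
      using splits_atD(2)[OF split ij(1,2)] embedD(6)[OF f ij(3,4,1,2,6)] by simp_all
    then show False
      using arm_mono[of "-1" "-1" "f j" "f i"] arm_mono[of 1 "-1" "f j" "f i"] order[OF ij(1-5)]
        embedD(1,2)[OF f ij(1,2)] embedD(1,2)[OF f ij(3,4)] by auto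
  qed
  ultimately show ?thesis unfolding cut_def by auto
qed

lemma splits_at_exists:
  assumes "embed f" "0 \<le> k"
  shows "\<exists>px py. 0 \<le> px \<and> px \<le> k \<and> 0 \<le> py \<and> py \<le> k \<and> splits_at f px py"
proof -
  \<comment> \<open>The inserted 0 stands for a line before all points, for the case that no image
    lies left of the centre; likewise for \<open>py\<close>.\<close>
  define px where "px = Max (insert 0 {p\<in>{1..k}. f p < g})"
  define py where "py = Max (insert 0 (P ` {p\<in>{1..k}. G (f p) < G g}))"
  have fin: "finite {p\<in>{1..k}. f p < g}" "finite {p\<in>{1..k}. G (f p) < G g}"
    by (rule finite_subset[of _ "{1..k}"]; auto)+
  have px_in: "px \<in> insert 0 {p\<in>{1..k}. f p < g}"
    unfolding px_def using fin by (intro Max_in) auto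
  have py_in: "py \<in> insert 0 (P ` {p\<in>{1..k}. G (f p) < G g})"
    unfolding py_def using fin by (intro Max_in) auto
  have "p \<le> px \<longleftrightarrow> f p < g" if "p \<in> {1..k}" for p
  proof
    assume "p \<le> px"
    then have "1 \<le> px" "px \<le> k" "f px < g" "p = px \<or> p < px" using px_in that by auto
    then show "f p < g" using embedD(5)[OF assms(1), of p px] that by auto
  next
    assume "f p < g"
    then show "p \<le> px" unfolding px_def using fin that by (intro Max_ge) auto
  qed
  moreover have "P p \<le> py \<longleftrightarrow> G (f p) < G g" if "p \<in> {1..k}" for p
  proof
    assume le: "P p \<le> py"
    have "1 \<le> P p" using perm_on_range[OF perm, of p] that by auto
    then obtain q where q: "q \<in> {1..k}" "G (f q) < G g" "P p \<le> P q" using py_in le by auto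
    then have "P p < P q \<or> p = q" using perm_on_eq[OF perm, of p q] that by auto
    then show "G (f p) < G g" using q that embedD(6)[OF assms(1), of p q] by auto
  next
    assume "G (f p) < G g"
    then show "P p \<le> py" unfolding py_def using fin that by (intro Max_ge) auto
  qed
  moreover have "0 \<le> px" "px \<le> k" "0 \<le> py" "py \<le> k"
    using px_in py_in assms(2) perm_on_range[OF perm] by fastforce+
  ultimately show ?thesis unfolding splits_at_def by blast
qed

lemma accepting_if_embed:
  assumes "covers A" "embed f" "0 \<le> k"
  shows "\<exists>px py. 0 \<le> px \<and> px \<le> k \<and> 0 \<le> py \<and> py \<le> k \<and> accepting A px py"
proof -
  obtain px py where pxy: "0 \<le> px" "px \<le> k" "0 \<le> py" "py \<le> k" and split: "splits_at f px py"
    using splits_at_exists[OF assms(2,3)] by blast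
  have "A (aid (side px p) (side py (P p))) p \<noteq> g" if p: "p \<in> {1..k}" for p
  proof -
    have "0 \<le> side px p * (A (aid (side px p) (side py (P p))) p - f p)"
      using assms(1,2) split p unfolding covers_def by blast
    moreover have "p \<le> px \<longleftrightarrow> f p < g" "f p \<noteq> g"
      using splits_atD(1)[OF split, of p] embedD(3)[OF assms(2), of p] p by auto
    ultimately show ?thesis by (auto simp: side_def split: if_splits)
  qed
  then have "accepting A px py"
    using cut_if_embed[OF assms(2) split] by (simp add: accepting_def)
  then show ?thesis using pxy by blast
qed

lemma accepting_iff_embed:
  assumes "stable A" "in_range A" "covers A" "0 \<le> k"
  shows "(\<exists>px py. 0 \<le> px \<and> px \<le> k \<and> 0 \<le> py \<and> py \<le> k \<and> accepting A px py) \<longleftrightarrow> (\<exists>f. embed f)"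
  using embed_if_accepting[OF assms(1,2)] accepting_if_embed[OF assms(3) _ assms(4)] by blast

section \<open>Lowering a bound\<close>

definition lower :: "arrays \<Rightarrow> int \<Rightarrow> int \<Rightarrow> int \<Rightarrow> arrays" where
  "lower A sx sy p = A(aid sx sy := (A (aid sx sy))(p := A (aid sx sy) p - sx))"

lemma aid_eq_iff:
  "\<lbrakk>sx \<in> {1,-1}; sy \<in> {1,-1}; sx' \<in> {1,-1}; sy' \<in> {1,-1}\<rbrakk> \<Longrightarrow>
     aid sx sy = aid sx' sy' \<longleftrightarrow> sx = sx' \<and> sy = sy'"
  by (auto simp: aid_def)

lemma in_range_lower:
  assumes "in_range A" "sx \<in> {1,-1}" "sy \<in> {1,-1}" "A (aid sx sy) p \<noteq> g"
  shows "in_range (lower A sx sy p)"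
  unfolding in_range_def
proof (intro ballI)
  fix q sx' sy' :: int assume *: "q \<in> {1..k}" "sx' \<in> {1,-1}" "sy' \<in> {1,-1}"
  let ?u = "A (aid sx' sy') q"
  have "0 \<le> ?u \<and> ?u \<le> n \<and> 0 \<le> sx' * (?u - g)"
    using assms(1) * unfolding in_range_def by blast
  then show "0 \<le> lower A sx sy p (aid sx' sy') q \<and> lower A sx sy p (aid sx' sy') q \<le> n \<and>
      0 \<le> sx' * (lower A sx sy p (aid sx' sy') q - g)"
    using assms(2-4) * g
    by (cases "sx' = sx \<and> sy' = sy \<and> q = p") (auto simp: lower_def aid_eq_iff)
qed

text \<open>If some embedding placed \<open>p\<close> exactly at its bound, that embedding would
  witness \<open>ok\<close>: its images of the neighbours are far enough out, and their bounds are
  no further in. So a violated bound is attained by no embedding and may move one step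
  inwards.\<close>

lemma covers_lower:
  assumes "in_range A" "covers A" and s: "sx \<in> {1,-1}" "sy \<in> {1,-1}"
    and p: "1 \<le> p" "p \<le> k" and bad: "\<not> ok A sx sy p"
  shows "covers (lower A sx sy p)"
  unfolding covers_def
proof (intro allI impI ballI)
  fix f px py r assume f: "embed f \<and> splits_at f px py" and r: "r \<in> {1..k}"
  have split: "splits_at f px py" and emb: "embed f" using f by auto
  have cut: "cut P k px py" using cut_if_embed f by blast
  have cov: "0 \<le> side px q * (A (aid (side px q) (side py (P q))) q - f q)" if "1 \<le> q" "q \<le> k" for q
    using assms(2) f that unfolding covers_def by auto
  show "0 \<le> side px r * (lower A sx sy p (aid (side px r) (side py (P r))) r - f r)"
  proof (cases "r = p \<and> side px p = sx \<and> side py (P p) = sy")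
    case False
    then have "lower A sx sy p (aid (side px r) (side py (P r))) r = A (aid (side px r) (side py (P r))) r"
      using side_cases s by (auto simp: lower_def aid_eq_iff)
    then show ?thesis using cov r by auto
  next
    case True
    let ?u = "A (aid sx sy) p"
    have "?u \<noteq> f p"
    proof
      assume u: "?u = f p"
      have fp: "0 \<le> f p" "f p \<le> n" "f p \<noteq> g" "p \<le> px \<longleftrightarrow> f p < g" "P p \<le> py \<longleftrightarrow> G (f p) < G g"
        using embedD[OF emb p] splits_atD[OF split p] by auto
      have arm: "sy * G g < sy * G (f p)"
        using True fp G_centre[OF fp(1-3)] by (auto simp: side_def split: if_splits)
      have x: "sx * f p < sx * A (aid sx (sg (P (p + sx) - P p))) (p + sx)"
        if q: "1 \<le> p + sx" "p + sx \<le> k"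
      proof -
        have eq: "side px (p + sx) = sx" "side py (P (p + sx)) = sg (P (p + sx) - P p)"
          using arm_x[OF cut p refl] True q by auto
        have "0 \<le> sx * (A (aid sx (sg (P (p + sx) - P p))) (p + sx) - f (p + sx))"
          using cov[OF q] eq by simp
        moreover have "sx * f p < sx * f (p + sx)"
          using embedD(5)[OF emb p, of "p + sx"] embedD(5)[OF emb q, of p] p q s by auto
        ultimately show ?thesis by (simp add: right_diff_distrib)
      qed
      have y: "\<not> (sy * G g \<le> sy * w \<and> sy * w \<le> sy * G (f p))"
        if v: "1 \<le> P p + sy" "P p + sy \<le> k" and q: "q = Q (P p + sy)"
          and w: "w = G (A (aid (sg (q - p)) sy) q)" for q w
      proof -
        have eq: "side py (P q) = sy" "side px q = sg (q - p)"
          using arm_y[OF cut p, of q] True v q by auto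
        have Pq: "1 \<le> q" "q \<le> k" "P q = P p + sy" using Q[OF v] q by auto
        have fq: "0 \<le> f q" "f q \<le> n" "f q \<noteq> g" "q \<le> px \<longleftrightarrow> f q < g" "P q \<le> py \<longleftrightarrow> G (f q) < G g"
          using embedD[OF emb Pq(1,2)] splits_atD[OF split Pq(1,2)] by auto
        let ?z = "A (aid (sg (q - p)) sy) q" and ?sq = "sg (q - p)"
        have sq: "?sq \<in> {1,-1}" by (simp add: sg_def)
        have z: "0 \<le> ?z" "?z \<le> n"
          using assms(1) s(2) sq Pq unfolding in_range_def by (metis atLeastAtMost_iff)+
        have z_beyond: "0 \<le> ?sq * (?z - f q)" using cov[OF Pq(1,2)] eq by simp
        have fq_side: "0 < ?sq * (f q - g)"
          unfolding eq(2)[symmetric] using fq by (auto simp: side_def)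
        have fq_arm: "sy * G g < sy * G (f q)"
          using eq(1) fq G_centre[OF fq(1-3)] by (auto simp: side_def split: if_splits)
        have fp_fq: "sy * G (f p) < sy * G (f q)"
          using embedD(6)[OF emb p Pq(1,2)] embedD(6)[OF emb Pq(1,2) p] Pq(3) s by auto
        \<comment> \<open>The bound of \<open>q\<close> is at least as far out horizontally as the
          image of \<open>q\<close>. If it is also on the correct side of the horizontal line, both
          lie in one arm, and further out means further from that line.\<close>
        have "sy * G (f q) \<le> sy * w" if "sy * G g \<le> sy * w"
        proof (cases "?z = f q")
          case False
          have "?z \<noteq> g" using z_beyond fq_side sq by auto
          then have "sy * G g < sy * G ?z"
            using that w G_centre[OF z] s(2) by auto
          moreover have "?sq * f q < ?sq * ?z" using z_beyond False sq by auto
          ultimately show ?thesis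
            using arm_mono[OF sq s(2) fq(1,2) z fq_side _ fq_arm] w by simp
        qed (simp add: w)
        then show ?thesis using fp_fq by linarith
      qed
      have "ok A sx sy p" unfolding ok_def Let_def u using arm x y by blast
      then show False using bad by blast
    qed
    then show ?thesis using cov[OF p] True s by (auto simp: lower_def)
  qed
qed

text \<open>The number of inward steps that all bounds together can still make.\<close>

definition potential :: "arrays \<Rightarrow> nat" where
  "potential A = (\<Sum>(p, sx, sy)\<in>{1..k} \<times> {1,-1} \<times> {1,-1}. nat (sx * (A (aid sx sy) p - g)))"

lemma potential_lower:
  assumes "in_range A" "sx \<in> {1,-1}" "sy \<in> {1,-1}" "1 \<le> p" "p \<le> k" "A (aid sx sy) p \<noteq> g"
  shows "potential (lower A sx sy p) < potential A"
  unfolding potential_def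
proof (rule sum_strict_mono_ex1)
  have "0 \<le> sx * (A (aid sx sy) p - g)" using assms by (auto simp: in_range_def)
  then have less: "nat (sx * (lower A sx sy p (aid sx sy) p - g)) < nat (sx * (A (aid sx sy) p - g))"
    using assms(2,6) by (auto simp: lower_def)
  then show "\<exists>a\<in>{1..k} \<times> {1, - 1} \<times> {1, - 1}.
       (case a of (p', sx', sy') \<Rightarrow> nat (sx' * (lower A sx sy p (aid sx' sy') p' - g)))
       < (case a of (p, sx, sy) \<Rightarrow> nat (sx * (A (aid sx sy) p - g)))"
    using assms by (intro bexI[of _ "(p, sx, sy)"]) auto
  show "\<forall>x\<in>{1..k} \<times> {1, - 1} \<times> {1, - 1}.
       (case x of (p', sx', sy') \<Rightarrow> nat (sx' * (lower A sx sy p (aid sx' sy') p' - g)))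
       \<le> (case x of (p, sx, sy) \<Rightarrow> nat (sx * (A (aid sx sy) p - g)))"
  proof clarify
    fix p' sx' sy' :: int assume "sx' \<in> {1,-1}" "sy' \<in> {1,-1}"
    then show "nat (sx' * (lower A sx sy p (aid sx' sy') p' - g)) \<le> nat (sx' * (A (aid sx' sy') p' - g))"
      using less assms(2,3)
      by (cases "sx' = sx \<and> sy' = sy \<and> p' = p") (auto simp: lower_def aid_eq_iff)
  qed
qed simp

lemma potential_le:
  assumes "in_range A" "0 \<le> k"
  shows "potential A \<le> 4 * nat k * nat n"
proof -
  have "potential A \<le> of_nat (card ({1..k} \<times> {1::int,-1} \<times> {1::int,-1})) * nat n"
    unfolding potential_def
  proof (rule sum_bounded_above, clarify)
    fix p sx sy :: int assume *: "p \<in> {1..k}" "sx \<in> {1,-1}" "sy \<in> {1,-1}"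
    then have "0 \<le> A (aid sx sy) p \<and> A (aid sx sy) p \<le> n"
      using assms(1) unfolding in_range_def by blast
    then show "nat (sx * (A (aid sx sy) p - g)) \<le> nat n" using *(2) g by auto
  qed
  then show ?thesis by (simp add: card_cartesian_product algebra_simps)
qed

text \<open>Besides \<open>p\<close>, only its two neighbours by index and its two neighbours by
  value consult the bounds of \<open>p\<close>. These five points are what a change has to put back
  on the stack.\<close>

lemma ok_cong:
  assumes "\<And>j r. r \<noteq> p \<Longrightarrow> j \<in> {4..7} \<Longrightarrow> A' j r = A j r" and s: "sx \<in> {1,-1}" "sy \<in> {1,-1}"
    and p: "1 \<le> p" "p \<le> k" and q: "1 \<le> q" "q \<le> k"
    and "q \<notin> {p, p + 1, p - 1, Q (P p + 1), Q (P p - 1)}"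
  shows "ok A' sx sy q \<longleftrightarrow> ok A sx sy q"
proof -
  have A: "A' (aid sx' sy') r = A (aid sx' sy') r" if "r \<noteq> p" for sx' sy' r
    using assms(1) that by (simp add: aid_def)
  have "q + sx \<noteq> p" using s assms(8) by auto
  moreover have "Q (P q + sy) \<noteq> p" if "1 \<le> P q + sy" "P q + sy \<le> k"
  proof
    assume "Q (P q + sy) = p"
    then have "P p = P q + sy" using Q[OF that] by auto
    then have "q = Q (P p - sy)" using Q_P[OF q] by simp
    then show False using s assms(8) by auto
  qed
  ultimately show ?thesis unfolding ok_def Let_def using A assms(8) by auto
qed

end

section \<open>Finding cuts\<close>

lemma wp_SeqI:
  assumes "wp c1 R s A" "\<And>t s' A'. R t s' A' \<Longrightarrow> wp c2 (\<lambda>t'. Q (t + t')) s' A'"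
  shows "wp (c1 ;; c2) Q s A"
  using wp_mono[OF assms(1)] assms(2) by simp

definition eq_off :: "nat set \<Rightarrow> store \<Rightarrow> store \<Rightarrow> bool" where
  "eq_off X s s' \<longleftrightarrow> (\<forall>z. z \<notin> X \<longrightarrow> s' z = s z)"

lemma eq_off_refl [simp]: "eq_off X s s"
  by (simp add: eq_off_def)

lemma eq_off_trans: "eq_off X s s' \<Longrightarrow> eq_off Y s' s'' \<Longrightarrow> X \<subseteq> Z \<Longrightarrow> Y \<subseteq> Z \<Longrightarrow> eq_off Z s s''"
  unfolding eq_off_def by (metis subsetD)

lemma eq_off_upd [simp]: "z \<in> X \<Longrightarrow> eq_off X s (s'(z := v)) \<longleftrightarrow> eq_off X s s'"
  by (auto simp: eq_off_def)

lemma eq_offD: "eq_off X s s' \<Longrightarrow> z \<notin> X \<Longrightarrow> s' z = s z"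
  by (simp add: eq_off_def)

text \<open>Arrays: 0 input, 1 text with centre, 2 inverse pattern, 3 work stack, 4 to 7 bounds of the arms.\<close>

abbreviation (input) vOut :: nat where "vOut \<equiv> 0"
abbreviation (input) vN :: nat where "vN \<equiv> 20"
abbreviation (input) vK :: nat where "vK \<equiv> 2"
abbreviation (input) vOff :: nat where "vOff \<equiv> 3"
abbreviation (input) vX :: nat where "vX \<equiv> 4"
abbreviation (input) vI :: nat where "vI \<equiv> 5"
abbreviation (input) vA :: nat where "vA \<equiv> 6"
abbreviation (input) vB :: nat where "vB \<equiv> 7"
abbreviation (input) vMax :: nat where "vMax \<equiv> 8"
abbreviation (input) vMin :: nat where "vMin \<equiv> 9"
abbreviation (input) vV :: nat where "vV \<equiv> 10"
abbreviation (input) vLen :: nat where "vLen \<equiv> 11"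
abbreviation (input) vG :: nat where "vG \<equiv> 12"
abbreviation (input) vU :: nat where "vU \<equiv> 13"
abbreviation (input) vQ :: nat where "vQ \<equiv> 14"
abbreviation (input) vW :: nat where "vW \<equiv> 15"
abbreviation (input) vBad :: nat where "vBad \<equiv> 16"
abbreviation (input) vChg :: nat where "vChg \<equiv> 17"
abbreviation (input) vSp :: nat where "vSp \<equiv> 18"
abbreviation (input) vP :: nat where "vP \<equiv> 19"

abbreviation inc :: "nat \<Rightarrow> com" where
  "inc x \<equiv> x ::= Plus (V x) (N 1)"

abbreviation (input) upon :: "exp \<Rightarrow> exp \<Rightarrow> com \<Rightarrow> com" where
  "upon e1 e2 c \<equiv> Cond e1 e2 c Skip"

text \<open>In a prefix admitting a cut every point is below or above all its successors, so no earlier value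
  lies strictly between \<open>a\<close> and \<open>b\<close>; hence only the last point matters when the prefix grows.\<close>

definition prefix_state :: "(int \<Rightarrow> int) \<Rightarrow> int \<Rightarrow> int \<Rightarrow> int \<Rightarrow> int \<Rightarrow> bool" where
  "prefix_state T n i a b \<longleftrightarrow> 1 \<le> i \<and> i \<le> n \<and> a < T i \<and> T i < b \<and> 0 \<le> a \<and> b \<le> n + 1 \<and>
     (\<forall>j. 1 \<le> j \<and> j < i \<longrightarrow> T j \<le> a \<or> b \<le> T j) \<and>
     (\<forall>j j'. 1 \<le> j \<and> j < j' \<and> j' \<le> i \<longrightarrow> (T j < T j' \<longrightarrow> T j \<le> a) \<and> (T j' < T j \<longrightarrow> b \<le> T j)) \<and>
     (a = 0 \<or> (\<exists>j j'. 1 \<le> j \<and> j < j' \<and> j' \<le> i \<and> a = T j \<and> T j < T j')) \<and>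
     (b = n + 1 \<or> (\<exists>j j'. 1 \<le> j \<and> j < j' \<and> j' \<le> i \<and> b = T j \<and> T j' < T j))"

lemma prefix_state_left_cut: "prefix_state T n i a b \<Longrightarrow> left_cut T i a"
  unfolding prefix_state_def left_cut_def by (smt (verit))

lemma prefix_state_init: "perm_on T n \<Longrightarrow> 1 \<le> n \<Longrightarrow> prefix_state T n 1 0 (n + 1)"
  using perm_on_range[of T n 1] by (auto simp: prefix_state_def)

text \<open>The lower bound is either 0 or the value of a point with a later, higher point, which
  forces the line to be at or above it; a next value below it would force the line below that same
  point. The upper bound is symmetric, and the defaults 0 and \<open>n + 1\<close> cannot be
  crossed.\<close>

lemma prefix_state_stop:
  assumes perm: "perm_on T n" and st: "prefix_state T n i a b" and "i < n"
    and out: "\<not> (a < T (i + 1) \<and> T (i + 1) < b)"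
  shows "\<not> left_cut T (i + 1) y"
proof
  assume cut: "left_cut T (i + 1) y"
  have i: "1 \<le> i" and ab: "a < b"
    and a: "a = 0 \<or> (\<exists>j j'. 1 \<le> j \<and> j < j' \<and> j' \<le> i \<and> a = T j \<and> T j < T j')"
    and b: "b = n + 1 \<or> (\<exists>j j'. 1 \<le> j \<and> j < j' \<and> j' \<le> i \<and> b = T j \<and> T j' < T j)"
    using st by (auto simp: prefix_state_def)
  have rng: "1 \<le> T (i + 1)" "T (i + 1) \<le> n" using perm_on_range[OF perm, of "i + 1"] i \<open>i < n\<close> by auto
  consider "T (i + 1) \<le> a" | "b \<le> T (i + 1)" using out by linarith
  then show False
  proof cases
    case 1
    then obtain j j' where j: "1 \<le> j" "j < j'" "j' \<le> i" "a = T j" "T j < T j'" using a rng by auto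
    have "T (i + 1) \<noteq> T j" using perm_on_eq[OF perm, of "i + 1" j] j i \<open>i < n\<close> by auto
    then have "T (i + 1) < T j" using 1 j by simp
    then have "y < T j" using cut j unfolding left_cut_def by (smt (verit))
    moreover have "T j \<le> y" using cut j unfolding left_cut_def by (smt (verit))
    ultimately show False by simp
  next
    case 2
    then obtain j j' where j: "1 \<le> j" "j < j'" "j' \<le> i" "b = T j" "T j' < T j" using b rng by auto
    have "T (i + 1) \<noteq> T j" using perm_on_eq[OF perm, of "i + 1" j] j i \<open>i < n\<close> by auto
    then have "T j < T (i + 1)" using 2 j by simp
    then have "T j \<le> y" using cut j unfolding left_cut_def by (smt (verit))
    moreover have "y < T j" using cut j unfolding left_cut_def by (smt (verit))
    ultimately show False by simp
  qed
qed

text \<open>The former last point acquires a higher successor, so its value becomes the lower bound.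
  For earlier points nothing changes: their values avoid the open interval, so both of the last two
  points lie on the same side of each of them.\<close>

lemma prefix_state_up:
  assumes st: "prefix_state T n i a b" and "i < n" "a < T (i + 1)" "T (i + 1) < b" "T i < T (i + 1)"
  shows "prefix_state T n (i + 1) (T i) b"
proof -
  have st': "1 \<le> i" "a < T i" "T i < b" "0 \<le> a" "b \<le> n + 1"
    "\<And>j. 1 \<le> j \<Longrightarrow> j < i \<Longrightarrow> T j \<le> a \<or> b \<le> T j"
    "\<And>j j'. 1 \<le> j \<Longrightarrow> j < j' \<Longrightarrow> j' \<le> i \<Longrightarrow> (T j < T j' \<longrightarrow> T j \<le> a) \<and> (T j' < T j \<longrightarrow> b \<le> T j)"
    "b = n + 1 \<or> (\<exists>j j'. 1 \<le> j \<and> j < j' \<and> j' \<le> i \<and> b = T j \<and> T j' < T j)"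
    using st unfolding prefix_state_def by auto
  have 1: "T j \<le> T i \<or> b \<le> T j" if "1 \<le> j" "j < i + 1" for j
    using st'(2) st'(6)[of j] that by (cases "j = i") auto
  have 2: "(T j < T j' \<longrightarrow> T j \<le> T i) \<and> (T j' < T j \<longrightarrow> b \<le> T j)" if "1 \<le> j" "j < j'" "j' \<le> i + 1" for j j'
  proof (cases "j' = i + 1")
    case True
    show ?thesis unfolding True using 1[of j] that assms(3-5) st'(2) st'(6)[of j] by (cases "j = i") auto
  next
    case False
    then show ?thesis using st'(2) st'(7)[of j j'] that by auto
  qed
  have 3: "\<exists>j j'. 1 \<le> j \<and> j < j' \<and> j' \<le> i + 1 \<and> T i = T j \<and> T j < T j'"
    using st'(1) assms(5) by (intro exI[of _ i] exI[of _ "i + 1"]) auto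
  have 4: "b = n + 1 \<or> (\<exists>j j'. 1 \<le> j \<and> j < j' \<and> j' \<le> i + 1 \<and> b = T j \<and> T j' < T j)"
    using st'(8) by (metis zle_add1_eq_le less_le)
  show ?thesis unfolding prefix_state_def using st'(1-5) assms 1 2 3 4 by (intro conjI) auto
qed

lemma prefix_state_down:
  assumes st: "prefix_state T n i a b" and "i < n" "a < T (i + 1)" "T (i + 1) < b" "T (i + 1) < T i"
  shows "prefix_state T n (i + 1) a (T i)"
proof -
  have st': "1 \<le> i" "a < T i" "T i < b" "0 \<le> a" "b \<le> n + 1"
    "\<And>j. 1 \<le> j \<Longrightarrow> j < i \<Longrightarrow> T j \<le> a \<or> b \<le> T j"
    "\<And>j j'. 1 \<le> j \<Longrightarrow> j < j' \<Longrightarrow> j' \<le> i \<Longrightarrow> (T j < T j' \<longrightarrow> T j \<le> a) \<and> (T j' < T j \<longrightarrow> b \<le> T j)"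
    "a = 0 \<or> (\<exists>j j'. 1 \<le> j \<and> j < j' \<and> j' \<le> i \<and> a = T j \<and> T j < T j')"
    using st unfolding prefix_state_def by auto
  have 1: "T j \<le> a \<or> T i \<le> T j" if "1 \<le> j" "j < i + 1" for j
    using st'(3) st'(6)[of j] that by (cases "j = i") auto
  have 2: "(T j < T j' \<longrightarrow> T j \<le> a) \<and> (T j' < T j \<longrightarrow> T i \<le> T j)" if "1 \<le> j" "j < j'" "j' \<le> i + 1" for j j'
  proof (cases "j' = i + 1")
    case True
    show ?thesis unfolding True using 1[of j] that assms(3-5) st'(3) st'(6)[of j] by (cases "j = i") auto
  next
    case False
    then show ?thesis using st'(3) st'(7)[of j j'] that by auto
  qed
  have 3: "\<exists>j j'. 1 \<le> j \<and> j < j' \<and> j' \<le> i + 1 \<and> T i = T j \<and> T j' < T j"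
    using st'(1) assms(5) by (intro exI[of _ i] exI[of _ "i + 1"]) auto
  have 4: "a = 0 \<or> (\<exists>j j'. 1 \<le> j \<and> j < j' \<and> j' \<le> i + 1 \<and> a = T j \<and> T j < T j')"
    using st'(8) by (metis zle_add1_eq_le less_le)
  show ?thesis unfolding prefix_state_def using st'(1-5) assms 1 2 3 4 by (intro conjI) auto
qed

text \<open>\<open>vX\<close> is the loop limit as well as the result: it starts at the full length,
  and setting it to \<open>vI\<close> leaves the loop.\<close>

definition prefix_body :: com where
  "prefix_body =
     vV ::= Arr 0 (Plus (V vI) (N 1)) ;;
     Cond (V vA) (V vV)
       (Cond (V vV) (V vB)
          (Cond (V vU) (V vV) (vA ::= V vU) (vB ::= V vU) ;; vU ::= V vV ;; inc vI)
          (vX ::= V vI))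
       (vX ::= V vI)"

definition prefix_prog :: com where
  "prefix_prog =
     (vI ::= N 1 ;; vU ::= Arr 0 (N 1) ;; vA ::= N 0 ;; vB ::= Plus (V vN) (N 1) ;; vX ::= V vN) ;;
     While (V vI) (V vX) prefix_body"

definition prefix_cost :: nat where
  "prefix_cost = csize prefix_body + 50"

lemma wp_prefix_prog:
  assumes perm: "perm_on (A 0) n" and n: "s vN = n" "1 \<le> n"
  shows "wp prefix_prog (\<lambda>t s' A'. t \<le> prefix_cost * (nat n + 1) \<and> A' = A \<and>
    eq_off {vX, vI, vA, vB, vV, vU} s s' \<and> 1 \<le> s' vX \<and> s' vX \<le> n \<and>
    (\<exists>y. left_cut (A 0) (s' vX) y) \<and>
    (s' vX = n \<or> \<not> (\<exists>y. left_cut (A 0) (s' vX + 1) y))) s A"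
proof -
  let ?T = "A 0"
  define I where "I = (\<lambda>s' A'. A' = A \<and> eq_off {vX, vI, vA, vB, vV, vU} s s' \<and>
    prefix_state ?T n (s' vI) (s' vA) (s' vB) \<and> s' vU = ?T (s' vI) \<and> s' vI \<le> s' vX \<and> s' vX \<le> n \<and>
    (s' vX = n \<or> s' vX = s' vI \<and> \<not> (\<exists>y. left_cut (A 0) (s' vX + 1) y)))"
  have loop: "wp (While (V vI) (V vX) prefix_body)
      (\<lambda>t s'' A''. t \<le> (csize prefix_body + tcost (V vI) (V vX) + 2) * (nat (s' vX - s' vI) + 1) \<and>
         I s'' A'' \<and> \<not> ev (V vI) s'' A'' < ev (V vX) s'' A'') s' A'" if "I s' A'" for s' A'
  proof (rule wp_While[where f = "\<lambda>s A. nat (s vX - s vI)" and I = I])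
    show "I s' A'" by fact
  next
    fix s1 A1 assume I1: "I s1 A1" and "ev (V vI) s1 A1 < ev (V vX) s1 A1"
    then have less: "s1 vI < s1 vX" by simp
    have A1: "A1 = A" and st: "prefix_state ?T n (s1 vI) (s1 vA) (s1 vB)" and u: "s1 vU = ?T (s1 vI)"
      and "s1 vX \<le> n" and X: "s1 vX = n" and off: "eq_off {vX, vI, vA, vB, vV, vU} s s1"
      using I1 less unfolding I_def by auto
    have i: "1 \<le> s1 vI" "s1 vI < n" using st less X by (auto simp: prefix_state_def)
    have ne: "?T (s1 vI + 1) \<noteq> ?T (s1 vI)"
      using perm_on_eq[OF perm, of "s1 vI + 1" "s1 vI"] i by auto
    note stop = prefix_state_stop[OF perm st i(2)]
    note up = prefix_state_up[OF st i(2)] and down = prefix_state_down[OF st i(2)]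
    have "wp prefix_body (\<lambda>_ s' A'. I s' A' \<and> nat (s' vX - s' vI) < nat (s1 vX - s1 vI)) s1 A1"
      unfolding prefix_body_def I_def
      using less A1 u X off i ne stop up down st by auto
    then show "wp prefix_body (\<lambda>t s' A'. t \<le> csize prefix_body \<and> I s' A' \<and>
        nat (s' vX - s' vI) < nat (s1 vX - s1 vI)) s1 A1"
      by (rule wp_loop_free[rotated]) (simp add: prefix_body_def)
  qed simp
  have "I (s(vI := 1, vU := A 0 1, vA := 0, vB := n + 1, vX := n)) A"
    using n prefix_state_init[OF perm] by (simp add: I_def)
  note loop = loop[OF this]
  show ?thesis
    unfolding prefix_prog_def
  proof (rule wp_SeqI[where R = "\<lambda>t s' A'. t \<le> 30 \<and> A' = A \<and>
       s' = s(vI := 1, vU := A 0 1, vA := 0, vB := n + 1, vX := n)"], goal_cases)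
    case 1
    show ?case using n by (simp add: acost_def)
  next
    case (2 t s' A')
    have "wp (While (V vI) (V vX) prefix_body)
        (\<lambda>t' s'' A''. t + t' \<le> prefix_cost * (nat n + 1) \<and> I s'' A'' \<and> \<not> s'' vI < s'' vX) s' A'"
    proof -
      have "30 + (csize prefix_body + tcost (V vI) (V vX) + 2) * (nat (n - 1) + 1) \<le> prefix_cost * (nat n + 1)"
        using n by (simp add: prefix_cost_def tcost_def algebra_simps nat_diff_distrib)
      then show ?thesis
        using 2 by (auto intro!: wp_mono[OF loop])
    qed
    then show ?case
    proof (rule wp_mono, goal_cases)
      case (1 t' s'' A'')
      then have "prefix_state ?T n (s'' vI) (s'' vA) (s'' vB)" "s'' vX = s'' vI"
        unfolding I_def by auto
      then have "left_cut ?T (s'' vX) (s'' vA)" "1 \<le> s'' vX"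
        by (simp_all add: prefix_state_left_cut) (simp_all add: prefix_state_def)
      then show ?case using 1 unfolding I_def by blast
    qed
  qed
qed


section \<open>Admissible horizontal lines for a fixed vertical line\<close>

text \<open>\<open>D\<close> is the set of visited points, \<open>E\<close> the part of it that is
  inner to the next point. The extremes \<open>M\<close> and \<open>m\<close> of \<open>E\<close>
  are described only by comparison with values in \<open>1..n\<close>, so that 0 and
  \<open>n + 1\<close> can represent the empty set.\<close>

definition scan_inv :: "(int \<Rightarrow> int) \<Rightarrow> int \<Rightarrow> int \<Rightarrow> int set \<Rightarrow> int set \<Rightarrow> int \<Rightarrow> int \<Rightarrow> int \<Rightarrow> int \<Rightarrow> bool" where
  "scan_inv T n x D E a b M m \<longleftrightarrow>
     (\<forall>y. a \<le> y \<and> y < b \<longleftrightarrow> 0 \<le> y \<and> y \<le> n \<and> (\<forall>i\<in>D. \<forall>j\<in>D. inner x i j \<longrightarrow>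
        (T i < T j \<longrightarrow> T i \<le> y) \<and> (T j < T i \<longrightarrow> y < T i))) \<and>
     (\<forall>v. 1 \<le> v \<and> v \<le> n \<longrightarrow> (v < M \<longleftrightarrow> (\<exists>j\<in>E. v < T j)) \<and> (m < v \<longleftrightarrow> (\<exists>j\<in>E. T j < v)))"

text \<open>The sweep goes outwards, so the new point is inner to no visited point and all new
  conditions constrain \<open>y\<close> by its own value. Whether it has a higher or a lower inner
  point is decided by the extremes alone.\<close>

lemma scan_inv_insert:
  assumes inv: "scan_inv T n x D E a b M m" and v: "1 \<le> T i" "T i \<le> n"
    and E: "E = {j\<in>D. inner x i j}" and outer: "\<And>j. j \<in> D \<Longrightarrow> \<not> inner x j i"
  shows "scan_inv T n x (insert i D) (insert i E)
    (if T i < M then max a (T i) else a) (if m < T i then min b (T i) else b)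
    (max M (T i)) (min m (T i))"
proof -
  have old: "a \<le> y \<and> y < b \<longleftrightarrow> 0 \<le> y \<and> y \<le> n \<and> (\<forall>i\<in>D. \<forall>j\<in>D. inner x i j \<longrightarrow>
        (T i < T j \<longrightarrow> T i \<le> y) \<and> (T j < T i \<longrightarrow> y < T i))" for y
    using inv by (simp add: scan_inv_def)
  have Mm: "v < M \<longleftrightarrow> (\<exists>j\<in>E. v < T j)" "m < v \<longleftrightarrow> (\<exists>j\<in>E. T j < v)" if "1 \<le> v" "v \<le> n" for v
    using inv that by (simp_all add: scan_inv_def)
  have irrefl: "\<not> inner x i i" by (simp add: inner_def)
  have "(if T i < M then max a (T i) else a) \<le> y \<and> y < (if m < T i then min b (T i) else b) \<longleftrightarrow>
      (a \<le> y \<and> y < b) \<and> (T i < M \<longrightarrow> T i \<le> y) \<and> (m < T i \<longrightarrow> y < T i)" for y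
    by auto
  also have "\<dots> y \<longleftrightarrow> (a \<le> y \<and> y < b) \<and>
      (\<forall>j\<in>D. inner x i j \<longrightarrow> (T i < T j \<longrightarrow> T i \<le> y) \<and> (T j < T i \<longrightarrow> y < T i))" for y
    unfolding Mm[OF v] E by blast
  also have "\<dots> y \<longleftrightarrow> 0 \<le> y \<and> y \<le> n \<and> (\<forall>i'\<in>insert i D. \<forall>j\<in>insert i D. inner x i' j \<longrightarrow>
        (T i' < T j \<longrightarrow> T i' \<le> y) \<and> (T j < T i' \<longrightarrow> y < T i'))" for y
    unfolding old using outer irrefl by blast
  finally have 1: "(if T i < M then max a (T i) else a) \<le> y \<and> y < (if m < T i then min b (T i) else b) \<longleftrightarrow>
      0 \<le> y \<and> y \<le> n \<and> (\<forall>i'\<in>insert i D. \<forall>j\<in>insert i D. inner x i' j \<longrightarrow>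
        (T i' < T j \<longrightarrow> T i' \<le> y) \<and> (T j < T i' \<longrightarrow> y < T i'))" for y .
  have 2: "(v < max M (T i) \<longleftrightarrow> (\<exists>j\<in>insert i E. v < T j)) \<and> (min m (T i) < v \<longleftrightarrow> (\<exists>j\<in>insert i E. T j < v))"
    if "1 \<le> v" "v \<le> n" for v
    using Mm[OF that] by (auto simp: less_max_iff_disj min_less_iff_disj)
  show ?thesis unfolding scan_inv_def using 1 2 by blast
qed

lemma scan_inv_empty: "scan_inv T n x {} {} 0 (n + 1) 0 (n + 1)"
  by (auto simp: scan_inv_def)

definition visit :: com where
  "visit =
     vV ::= Arr 0 (Plus (V vOff) (V vI)) ;;
     upon (V vV) (V vMax) (upon (V vA) (V vV) (vA ::= V vV)) ;;
     upon (V vMin) (V vV) (upon (V vV) (V vB) (vB ::= V vV)) ;;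
     upon (V vMax) (V vV) (vMax ::= V vV) ;;
     upon (V vV) (V vMin) (vMin ::= V vV)"

lemma wp_visit:
  assumes "0 \<le> s vOff + s vI" and v: "v = A 0 (s vOff + s vI)"
  shows "wp visit (\<lambda>_ s' A'. A' = A \<and> eq_off {vA, vB, vMax, vMin, vV} s s' \<and>
    s' vA = (if v < s vMax then max (s vA) v else s vA) \<and>
    s' vB = (if s vMin < v then min (s vB) v else s vB) \<and>
    s' vMax = max (s vMax) v \<and> s' vMin = min (s vMin) v) s A"
  unfolding visit_def using assms by (auto simp: max_def min_def)

text \<open>Both sides are swept outwards from the line. The extremes are reset in between because
  \<open>inner\<close> never relates points of different sides, whereas the interval for
  \<open>y\<close> accumulates.\<close>

definition scan :: com where
  "scan =
     (vA ::= N 0 ;; vB ::= Plus (V vLen) (N 1) ;; vMax ::= N 0 ;; vMin ::= Plus (V vLen) (N 1) ;;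
      vI ::= Plus (V vX) (N 1)) ;;
     While (V vI) (Plus (V vLen) (N 1)) (visit ;; inc vI) ;;
     (vMax ::= N 0 ;; vMin ::= Plus (V vLen) (N 1) ;; vI ::= V vX) ;;
     While (N 0) (V vI) (visit ;; vI ::= Minus (V vI) (N 1))"

definition scan_cost :: nat where
  "scan_cost = 2 * csize visit + 100"

lemma wp_scan:
  fixes s :: store and A :: arrays and n x :: int
  defines "T \<equiv> \<lambda>i. A 0 (s vOff + i)"
  assumes perm: "perm_on T n" and n: "s vLen = n" and x: "s vX = x" "0 \<le> x" "x \<le> n"
    and off: "0 \<le> s vOff"
  shows "wp scan (\<lambda>t s' A'. t \<le> scan_cost * (nat n + 1) \<and> A' = A \<and>
    eq_off {vI, vA, vB, vMax, vMin, vV} s s' \<and>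
    (\<forall>y. s' vA \<le> y \<and> y < s' vB \<longleftrightarrow> 0 \<le> y \<and> y \<le> n \<and> cut T n x y)) s A"
proof -
  let ?X = "{vI, vA, vB, vMax, vMin, vV}"
  define st where "st = (\<lambda>(D :: int set) E (s' :: store) (A' :: arrays). A' = A \<and> eq_off ?X s s' \<and>
    scan_inv T n x D E (s' vA) (s' vB) (s' vMax) (s' vMin))"
  have visit: "wp visit (\<lambda>_ s' A'. s' vI = i \<and> st (insert i D) (insert i E) s' A') s1 A1"
    if "st D E s1 A1" "s1 vI = i" "1 \<le> i" "i \<le> n"
      "E = {j\<in>D. inner x i j}" "\<And>j. j \<in> D \<Longrightarrow> \<not> inner x j i" for D E s1 A1 i
  proof -
    have s1: "A1 = A" "eq_off ?X s s1" "scan_inv T n x D E (s1 vA) (s1 vB) (s1 vMax) (s1 vMin)"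
      using that(1) by (auto simp: st_def)
    have off1: "s1 vOff = s vOff" using eq_offD[OF s1(2), of vOff] by simp
    have v: "1 \<le> T i" "T i \<le> n" using perm_on_range[OF perm that(3,4)] by auto
    have T: "T i = A1 0 (s1 vOff + s1 vI)" using s1(1) off1 that(2) by (simp add: T_def)
    have nonneg: "0 \<le> s1 vOff + s1 vI" using off off1 that by simp
    note step = scan_inv_insert[OF s1(3) v that(5,6)]
    show ?thesis
    proof (rule wp_mono[OF wp_visit[of s1 "T i" A1, OF nonneg T]], goal_cases)
      case (1 t s' A')
      then have "eq_off ?X s s'" using eq_off_trans[OF s1(2)] by blast
      moreover have "s' vI = i" using 1 eq_offD[of _ s1 s' vI] that(2) by auto
      ultimately show ?case using 1 step s1(1) by (simp add: st_def)
    qed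
  qed
  define I where "I = (\<lambda>s' A'. x + 1 \<le> s' vI \<and> s' vI \<le> n + 1 \<and> st {x+1..s' vI - 1} {x+1..s' vI - 1} s' A')"
  define J where "J = (\<lambda>s' A'. 0 \<le> s' vI \<and> s' vI \<le> x \<and> st {s' vI + 1..n} {s' vI + 1..x} s' A')"
  have len: "s' vLen = n" "s' vX = x" "A' = A" if "st D E s' A'" for D E s' A'
    using that n x eq_offD[of ?X s s' vLen] eq_offD[of ?X s s' vX] by (auto simp: st_def)
  have right: "wp (While (V vI) (Plus (V vLen) (N 1)) (visit ;; inc vI))
      (\<lambda>t s'' A''. t \<le> (csize (visit ;; inc vI) + tcost (V vI) (Plus (V vLen) (N 1)) + 2) * (nat (n + 1 - s' vI) + 1) \<and>
         I s'' A'' \<and> \<not> ev (V vI) s'' A'' < ev (Plus (V vLen) (N 1)) s'' A'') s' A'"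
    if "I s' A'" for s' A'
  proof (rule wp_While[where I = I and f = "\<lambda>s A. nat (n + 1 - s vI)"])
    show "I s' A'" by fact
    fix s1 A1 assume I1: "I s1 A1" and "ev (V vI) s1 A1 < ev (Plus (V vLen) (N 1)) s1 A1"
    then have less: "s1 vI \<le> n" and st1: "st {x+1..s1 vI - 1} {x+1..s1 vI - 1} s1 A1" and "x + 1 \<le> s1 vI"
      using len by (auto simp: I_def)
    then have ins: "insert (s1 vI) {x+1..s1 vI - 1} = {x+1..s1 vI}" by auto
    have "{x+1..s1 vI - 1} = {j\<in>{x+1..s1 vI - 1}. inner x (s1 vI) j}" by (auto simp: inner_def)
    then have "wp visit (\<lambda>_ s' A'. s' vI = s1 vI \<and> st {x+1..s1 vI} {x+1..s1 vI} s' A') s1 A1"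
      using visit[OF st1 refl] less \<open>x + 1 \<le> s1 vI\<close> x(2) unfolding ins by (auto simp: inner_def)
    then have "wp (visit ;; inc vI) (\<lambda>_ s' A'. I s' A' \<and> nat (n + 1 - s' vI) < nat (n + 1 - s1 vI)) s1 A1"
      using less \<open>x + 1 \<le> s1 vI\<close> by (auto simp: I_def st_def elim!: wp_mono)
    then show "wp (visit ;; inc vI) (\<lambda>t s' A'. t \<le> csize (visit ;; inc vI) \<and> I s' A' \<and>
        nat (n + 1 - s' vI) < nat (n + 1 - s1 vI)) s1 A1"
      by (rule wp_loop_free[rotated]) (simp add: visit_def)
  qed simp
  have left: "wp (While (N 0) (V vI) (visit ;; vI ::= Minus (V vI) (N 1)))
      (\<lambda>t s'' A''. t \<le> (csize (visit ;; vI ::= Minus (V vI) (N 1)) + tcost (N 0) (V vI) + 2) * (nat (s' vI) + 1) \<and>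
         J s'' A'' \<and> \<not> ev (N 0) s'' A'' < ev (V vI) s'' A'') s' A'"
    if "J s' A'" for s' A'
  proof (rule wp_While[where I = J and f = "\<lambda>s A. nat (s vI)"])
    show "J s' A'" by fact
    fix s1 A1 assume J1: "J s1 A1" and "ev (N 0) s1 A1 < ev (V vI) s1 A1"
    then have less: "0 < s1 vI" and st1: "st {s1 vI + 1..n} {s1 vI + 1..x} s1 A1" and "s1 vI \<le> x"
      by (auto simp: J_def)
    then have ins: "insert (s1 vI) {s1 vI + 1..n} = {s1 vI..n}" "insert (s1 vI) {s1 vI + 1..x} = {s1 vI..x}"
      using x by auto
    have "{s1 vI + 1..x} = {j\<in>{s1 vI + 1..n}. inner x (s1 vI) j}"
      using \<open>s1 vI \<le> x\<close> x(3) by (auto simp: inner_def)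
    then have "wp visit (\<lambda>_ s' A'. s' vI = s1 vI \<and> st {s1 vI..n} {s1 vI..x} s' A') s1 A1"
      using visit[OF st1 refl] less \<open>s1 vI \<le> x\<close> x(3) unfolding ins by (auto simp: inner_def)
    then have "wp (visit ;; vI ::= Minus (V vI) (N 1)) (\<lambda>_ s' A'. J s' A' \<and> nat (s' vI) < nat (s1 vI)) s1 A1"
      using less \<open>s1 vI \<le> x\<close> by (auto simp: J_def st_def elim!: wp_mono)
    then show "wp (visit ;; vI ::= Minus (V vI) (N 1)) (\<lambda>t s' A'. t \<le> csize (visit ;; vI ::= Minus (V vI) (N 1)) \<and>
        J s' A' \<and> nat (s' vI) < nat (s1 vI)) s1 A1"
      by (rule wp_loop_free[rotated]) (simp add: visit_def)
  qed simp
  show ?thesis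
    unfolding scan_def
  proof (rule wp_SeqI[where R = "\<lambda>t s' A'. t \<le> 30 \<and> I s' A' \<and> s' vI = x + 1"], goal_cases)
    case 1
    show ?case using n x scan_inv_empty[of T n x] by (simp add: I_def st_def)
  next
    case (2 t1 s1 A1)
    note c1 = 2
    show ?case
    proof (rule wp_SeqI[OF right], goal_cases)
      case 1
      show ?case using c1 by simp
    next
      case (2 t2 s2 A2)
      note c2 = 2
      then have I2: "I s2 A2" "s2 vI = n + 1" using len by (auto simp: I_def)
      then have st2: "st {x + 1..n} {x + 1..n} s2 A2" by (simp add: I_def)
      show ?case
      proof (rule wp_SeqI[where R = "\<lambda>t s' A'. t \<le> 20 \<and> J s' A' \<and> s' vI = x"], goal_cases)
        case 1
        have "scan_inv T n x {x + 1..n} {} (s2 vA) (s2 vB) 0 (n + 1)"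
          using st2 by (auto simp: st_def scan_inv_def)
        then show ?case using st2 len[OF st2] x by (simp add: J_def st_def)
      next
        case (2 t3 s3 A3)
        note c3 = 2
        show ?case
        proof (rule wp_mono[OF left], goal_cases)
          case 1
          show ?case using c3 by simp
        next
          case (2 t4 s4 A4)
          then have "s4 vI = 0" "J s4 A4" by (auto simp: J_def)
          then have st4: "st {1..n} {1..x} s4 A4" by (simp add: J_def)
          have "t2 \<le> (csize visit + 20) * (nat n + 1)"
            using c1 x by (intro order.trans[OF conjunct1[OF c2]] mult_le_mono) (auto simp: tcost_def)
          moreover have "t4 \<le> (csize visit + 20) * (nat n + 1)"
            using c3 x by (intro order.trans[OF conjunct1[OF 2]] mult_le_mono) (auto simp: tcost_def)
          moreover have "t1 \<le> 30" "t3 \<le> 20" using c1 c3 by auto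
          ultimately have "t1 + (t2 + (t3 + t4)) \<le> scan_cost * (nat n + 1)"
            unfolding scan_cost_def by (simp add: algebra_simps)
          moreover have "\<forall>y. s4 vA \<le> y \<and> y < s4 vB \<longleftrightarrow> 0 \<le> y \<and> y \<le> n \<and> cut T n x y"
            using st4 unfolding st_def scan_inv_def cut_def by blast
          ultimately show ?case using st4 unfolding st_def by blast
        qed
      qed
    qed
  qed
qed

section \<open>The worklist\<close>

text \<open>Indices up to the centre move down by one, which frees slot \<open>vG\<close> and makes
  the text with its centre occupy \<open>0..n\<close>. Doubled values leave the odd ones free for
  the centre.\<close>

definition centre_body :: com where
  "centre_body =
     vV ::= Arr 0 (V vI) ;;
     Cond (V vG) (V vI)
       (Write 1 (V vI) (Plus (V vV) (V vV)))
       (Write 1 (Minus (V vI) (N 1)) (Plus (V vV) (V vV))) ;;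
     inc vI"

definition centre_prog :: com where
  "centre_prog =
     vI ::= N 1 ;;
     While (V vI) (Plus (V vN) (N 1)) centre_body ;;
     Write 1 (V vG) (Plus (Plus (V vA) (V vA)) (N 1))"

definition centre_cost :: nat where
  "centre_cost = csize centre_body + 60"

lemma wp_centre_prog:
  assumes n: "s vN = n" "1 \<le> n" and g: "s vG = g" "0 \<le> g" "g \<le> n"
  shows "wp centre_prog (\<lambda>t s' A'. t \<le> centre_cost * (nat n + 1) \<and> eq_off {vI, vV} s s' \<and>
    (\<forall>j. j \<noteq> 1 \<longrightarrow> A' j = A j) \<and>
    (\<forall>j. 0 \<le> j \<and> j \<le> n \<longrightarrow> A' 1 j =
       (if j < g then 2 * A 0 (j + 1) else if j = g then 2 * s vA + 1 else 2 * A 0 j))) s A"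
proof -
  define I where "I = (\<lambda>s' A'. eq_off {vI, vV} s s' \<and> (\<forall>j. j \<noteq> 1 \<longrightarrow> A' j = A j) \<and>
    1 \<le> s' vI \<and> s' vI \<le> n + 1 \<and>
    (\<forall>j. 1 \<le> j \<and> j < s' vI \<longrightarrow> A' 1 (if j \<le> g then j - 1 else j) = 2 * A 0 j))"
  have frame: "s' vN = n" "s' vG = g" "s' vA = s vA" if "I s' A'" for s' A'
    using that n g by (auto simp: I_def eq_off_def)
  have loop: "wp (While (V vI) (Plus (V vN) (N 1)) centre_body)
      (\<lambda>t s'' A''. t \<le> (csize centre_body + tcost (V vI) (Plus (V vN) (N 1)) + 2) * (nat (n + 1 - s' vI) + 1) \<and>
         I s'' A'' \<and> \<not> ev (V vI) s'' A'' < ev (Plus (V vN) (N 1)) s'' A'') s' A'"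
    if "I s' A'" for s' A'
  proof (rule wp_While[where I = I and f = "\<lambda>s A. nat (n + 1 - s vI)"])
    show "I s' A'" by fact
    fix s1 A1 assume I1: "I s1 A1" and "ev (V vI) s1 A1 < ev (Plus (V vN) (N 1)) s1 A1"
    then have i: "1 \<le> s1 vI" "s1 vI \<le> n" and off: "eq_off {vI, vV} s s1"
      and A1: "\<And>j. j \<noteq> 1 \<Longrightarrow> A1 j = A j"
      and pre: "\<And>j. 1 \<le> j \<Longrightarrow> j < s1 vI \<Longrightarrow> A1 1 (if j \<le> g then j - 1 else j) = 2 * A 0 j"
      using frame[OF I1] by (auto simp: I_def)
    have A0: "A1 0 = A 0" using A1[of 0] by simp
    let ?i = "s1 vI"
    let ?A = "A1(1 := (A1 1)((if ?i \<le> g then ?i - 1 else ?i) := A 0 ?i + A 0 ?i))"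
    have "I (s1(vV := A 0 ?i, vI := ?i + 1)) ?A"
      unfolding I_def
    proof (intro conjI allI impI)
      fix j assume "1 \<le> j \<and> j < (s1(vV := A 0 ?i, vI := ?i + 1)) vI"
      then show "?A 1 (if j \<le> g then j - 1 else j) = 2 * A 0 j"
        using pre[of j] by (cases "j = ?i") (auto split: if_splits)
    qed (use i off A1 in auto)
    then have "wp centre_body (\<lambda>_ s' A'. I s' A' \<and> nat (n + 1 - s' vI) < nat (n + 1 - s1 vI)) s1 A1"
      using i A0 frame(2)[OF I1] unfolding centre_body_def by auto
    then show "wp centre_body (\<lambda>t s' A'. t \<le> csize centre_body \<and> I s' A' \<and>
        nat (n + 1 - s' vI) < nat (n + 1 - s1 vI)) s1 A1"
      by (rule wp_loop_free[rotated]) (simp add: centre_body_def)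
  qed simp
  show ?thesis
    unfolding centre_prog_def
  proof (rule wp_SeqI[where R = "\<lambda>t s' A'. t \<le> 3 \<and> I s' A' \<and> s' vI = 1"], goal_cases)
    case 1
    show ?case using n by (simp add: I_def)
  next
    case (2 t1 s1 A1)
    note c1 = 2
    show ?case
    proof (rule wp_SeqI[OF loop], goal_cases)
      case 1
      show ?case using c1 by simp
    next
      case (2 t2 s2 A2)
      then have I2: "I s2 A2" by blast
      then have "s2 vI \<le> n + 1" unfolding I_def by blast
      then have i2: "s2 vI = n + 1" using 2 frame[OF I2] by simp
      have "t2 \<le> (csize centre_body + 20) * (nat n + 1)"
        using c1 by (intro order.trans[OF conjunct1[OF 2]] mult_le_mono) (auto simp: tcost_def)
      then have time: "t1 + (t2 + 30) \<le> centre_cost * (nat n + 1)"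
        using c1 unfolding centre_cost_def by (simp add: algebra_simps)
      have pre: "A2 1 (if j \<le> g then j - 1 else j) = 2 * A 0 j" if "1 \<le> j" "j \<le> n" for j
        using I2 i2 that unfolding I_def by simp
      have G: "A2 1 j = (if j < g then 2 * A 0 (j + 1) else 2 * A 0 j)"
        if "0 \<le> j" "j \<le> n" "j \<noteq> g" for j
      proof (cases "j < g")
        case True
        then show ?thesis using pre[of "j + 1"] that g by simp
      next
        case False
        then show ?thesis using pre[of j] that g by simp
      qed
      show ?case
        using time I2 G frame[OF I2] g by (auto simp: I_def acost_def)
    qed
  qed
qed

definition init_body :: com where
  "init_body =
     Write 2 (Arr 0 (Plus (V vOff) (V vI))) (V vI) ;;
     Write 3 (Minus (V vI) (N 1)) (V vI) ;;
     Write 4 (V vI) (N 0) ;; Write 5 (V vI) (N 0) ;;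
     Write 6 (V vI) (V vN) ;; Write 7 (V vI) (V vN) ;;
     inc vI"

text \<open>The zeros at values 0 and \<open>k + 1\<close> of the inverse are sentinels: 0 is no
  point, so a missing vertical neighbour is recognised by the looked-up index. All points start on
  the stack, and all bounds at the ends of the text.\<close>

definition init_prog :: com where
  "init_prog =
     (Write 2 (N 0) (N 0) ;; Write 2 (Plus (V vK) (N 1)) (N 0) ;; vI ::= N 1) ;;
     While (V vI) (Plus (V vK) (N 1)) init_body ;;
     vSp ::= V vK"

definition init_cost :: nat where
  "init_cost = csize init_body + 80"

lemma wp_init_prog:
  fixes s :: store and A :: arrays and k n :: int
  defines "P \<equiv> \<lambda>i. A 0 (s vOff + i)"
  assumes k: "s vK = k" "1 \<le> k" and n: "s vN = n" and off: "0 \<le> s vOff" and perm: "perm_on P k"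
  shows "wp init_prog (\<lambda>t s' A'. t \<le> init_cost * (nat k + 1) \<and> eq_off {vI, vSp} s s' \<and>
    A' 0 = A 0 \<and> A' 1 = A 1 \<and> A' 2 0 = 0 \<and> A' 2 (k + 1) = 0 \<and> s' vSp = k \<and>
    (\<forall>p. 1 \<le> p \<and> p \<le> k \<longrightarrow> A' 2 (P p) = p \<and> A' 3 (p - 1) = p \<and>
       A' 4 p = 0 \<and> A' 5 p = 0 \<and> A' 6 p = n \<and> A' 7 p = n)) s A"
proof -
  define I where "I = (\<lambda>s' (A' :: arrays). eq_off {vI} s s' \<and> A' 0 = A 0 \<and> A' 1 = A 1 \<and>
    A' 2 0 = 0 \<and> A' 2 (k + 1) = 0 \<and> 1 \<le> s' vI \<and> s' vI \<le> k + 1 \<and>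
    (\<forall>p. 1 \<le> p \<and> p < s' vI \<longrightarrow> A' 2 (P p) = p \<and> A' 3 (p - 1) = p \<and>
       A' 4 p = 0 \<and> A' 5 p = 0 \<and> A' 6 p = n \<and> A' 7 p = n))"
  have frame: "s' vK = k" "s' vN = n" "s' vOff = s vOff" "A' 0 = A 0" if "I s' A'" for s' A'
    using that n k by (auto simp: I_def eq_off_def)
  have loop: "wp (While (V vI) (Plus (V vK) (N 1)) init_body)
      (\<lambda>t s'' A''. t \<le> (csize init_body + tcost (V vI) (Plus (V vK) (N 1)) + 2) * (nat (k + 1 - s' vI) + 1) \<and>
         I s'' A'' \<and> \<not> ev (V vI) s'' A'' < ev (Plus (V vK) (N 1)) s'' A'') s' A'"
    if "I s' A'" for s' A'
  proof (rule wp_While[where I = I and f = "\<lambda>s A. nat (k + 1 - s vI)"])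
    show "I s' A'" by fact
    fix s1 A1 assume I1: "I s1 A1" and "ev (V vI) s1 A1 < ev (Plus (V vK) (N 1)) s1 A1"
    then have i: "1 \<le> s1 vI" "s1 vI \<le> k" using frame[OF I1] by (auto simp: I_def)
    let ?i = "s1 vI"
    have Pi: "1 \<le> P ?i" "P ?i \<le> k" using perm_on_range[OF perm i] by auto
    have ne: "P j \<noteq> P ?i" if "1 \<le> j" "j < ?i" for j
      using perm_on_eq[OF perm, of j ?i] that i by auto
    have P: "A1 0 (s1 vOff + ?i) = P ?i" using frame[OF I1] by (simp add: P_def)
    have "wp init_body (\<lambda>_ s' A'. I s' A' \<and> nat (k + 1 - s' vI) < nat (k + 1 - s1 vI)) s1 A1"
      unfolding init_body_def using i Pi ne P off frame[OF I1] I1 by (auto simp: I_def)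
    then show "wp init_body (\<lambda>t s' A'. t \<le> csize init_body \<and> I s' A' \<and>
        nat (k + 1 - s' vI) < nat (k + 1 - s1 vI)) s1 A1"
      by (rule wp_loop_free[rotated]) (simp add: init_body_def)
  qed simp
  show ?thesis
    unfolding init_prog_def
  proof (rule wp_SeqI[where R = "\<lambda>t s' A'. t \<le> 40 \<and> I s' A' \<and> s' vI = 1"], goal_cases)
    case 1
    show ?case using k by (simp add: I_def acost_def)
  next
    case (2 t1 s1 A1)
    note c1 = 2
    show ?case
    proof (rule wp_SeqI[OF loop], goal_cases)
      case 1
      show ?case using c1 by simp
    next
      case (2 t2 s2 A2)
      then have I2: "I s2 A2" by blast
      then have "s2 vI \<le> k + 1" unfolding I_def by blast
      then have i2: "s2 vI = k + 1" using 2 frame[OF I2] by simp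
      have "t2 \<le> (csize init_body + 20) * (nat k + 1)"
        using c1 by (intro order.trans[OF conjunct1[OF 2]] mult_le_mono) (auto simp: tcost_def)
      then have time: "t1 + (t2 + 10) \<le> init_cost * (nat k + 1)"
        using c1 unfolding init_cost_def by (simp add: algebra_simps)
      have "eq_off {vI, vSp} s s2" using I2 by (auto simp: I_def eq_off_def)
      then show ?case
        using time I2 i2 frame[OF I2] by (auto simp: I_def)
    qed
  qed
qed

section \<open>Testing the constraints of one point\<close>

text \<open>The sign is fixed when the program is built, so multiplying both sides by it amounts to
  swapping operands.\<close>

definition Lessd :: "int \<Rightarrow> exp \<Rightarrow> exp \<Rightarrow> com \<Rightarrow> com \<Rightarrow> com" where
  "Lessd d e1 e2 c1 c2 = (if d = 1 then Cond e1 e2 c1 c2 else Cond e2 e1 c1 c2)"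

lemma wp_Lessd:
  assumes "d \<in> {1, -1}"
  shows "wp (Lessd d e1 e2 c1 c2) (\<lambda>_. Q) s A \<longleftrightarrow> safe e1 s A \<and> safe e2 s A \<and>
    (if d * ev e1 s A < d * ev e2 s A then wp c1 (\<lambda>_. Q) s A else wp c2 (\<lambda>_. Q) s A)"
  using assms by (auto simp: Lessd_def)

lemma loop_free_Lessd [simp]: "loop_free (Lessd d e1 e2 c1 c2) \<longleftrightarrow> loop_free c1 \<and> loop_free c2"
  by (auto simp: Lessd_def)

abbreviation (input) pat :: "exp \<Rightarrow> exp" where
  "pat e \<equiv> Arr 0 (Plus (V vOff) e)"

definition check_x :: "int \<Rightarrow> com" where
  "check_x sx =
     vQ ::= Plus (V vP) (N sx) ;;
     upon (N 0) (V vQ) (upon (V vQ) (Plus (V vK) (N 1))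
       (Cond (pat (V vP)) (pat (V vQ))
          (vW ::= Arr (aid sx 1) (V vQ)) (vW ::= Arr (aid sx (-1)) (V vQ)) ;;
        Lessd sx (V vU) (V vW) Skip (vBad ::= N 1)))"

definition check_y :: "int \<Rightarrow> com" where
  "check_y sy =
     vQ ::= Arr 2 (Plus (pat (V vP)) (N sy)) ;;
     upon (N 0) (V vQ)
       (Cond (V vP) (V vQ) (vW ::= Arr (aid 1 sy) (V vQ)) (vW ::= Arr (aid (-1) sy) (V vQ)) ;;
        vW ::= Arr 1 (V vW) ;;
        Lessd sy (V vW) (Arr 1 (V vG)) Skip
          (Lessd sy (Arr 1 (V vU)) (V vW) Skip (vBad ::= N 1)))"

definition check :: "int \<Rightarrow> int \<Rightarrow> com" where
  "check sx sy =
     vU ::= Arr (aid sx sy) (V vP) ;;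
     Lessd sx (V vG) (V vU)
       (vBad ::= N 0 ;;
        Lessd sy (Arr 1 (V vG)) (Arr 1 (V vU)) Skip (vBad ::= N 1) ;;
        check_x sx ;;
        check_y sy ;;
        upon (N 0) (V vBad) (Write (aid sx sy) (V vP) (Minus (V vU) (N sx)) ;; vChg ::= N 1))
       Skip"

definition push :: "exp \<Rightarrow> com" where
  "push e = Write 3 (V vSp) e ;; inc vSp"

text \<open>Neighbours are pushed without range tests; the non-points 0 and \<open>k + 1\<close> are
  discarded when popped. The point itself returns to the stack because a check moves a bound by a
  single step, which may not be enough.\<close>

definition work_body :: com where
  "work_body =
     vSp ::= Minus (V vSp) (N 1) ;;
     vP ::= Arr 3 (V vSp) ;;
     upon (N 0) (V vP) (upon (V vP) (Plus (V vK) (N 1))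
       (vChg ::= N 0 ;;
        (check 1 1 ;; check 1 (-1) ;; check (-1) 1 ;; check (-1) (-1)) ;;
        upon (N 0) (V vChg)
          (push (V vP) ;; push (Plus (V vP) (N 1)) ;; push (Minus (V vP) (N 1)) ;;
           push (Arr 2 (Plus (pat (V vP)) (N 1))) ;; push (Arr 2 (Minus (pat (V vP)) (N 1))))))"

definition work_prog :: com where
  "work_prog = While (N 0) (V vSp) work_body"

lemma aid_less [simp]: "aid sx sy < 8"
  by (simp add: aid_def)

lemma aid_ge: "4 \<le> aid sx sy"
  by (simp add: aid_def)

lemma aid_neq [simp]: "aid sx sy \<noteq> 0" "aid sx sy \<noteq> 1" "aid sx sy \<noteq> Suc 0" "aid sx sy \<noteq> 2" "aid sx sy \<noteq> 3"
  using aid_ge[of sx sy] by auto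

context matching
begin

definition loaded :: "store \<Rightarrow> arrays \<Rightarrow> bool" where
  "loaded s A \<longleftrightarrow> s vK = k \<and> s vG = g \<and> 0 \<le> s vOff \<and> (\<forall>i. A 0 (s vOff + i) = P i) \<and>
     A 1 = G \<and> A 2 = Q \<and> Q 0 = 0 \<and> Q (k + 1) = 0"

lemma in_rangeD:
  assumes "in_range A" "sx \<in> {1,-1}" "sy \<in> {1,-1}" "1 \<le> p" "p \<le> k"
  shows "0 \<le> A (aid sx sy) p" "A (aid sx sy) p \<le> n" "0 \<le> sx * (A (aid sx sy) p - g)"
  using assms unfolding in_range_def by (metis atLeastAtMost_iff)+

lemma wp_check_x:
  assumes "loaded s A" and s: "sx \<in> {1,-1}" and p: "s vP = p" "1 \<le> p" "p \<le> k"
  shows "wp (check_x sx) (\<lambda>_ s' A'. A' = A \<and> eq_off {vQ, vW, vBad} s s' \<and>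
    s' vBad = (if 1 \<le> p + sx \<and> p + sx \<le> k \<longrightarrow>
        sx * s vU < sx * A (aid sx (sg (P (p + sx) - P p))) (p + sx) then s vBad else 1)) s A"
proof -
  have "s vK = k" "\<And>i. A 0 (s vOff + i) = P i" "0 \<le> s vOff" using assms(1) by (auto simp: loaded_def)
  then show ?thesis
    unfolding check_x_def using p by (simp add: wp_Lessd[OF s] sg_def)
qed

lemma wp_check_y:
  assumes "loaded s A" "in_range A" and s: "sy \<in> {1,-1}" and p: "s vP = p" "1 \<le> p" "p \<le> k"
    and u: "0 \<le> s vU"
  shows "wp (check_y sy) (\<lambda>_ s' A'. A' = A \<and> eq_off {vQ, vW, vBad} s s' \<and>
    s' vBad = (if 1 \<le> P p + sy \<and> P p + sy \<le> k \<longrightarrow>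
        (let q = Q (P p + sy); w = G (A (aid (sg (q - p)) sy) q)
         in \<not> (sy * G g \<le> sy * w \<and> sy * w \<le> sy * G (s vU))) then s vBad else 1)) s A"
proof -
  have ld: "s vK = k" "s vG = g" "\<And>i. A 0 (s vOff + i) = P i" "0 \<le> s vOff" "A 1 = G" "A 2 = Q"
    "Q 0 = 0" "Q (k + 1) = 0" using assms(1) by (auto simp: loaded_def)
  have Pp: "1 \<le> P p" "P p \<le> k" using perm_on_range[OF perm p(2,3)] by auto
  let ?q = "Q (P p + sy)"
  show ?thesis
  proof (cases "1 \<le> P p + sy \<and> P p + sy \<le> k")
    case True
    then have q: "1 \<le> ?q" "?q \<le> k" "P ?q = P p + sy" using Q[of "P p + sy"] by auto
    then have "?q \<noteq> p" using s by auto
    have nonneg: "0 \<le> A (aid 1 sy) ?q" "0 \<le> A (aid (-1) sy) ?q"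
      using in_rangeD(1)[OF assms(2) _ s q(1,2)] by auto
    show ?thesis
      unfolding check_y_def using p u ld True q nonneg \<open>?q \<noteq> p\<close> g
      by (simp add: wp_Lessd[OF s] sg_def Let_def not_less)
  next
    case False
    then have "P p + sy = 0 \<or> P p + sy = k + 1" using Pp s by auto
    then have "?q = 0" using ld by auto
    then show ?thesis
      unfolding check_y_def using p ld False Pp s by auto
  qed
qed

lemma wp_check:
  assumes "loaded s A" "in_range A" and s: "sx \<in> {1,-1}" "sy \<in> {1,-1}"
    and p: "s vP = p" "1 \<le> p" "p \<le> k"
  shows "wp (check sx sy) (\<lambda>_ s' A'. eq_off {vU, vQ, vW, vBad, vChg} s s' \<and>
    (if ok A sx sy p then A' = A \<and> s' vChg = s vChg
     else A (aid sx sy) p \<noteq> g \<and> A' = lower A sx sy p \<and> s' vChg = 1)) s A"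
proof -
  have ld: "s vG = g" "A 1 = G" using assms(1) by (auto simp: loaded_def)
  let ?u = "A (aid sx sy) p"
  note u = in_rangeD[OF assms(2) s p(2,3)]
  have u_iff: "sx * g < sx * ?u \<longleftrightarrow> ?u \<noteq> g" using u(3) s(1) by auto
  show ?thesis
  proof (cases "?u = g")
    case True
    then have "ok A sx sy p" by (simp add: ok_def)
    then show ?thesis
      unfolding check_def using p ld True by (simp add: wp_Lessd[OF s(1)])
  next
    case False
    define X where "X \<longleftrightarrow> (1 \<le> p + sx \<and> p + sx \<le> k \<longrightarrow>
        sx * ?u < sx * A (aid sx (sg (P (p + sx) - P p))) (p + sx))"
    define Y where "Y \<longleftrightarrow> (1 \<le> P p + sy \<and> P p + sy \<le> k \<longrightarrow>
        (let q = Q (P p + sy); w = G (A (aid (sg (q - p)) sy) q)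
         in \<not> (sy * G g \<le> sy * w \<and> sy * w \<le> sy * G ?u)))"
    have ok: "ok A sx sy p \<longleftrightarrow> sy * G g < sy * G ?u \<and> X \<and> Y"
      using False by (simp add: ok_def X_def Y_def Let_def)
    let ?c0 = "vBad ::= N 0 ;; Lessd sy (Arr 1 (V vG)) (Arr 1 (V vU)) Skip (vBad ::= N 1)"
    let ?rest = "check_x sx ;; check_y sy ;;
        upon (N 0) (V vBad) (Write (aid sx sy) (V vP) (Minus (V vU) (N sx)) ;; vChg ::= N 1)"
    let ?post = "\<lambda>_ s' A'. eq_off {vU, vQ, vW, vBad, vChg} s s' \<and>
      (if ok A sx sy p then A' = A \<and> s' vChg = s vChg
       else A (aid sx sy) p \<noteq> g \<and> A' = lower A sx sy p \<and> s' vChg = 1)"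
    have rest: "wp ?rest ?post s1 A"
      if s1: "eq_off {vU, vBad} s s1" "s1 vU = ?u" "s1 vBad = (if sy * G g < sy * G ?u then 0 else 1)" for s1
    proof -
      have same: "s1 vP = p" "loaded s1 A"
        using s1(1) p assms(1) by (auto simp: eq_off_def loaded_def)
      show ?thesis
      proof (rule wp_SeqI[OF wp_check_x[OF same(2) s(1) same(1) p(2,3)]], goal_cases)
        case (1 t2 s2 A2)
        have "loaded s2 A" "s2 vP = p" "s2 vU = ?u"
          using 1 same s1(2) by (auto simp: eq_off_def loaded_def)
        then show ?case
        proof (unfold conjunct1[OF 1], intro wp_SeqI[OF wp_check_y[OF _ assms(2) s(2) _ p(2,3)]], goal_cases)
          case (4 t3 s3 A3)
          have s2: "s2 vU = ?u" "s2 vBad = (if X then s1 vBad else 1)" "eq_off {vQ, vW, vBad} s1 s2"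
            using 1 s1(2) \<open>s2 vU = ?u\<close> by (auto simp: X_def)
          have s3: "A3 = A" "s3 vBad = (if Y then s2 vBad else 1)" "eq_off {vQ, vW, vBad} s2 s3"
            using 4 s2(1) by (auto simp: Y_def)
          have off: "eq_off {vU, vQ, vW, vBad} s s3"
            using s1(1) s2(3) s3(3) by (auto simp: eq_off_def)
          then have off': "eq_off {vU, vQ, vW, vBad, vChg} s s3" by (auto simp: eq_off_def)
          have "s3 vP = p" "s3 vChg = s vChg" "s3 vU = ?u"
            using off p(1) s2(1) s3(3) by (auto simp: eq_off_def)
          moreover have "0 < s3 vBad \<longleftrightarrow> \<not> ok A sx sy p"
            using s1(3) s2(2) s3(2) ok by auto
          ultimately show ?case
            using off' s3(1) p False by (auto simp: lower_def)
        qed (use u in auto)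
      qed
    qed
    have "wp (?c0 ;; ?rest) ?post (s(vU := ?u)) A"
    proof (rule wp_SeqI[where R = "\<lambda>_ s1 A1. A1 = A \<and> eq_off {vU, vBad} s s1 \<and> s1 vU = ?u \<and>
        s1 vBad = (if sy * G g < sy * G ?u then 0 else 1)"], goal_cases)
      case 1
      show ?case using ld u g by (simp add: wp_Lessd[OF s(2)])
    next
      case (2 t1 s1 A1)
      then show ?case using rest by simp
    qed
    then show ?thesis
      unfolding check_def using p ld False u_iff by (simp add: wp_Lessd[OF s(1)])
  qed
qed

end

section \<open>The worklist loop and its amortised cost\<close>

definition work_cost :: nat where
  "work_cost = csize work_body + 10"

context matching
begin

lemma arrays_cong:
  assumes "\<And>j. 4 \<le> j \<Longrightarrow> A' j = A j"
  shows "ok A' = ok A" "in_range A' = in_range A" "covers A' = covers A" "potential A' = potential A"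
proof -
  have [simp]: "A' (aid sx sy) = A (aid sx sy)" for sx sy using assms aid_ge by simp
  show "ok A' = ok A" by (intro ext) (simp add: ok_def)
  show "in_range A' = in_range A" by (simp add: in_range_def)
  show "covers A' = covers A" by (simp add: covers_def)
  show "potential A' = potential A" by (simp add: potential_def)
qed

text \<open>Describes the state between the checks of the four arms, \<open>Z\<close> being those
  already tested. Once a bound has moved, nothing is recorded about \<open>ok\<close> at
  \<open>p\<close>, since \<open>p\<close> will be pushed again anyway.\<close>

definition checked :: "store \<Rightarrow> arrays \<Rightarrow> int \<Rightarrow> (int \<times> int) set \<Rightarrow> store \<Rightarrow> arrays \<Rightarrow> bool" where
  "checked s0 A0 p Z s A \<longleftrightarrow> eq_off {vU, vQ, vW, vBad, vChg} s0 s \<and> in_range A \<and> covers A \<and>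
     (\<forall>j r. r \<noteq> p \<or> j < 4 \<longrightarrow> A j r = A0 j r) \<and>
     (s vChg = 0 \<and> A = A0 \<and> (\<forall>(sx, sy)\<in>Z. ok A0 sx sy p) \<or> s vChg = 1 \<and> potential A < potential A0)"

lemma loaded_cong:
  assumes "loaded s A" "\<And>z. z \<in> {vK, vG, vOff} \<Longrightarrow> s' z = s z" "\<And>j. j < 3 \<Longrightarrow> A' j = A j"
  shows "loaded s' A'"
  using assms by (simp add: loaded_def)

lemma wp_check_checked:
  assumes ld: "loaded s0 A0" and p: "s0 vP = p" "1 \<le> p" "p \<le> k"
    and ch: "checked s0 A0 p Z s A" and s: "sx \<in> {1,-1}" "sy \<in> {1,-1}"
  shows "wp (check sx sy) (\<lambda>_. checked s0 A0 p (insert (sx, sy) Z)) s A"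
proof -
  have off: "eq_off {vU, vQ, vW, vBad, vChg} s0 s" and rng: "in_range A" and cov: "covers A"
    and same: "\<And>j r. r \<noteq> p \<or> j < 4 \<Longrightarrow> A j r = A0 j r"
    using ch by (auto simp: checked_def)
  have "loaded s A"
    by (rule loaded_cong[OF ld]) (use off same in \<open>auto simp: eq_off_def\<close>)
  moreover have "s vP = p" using off p by (auto simp: eq_off_def)
  ultimately show ?thesis
  proof (rule wp_mono[OF wp_check[OF _ rng s _ p(2,3)]], goal_cases)
    case (1 t s' A')
    have off': "eq_off {vU, vQ, vW, vBad, vChg} s0 s'"
      using eq_off_trans[OF off] 1 by blast
    show ?case
    proof (cases "ok A sx sy p")
      case True
      then have "A' = A" "s' vChg = s vChg" using 1 by auto
      then show ?thesis using off' ch True unfolding checked_def by auto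
    next
      case False
      then have A': "A (aid sx sy) p \<noteq> g" "A' = lower A sx sy p" "s' vChg = 1" using 1 by auto
      have "potential A' < potential A"
        using potential_lower[OF rng s p(2,3) A'(1)] A'(2) by simp
      moreover have "potential A \<le> potential A0" using ch by (auto simp: checked_def)
      moreover have "in_range A'" "covers A'"
        using in_range_lower[OF rng s A'(1)] covers_lower[OF rng cov s p(2,3) False] A'(2) by auto
      moreover have "A' j r = A0 j r" if "r \<noteq> p \<or> j < 4" for j r
        using that same aid_ge[of sx sy] A'(2) by (auto simp: lower_def)
      ultimately show ?thesis using off' A'(3) by (auto simp: checked_def)
    qed
  qed
qed

lemma wp_checks:
  assumes ld: "loaded s0 A0" and p: "s0 vP = p" "1 \<le> p" "p \<le> k"
    and ch: "checked s0 A0 p {} s A"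
  shows "wp (check 1 1 ;; check 1 (-1) ;; check (-1) 1 ;; check (-1) (-1))
    (\<lambda>_ s' A'. checked s0 A0 p ({1,-1} \<times> {1,-1}) s' A') s A"
proof -
  note chk = wp_check_checked[OF ld p]
  have eq: "{1,-1} \<times> {1,-1} = {(-1,-1), (-1,1), (1,-1), (1,1 :: int)} "
    by auto
  show ?thesis
    unfolding eq
  proof (rule wp_SeqI[OF chk[OF ch]]; (simp only: insert_iff simp_thms)?)
    fix s1 A1 assume 1: "checked s0 A0 p {(1, 1)} s1 A1"
    show "wp (check 1 (-1) ;; check (-1) 1 ;; check (-1) (-1))
        (\<lambda>_. checked s0 A0 p {(-1, -1), (-1, 1), (1, -1), (1, 1)}) s1 A1"
    proof (rule wp_SeqI[OF chk[OF 1]]; (simp only: insert_iff simp_thms)?)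
      fix s2 A2 assume 2: "checked s0 A0 p {(1, -1), (1, 1)} s2 A2"
      show "wp (check (-1) 1 ;; check (-1) (-1))
          (\<lambda>_. checked s0 A0 p {(-1, -1), (-1, 1), (1, -1), (1, 1)}) s2 A2"
      proof (rule wp_SeqI[OF chk[OF 2]]; (simp only: insert_iff simp_thms)?)
        fix s3 A3 assume 3: "checked s0 A0 p {(-1, 1), (1, -1), (1, 1)} s3 A3"
        show "wp (check (-1) (-1))
            (\<lambda>_. checked s0 A0 p {(-1, -1), (-1, 1), (1, -1), (1, 1)}) s3 A3"
          using chk[OF 3, of "-1" "-1"] by simp
      qed
    qed
  qed
qed

text \<open>Every point violating a condition is on the stack. A lowered bound costs at most five pushes, which
  the decrease of \<open>5 * potential\<close> pays for.\<close>

definition work_inv :: "store \<Rightarrow> arrays \<Rightarrow> store \<Rightarrow> arrays \<Rightarrow> bool" where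
  "work_inv s0 A0 s A \<longleftrightarrow> eq_off {vU, vQ, vW, vBad, vChg, vSp, vP} s0 s \<and>
     A 0 = A0 0 \<and> A 1 = A0 1 \<and> A 2 = A0 2 \<and> in_range A \<and> covers A \<and> 0 \<le> s vSp \<and>
     (\<forall>p sx sy. 1 \<le> p \<and> p \<le> k \<and> sx \<in> {1,-1} \<and> sy \<in> {1,-1} \<and> \<not> ok A sx sy p \<longrightarrow>
        (\<exists>j. 0 \<le> j \<and> j < s vSp \<and> A 3 j = p))"

lemma wp_pushes:
  assumes ld: "loaded s A" and p: "s vP = p" "1 \<le> p" "p \<le> k" and sp: "0 \<le> s vSp"
  shows "wp (push (V vP) ;; push (Plus (V vP) (N 1)) ;; push (Minus (V vP) (N 1)) ;;
      push (Arr 2 (Plus (pat (V vP)) (N 1))) ;; push (Arr 2 (Minus (pat (V vP)) (N 1))))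
    (\<lambda>_ s' A'. eq_off {vSp} s s' \<and> s' vSp = s vSp + 5 \<and> (\<forall>j. j \<noteq> 3 \<longrightarrow> A' j = A j) \<and>
      (\<forall>j. j < s vSp \<longrightarrow> A' 3 j = A 3 j) \<and>
      (\<forall>q\<in>{p, p + 1, p - 1, Q (P p + 1), Q (P p - 1)}. \<exists>j. 0 \<le> j \<and> j < s' vSp \<and> A' 3 j = q)) s A"
proof -
  have ld': "\<And>i. A 0 (s vOff + i) = P i" "0 \<le> s vOff" "A 2 = Q" using ld by (auto simp: loaded_def)
  have Pp: "1 \<le> P p" using perm_on_range[OF perm p(2,3)] by auto
  let ?sp = "s vSp"
  let ?S = "(A 3)(?sp := p, ?sp + 1 := p + 1, ?sp + 2 := p - 1, ?sp + 3 := Q (P p + 1), ?sp + 4 := Q (P p - 1))"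
  have S: "\<exists>j. 0 \<le> j \<and> j < ?sp + 5 \<and> ?S j = q"
    if qm: "q \<in> {p, p + 1, p - 1, Q (P p + 1), Q (P p - 1)}" for q
  proof -
    consider "q = p" | "q = p + 1" | "q = p - 1" | "q = Q (P p + 1)" | "q = Q (P p - 1)"
      using qm by blast
    then show ?thesis
    proof cases
      case 1 then show ?thesis using sp by (intro exI[of _ ?sp]) simp
    next
      case 2 then show ?thesis using sp by (intro exI[of _ "?sp + 1"]) simp
    next
      case 3 then show ?thesis using sp by (intro exI[of _ "?sp + 2"]) simp
    next
      case 4 then show ?thesis using sp by (intro exI[of _ "?sp + 3"]) simp
    next
      case 5 then show ?thesis using sp by (intro exI[of _ "?sp + 4"]) simp
    qed
  qed
  have "wp (push (V vP) ;; push (Plus (V vP) (N 1)) ;; push (Minus (V vP) (N 1)) ;;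
      push (Arr 2 (Plus (pat (V vP)) (N 1))) ;; push (Arr 2 (Minus (pat (V vP)) (N 1))))
    (\<lambda>_ s' A'. s' = s(vSp := ?sp + 5) \<and> A' = A(3 := ?S)) s A"
    using ld' p sp Pp by (simp add: push_def) (simp add: add.commute)
  then show ?thesis
    by (rule wp_mono) (use S in auto)
qed

lemma wp_work_body:
  assumes ld: "loaded s0 A0" and inv: "work_inv s0 A0 s A" and pos: "0 < s vSp"
  shows "wp work_body (\<lambda>_ s' A'. work_inv s0 A0 s' A' \<and>
    nat (s' vSp) + 5 * potential A' < nat (s vSp) + 5 * potential A) s A"
proof -
  let ?sp = "s vSp - 1"
  let ?p = "A 3 ?sp"
  let ?s = "s(vSp := ?sp, vP := ?p)"
  have off: "eq_off {vU, vQ, vW, vBad, vChg, vSp, vP} s0 s" and same: "A 0 = A0 0" "A 1 = A0 1" "A 2 = A0 2"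
    and rng: "in_range A" and cov: "covers A"
    using inv by (auto simp: work_inv_def)
  have stack: "\<exists>j. 0 \<le> j \<and> j < s vSp \<and> A 3 j = q"
    if "1 \<le> q" "q \<le> k" "sx \<in> {1,-1}" "sy \<in> {1,-1}" "\<not> ok A sx sy q" for q sx sy
    using inv that unfolding work_inv_def by blast
  have stack': "\<exists>j. 0 \<le> j \<and> j < ?sp \<and> A 3 j = q"
    if q: "1 \<le> q" "q \<le> k" "sx \<in> {1,-1}" "sy \<in> {1,-1}" "\<not> ok A sx sy q" "q \<noteq> ?p" for q sx sy
  proof -
    obtain j where j: "0 \<le> j" "j < s vSp" "A 3 j = q" using stack[OF q(1-5)] by blast
    then have "j \<noteq> ?sp" using q(6) by auto
    then show ?thesis using j by (intro exI[of _ j]) auto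
  qed
  have ld_s: "loaded ?s A"
  proof (rule loaded_cong[OF ld])
    fix j :: nat assume "j < 3"
    then have "j \<in> {0, 1, 2}" by auto
    then show "A j = A0 j" using same by auto
  qed (use off in \<open>auto simp: eq_off_def\<close>)
  then have K: "s vK = k" by (simp add: loaded_def)
  \<comment> \<open>Dropping the popped entry loses nothing if it is not a point or if all its arms
    satisfy their conditions.\<close>
  have idle: "work_inv s0 A0 s' A \<and> nat (s' vSp) + 5 * potential A < nat (s vSp) + 5 * potential A"
    if off': "eq_off {vU, vQ, vW, vBad, vChg} ?s s'"
      and all_ok: "\<And>sx sy. 1 \<le> ?p \<Longrightarrow> ?p \<le> k \<Longrightarrow> sx \<in> {1,-1} \<Longrightarrow> sy \<in> {1,-1} \<Longrightarrow> ok A sx sy ?p" for s'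
  proof -
    have "eq_off {vU, vQ, vW, vBad, vChg, vSp, vP} s0 s'" "s' vSp = ?sp"
      using off' off by (auto simp: eq_off_def)
    moreover have "\<exists>j. 0 \<le> j \<and> j < ?sp \<and> A 3 j = q"
      if "1 \<le> q" "q \<le> k" "sx \<in> {1,-1}" "sy \<in> {1,-1}" "\<not> ok A sx sy q" for q sx sy
      using stack'[OF that] all_ok that by blast
    ultimately have "work_inv s0 A0 s' A"
      using same rng cov pos unfolding work_inv_def by (intro conjI) (assumption | simp | blast)+
    then show ?thesis using \<open>s' vSp = ?sp\<close> pos by simp
  qed
  show ?thesis
  proof (cases "1 \<le> ?p \<and> ?p \<le> k")
    case False
    then have "work_inv s0 A0 ?s A \<and> nat (?s vSp) + 5 * potential A < nat (s vSp) + 5 * potential A"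
      using idle[of ?s] by auto
    then show ?thesis unfolding work_body_def using False K pos by auto
  next
    case True
    let ?s' = "?s(vChg := 0)"
    have ld': "loaded ?s' A" and p: "?s' vP = ?p" "1 \<le> ?p" "?p \<le> k"
      using ld_s True by (auto simp: loaded_def)
    have "checked ?s' A ?p {} ?s' A"
      using rng cov by (simp add: checked_def)
    note checks = wp_checks[OF ld' p this]
    let ?post = "\<lambda>_ s' A'. work_inv s0 A0 s' A' \<and>
      nat (s' vSp) + 5 * potential A' < nat (s vSp) + 5 * potential A"
    have "wp ((check 1 1 ;; check 1 (-1) ;; check (-1) 1 ;; check (-1) (-1)) ;;
        upon (N 0) (V vChg)
          (push (V vP) ;; push (Plus (V vP) (N 1)) ;; push (Minus (V vP) (N 1)) ;;
           push (Arr 2 (Plus (pat (V vP)) (N 1))) ;; push (Arr 2 (Minus (pat (V vP)) (N 1))))) ?post ?s' A"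
    proof (rule wp_SeqI[OF checks], goal_cases)
      case (1 t1 s1 A1)
      have off1: "eq_off {vU, vQ, vW, vBad, vChg} ?s s1"
        using 1 by (auto simp: checked_def eq_off_def)
      have same1: "A1 j r = A j r" if "r \<noteq> ?p \<or> j < 4" for j r
        using 1 that unfolding checked_def by blast
      have rng1: "in_range A1" and cov1: "covers A1" using 1 by (auto simp: checked_def)
      have sp1: "s1 vSp = ?sp" "s1 vP = ?p" using off1 by (auto simp: eq_off_def)
      consider "s1 vChg = 0" "A1 = A" "\<And>sx sy. sx \<in> {1,-1} \<Longrightarrow> sy \<in> {1,-1} \<Longrightarrow> ok A sx sy ?p"
        | "s1 vChg = 1" "potential A1 < potential A"
        using 1 unfolding checked_def by blast
      then show ?case
      proof cases
        case 1
        then show ?thesis using idle[OF off1] by simp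
      next
        case 2
        have "loaded s1 A1"
          by (rule loaded_cong[OF ld_s]) (use off1 same1 in \<open>auto simp: eq_off_def\<close>)
        note pushes = wp_pushes[OF this sp1(2) p(2,3)]
        have "wp (push (V vP) ;; push (Plus (V vP) (N 1)) ;; push (Minus (V vP) (N 1)) ;;
           push (Arr 2 (Plus (pat (V vP)) (N 1))) ;; push (Arr 2 (Minus (pat (V vP)) (N 1)))) ?post s1 A1"
        proof (rule wp_mono[OF pushes], goal_cases)
          case 1
          then show ?case using sp1 pos by simp
        next
          case (2 t2 s2 A2)
          have A2: "A2 j = A1 j" if "j \<noteq> 3" for j using 2 that by blast
          then have cong: "ok A2 = ok A1" "in_range A2 = in_range A1" "covers A2 = covers A1"
            "potential A2 = potential A1"
            using arrays_cong[of A2 A1] by auto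
          have "\<exists>j. 0 \<le> j \<and> j < s2 vSp \<and> A2 3 j = q"
            if q: "1 \<le> q" "q \<le> k" "sx \<in> {1,-1}" "sy \<in> {1,-1}" "\<not> ok A2 sx sy q" for q sx sy
          proof (cases "q \<in> {?p, ?p + 1, ?p - 1, Q (P ?p + 1), Q (P ?p - 1)}")
            case True
            then show ?thesis using 2 by blast
          next
            case False
            \<comment> \<open>Any other point consults only unchanged bounds, so its violation is an
              old one and its entry lies below the popped position, where the pushes do not
              overwrite it.\<close>
            have "\<not> ok A sx sy q"
              using ok_cong[of ?p A1 A sx sy q, OF same1 q(3,4) p(2,3) q(1,2) False] q(5) cong(1) by simp
            then obtain j where j: "0 \<le> j" "j < ?sp" "A 3 j = q"
              using stack'[OF q(1-4)] False by blast
            have "\<forall>j. j < s1 vSp \<longrightarrow> A2 3 j = A1 3 j" using 2 by blast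
            then have "A2 3 j = q" using j same1[of j 3] sp1 by auto
            moreover have "j < s2 vSp" using j 2 sp1 by auto
            ultimately show ?thesis using j by blast
          qed
          moreover have "eq_off {vU, vQ, vW, vBad, vChg, vSp, vP} s0 s2"
            using 2 off1 off by (auto simp: eq_off_def)
          moreover have "A2 0 = A0 0" "A2 1 = A0 1" "A2 2 = A0 2"
            using A2 same1 same by (auto simp: fun_eq_iff)
          moreover have "s2 vSp = ?sp + 5" using 2 sp1 by simp
          ultimately have "work_inv s0 A0 s2 A2"
            using cong rng1 cov1 pos unfolding work_inv_def by (intro conjI) (assumption | simp | blast)+
          then show ?case
            using cong(4) pos \<open>potential A1 < potential A\<close> \<open>s2 vSp = ?sp + 5\<close> by simp
        qed
        then show ?thesis using \<open>s1 vChg = 1\<close> by simp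
      qed
    qed
    then show ?thesis unfolding work_body_def using True K pos by simp
  qed
qed

lemma loop_free_check [simp]: "loop_free (check sx sy)"
  by (simp add: check_def check_x_def check_y_def)

lemma loop_free_work_body: "loop_free work_body"
  by (simp add: work_body_def push_def)

lemma wp_work_prog:
  assumes ld: "loaded s A" and inv: "work_inv s A s A" and k: "0 \<le> k" and sp: "s vSp = k"
  shows "wp work_prog (\<lambda>t s' A'. t \<le> work_cost * (nat k + 20 * nat k * nat n + 1) \<and>
    eq_off {vU, vQ, vW, vBad, vChg, vSp, vP} s s' \<and> loaded s' A' \<and>
    in_range A' \<and> covers A' \<and> stable A') s A"
proof -
  have "wp work_prog (\<lambda>t s' A'. t \<le> (csize work_body + tcost (N 0) (V vSp) + 2) * (nat (s vSp) + 5 * potential A + 1) \<and>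
    work_inv s A s' A' \<and> \<not> ev (N 0) s' A' < ev (V vSp) s' A') s A"
    unfolding work_prog_def
  proof (rule wp_While[where I = "work_inv s A" and f = "\<lambda>s A. nat (s vSp) + 5 * potential A", OF inv])
    fix s1 A1 assume "work_inv s A s1 A1" "ev (N 0) s1 A1 < ev (V vSp) s1 A1"
    then show "wp work_body (\<lambda>t s' A'. t \<le> csize work_body \<and> work_inv s A s' A' \<and>
        nat (s' vSp) + 5 * potential A' < nat (s1 vSp) + 5 * potential A1) s1 A1"
      by (intro wp_loop_free[OF loop_free_work_body] wp_work_body[OF ld]) auto
  qed simp
  then show ?thesis
  proof (rule wp_mono, goal_cases)
    case (1 t s' A')
    \<comment> \<open>The potential is at most \<open>4 * k * n\<close>, and every unit of it is
      worth five stack entries.\<close>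
    have "5 * potential A \<le> 20 * nat k * nat n"
      using potential_le[of A] inv k by (simp add: work_inv_def)
    then have "t \<le> work_cost * (nat k + 20 * nat k * nat n + 1)"
      using sp by (intro order.trans[OF conjunct1[OF 1]] mult_le_mono) (auto simp: tcost_def work_cost_def)
    moreover have inv': "work_inv s A s' A'" and "s' vSp \<le> 0" using 1 by auto
    then have "stable A'" unfolding stable_def work_inv_def by (meson atLeastAtMost_iff dual_order.trans not_le)
    moreover have "loaded s' A'"
    proof (rule loaded_cong[OF ld])
      fix j :: nat assume "j < 3"
      then have "j \<in> {0, 1, 2}" by auto
      then show "A' j = A j" using inv' by (auto simp: work_inv_def)
    qed (use inv' in \<open>auto simp: work_inv_def eq_off_def\<close>)
    ultimately show ?case using inv' unfolding work_inv_def by blast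
  qed
qed

end

section \<open>Choosing the cut of the pattern\<close>

text \<open>A point whose upper arm is void needs the horizontal line at or above its value, one
  whose lower arm is void needs it below. Non-voidness is thus again a pair of one-sided bounds on
  \<open>y\<close>.\<close>

definition narrow_side :: "int \<Rightarrow> com" where
  "narrow_side d =
     Lessd d (V vG) (Arr (aid d 1) (V vI)) Skip (upon (V vA) (V vV) (vA ::= V vV)) ;;
     Lessd d (V vG) (Arr (aid d (-1)) (V vI)) Skip (upon (V vV) (V vB) (vB ::= V vV))"

definition narrow_body :: com where
  "narrow_body =
     vV ::= pat (V vI) ;;
     Cond (V vX) (V vI) (narrow_side 1) (narrow_side (-1)) ;;
     inc vI"

definition narrow_prog :: com where
  "narrow_prog = vI ::= N 1 ;; While (V vI) (Plus (V vK) (N 1)) narrow_body"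

definition narrow_cost :: nat where
  "narrow_cost = csize narrow_body + 20"

text \<open>After both passes the accepting heights for this vertical line form a half-open
  interval, so the search over \<open>y\<close> shrinks to one comparison.\<close>

definition final_body :: com where
  "final_body = scan ;; narrow_prog ;; upon (V vA) (V vB) (vOut ::= N 1) ;; inc vX"

definition final_prog :: com where
  "final_prog =
     (vOut ::= N 0 ;; vX ::= N 0 ;; vLen ::= V vK) ;;
     While (V vX) (Plus (V vK) (N 1)) final_body"

definition final_cost :: nat where
  "final_cost = scan_cost + narrow_cost + 60"

context matching
begin

lemma wp_narrow_side:
  assumes "loaded s A" "in_range A" and d: "d \<in> {1,-1}" and p: "s vI = p" "1 \<le> p" "p \<le> k"
  shows "wp (narrow_side d) (\<lambda>_ s' A'. A' = A \<and> eq_off {vA, vB} s s' \<and>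
    s' vA = (if A (aid d 1) p = g then max (s vA) (s vV) else s vA) \<and>
    s' vB = (if A (aid d (-1)) p = g then min (s vB) (s vV) else s vB)) s A"
proof -
  have "d * g < d * A (aid d e) p \<longleftrightarrow> A (aid d e) p \<noteq> g" if "e \<in> {1,-1}" for e
    using in_rangeD(3)[OF assms(2) d that p(2,3)] d by auto
  then have eq: "d * g < d * A (aid d 1) p \<longleftrightarrow> A (aid d 1) p \<noteq> g"
    "d * g < d * A (aid d (-1)) p \<longleftrightarrow> A (aid d (-1)) p \<noteq> g"
    by auto
  have "s vG = g" using assms(1) by (simp add: loaded_def)
  then show ?thesis
    unfolding narrow_side_def using p eq by (simp add: wp_Lessd[OF d] max_def min_def)
qed

lemma wp_narrow_prog:
  assumes ld: "loaded s A" and rng: "in_range A" and k: "0 \<le> k" and x: "s vX = x"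
    and start: "\<And>y. s vA \<le> y \<and> y < s vB \<longleftrightarrow> 0 \<le> y \<and> y \<le> k \<and> cut P k x y"
  shows "wp narrow_prog (\<lambda>t s' A'. t \<le> narrow_cost * (nat k + 1) \<and> A' = A \<and>
    eq_off {vI, vA, vB, vV} s s' \<and>
    (\<forall>y. s' vA \<le> y \<and> y < s' vB \<longleftrightarrow> 0 \<le> y \<and> y \<le> k \<and> accepting A x y)) s A"
proof -
  define I where "I = (\<lambda>s' A'. A' = A \<and> eq_off {vI, vA, vB, vV} s s' \<and> 1 \<le> s' vI \<and> s' vI \<le> k + 1 \<and>
    (\<forall>y. s' vA \<le> y \<and> y < s' vB \<longleftrightarrow> 0 \<le> y \<and> y \<le> k \<and> cut P k x y \<and>
       (\<forall>p. 1 \<le> p \<and> p < s' vI \<longrightarrow> A (aid (side x p) (side y (P p))) p \<noteq> g)))"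
  have frame: "loaded s' A'" "s' vX = x" "s' vK = k" if "I s' A'" for s' A'
  proof -
    have off: "eq_off {vI, vA, vB, vV} s s'" "A' = A" using that by (auto simp: I_def)
    show "loaded s' A'"
      by (rule loaded_cong[OF ld]) (use off in \<open>auto simp: eq_off_def\<close>)
    then show "s' vK = k" by (simp add: loaded_def)
    show "s' vX = x" using off x by (auto simp: eq_off_def)
  qed
  have loop: "wp (While (V vI) (Plus (V vK) (N 1)) narrow_body)
      (\<lambda>t s'' A''. t \<le> (csize narrow_body + tcost (V vI) (Plus (V vK) (N 1)) + 2) * (nat (k + 1 - s' vI) + 1) \<and>
         I s'' A'' \<and> \<not> ev (V vI) s'' A'' < ev (Plus (V vK) (N 1)) s'' A'') s' A'"
    if "I s' A'" for s' A'
  proof (rule wp_While[where I = I and f = "\<lambda>s A. nat (k + 1 - s vI)"])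
    show "I s' A'" by fact
    fix s1 A1 assume I1: "I s1 A1" and "ev (V vI) s1 A1 < ev (Plus (V vK) (N 1)) s1 A1"
    then have lt: "s1 vI < k + 1" using frame[OF I1] by simp
    let ?p = "s1 vI"
    have A1: "A1 = A" and off1: "eq_off {vI, vA, vB, vV} s s1" and p: "1 \<le> ?p"
      and iff: "\<And>y. s1 vA \<le> y \<and> y < s1 vB \<longleftrightarrow> 0 \<le> y \<and> y \<le> k \<and> cut P k x y \<and>
       (\<forall>p. 1 \<le> p \<and> p < ?p \<longrightarrow> A (aid (side x p) (side y (P p))) p \<noteq> g)"
      using I1 unfolding I_def by blast+
    note fr = frame[OF I1]
    have P: "A1 0 (s1 vOff + i) = P i" "0 \<le> s1 vOff" for i using fr(1) by (auto simp: loaded_def)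
    let ?d = "side x ?p"
    let ?s = "s1(vV := P ?p)"
    have lds: "loaded ?s A" using fr(1) A1 by (auto simp: loaded_def)
    have "wp (narrow_side ?d ;; inc vI) (\<lambda>_ s' A'. I s' A' \<and> nat (k + 1 - s' vI) < nat (k + 1 - s1 vI)) ?s A"
    proof (rule wp_SeqI[OF wp_narrow_side[OF lds rng side_cases refl]], goal_cases)
      case 1
      show ?case using p by simp
    next
      case 2
      show ?case using lt by simp
    next
      case (3 t2 s2 A2)
      then have s2: "A2 = A" "eq_off {vA, vB} ?s s2"
        "s2 vA = (if A (aid ?d 1) ?p = g then max (s1 vA) (P ?p) else s1 vA)"
        "s2 vB = (if A (aid ?d (-1)) ?p = g then min (s1 vB) (P ?p) else s1 vB)"
        by simp_all
      have "s2 vI = ?p" using s2(2) by (auto simp: eq_off_def)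
      have "s2 vA \<le> y \<and> y < s2 vB \<longleftrightarrow> 0 \<le> y \<and> y \<le> k \<and> cut P k x y \<and>
       (\<forall>p. 1 \<le> p \<and> p < ?p + 1 \<longrightarrow> A (aid (side x p) (side y (P p))) p \<noteq> g)" for y
      proof -
        \<comment> \<open>The height \<open>y\<close> selects the lower arm exactly when the value
          of the point is at most \<open>y\<close>, so each void arm excludes one of the two
          half-lines of heights.\<close>
        have "s2 vA \<le> y \<and> y < s2 vB \<longleftrightarrow> (s1 vA \<le> y \<and> y < s1 vB) \<and>
          A (aid ?d (side y (P ?p))) ?p \<noteq> g"
          unfolding s2(3,4) by (auto simp: side_def)
        moreover have "(\<forall>p. 1 \<le> p \<and> p < ?p + 1 \<longrightarrow> A (aid (side x p) (side y (P p))) p \<noteq> g) \<longleftrightarrow>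
          (\<forall>p. 1 \<le> p \<and> p < ?p \<longrightarrow> A (aid (side x p) (side y (P p))) p \<noteq> g) \<and>
          A (aid ?d (side y (P ?p))) ?p \<noteq> g"
          using p by (metis less_add_one order_less_le zle_add1_eq_le)
        ultimately show ?thesis unfolding iff by blast
      qed
      moreover have "eq_off {vI, vA, vB, vV} s s2"
        using off1 s2(2) by (auto simp: eq_off_def)
      ultimately have "I (s2(vI := ?p + 1)) A"
        using p lt unfolding I_def by simp
      then show ?case using \<open>s2 vI = ?p\<close> s2(1) lt by simp
    qed
    then have "wp narrow_body (\<lambda>_ s' A'. I s' A' \<and> nat (k + 1 - s' vI) < nat (k + 1 - s1 vI)) s1 A1"
      unfolding narrow_body_def using P fr A1 p by (auto simp: side_def split: if_splits)
    then show "wp narrow_body (\<lambda>t s' A'. t \<le> csize narrow_body \<and> I s' A' \<and>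
        nat (k + 1 - s' vI) < nat (k + 1 - s1 vI)) s1 A1"
      by (rule wp_loop_free[rotated]) (simp add: narrow_body_def narrow_side_def)
  qed simp
  show ?thesis
    unfolding narrow_prog_def
  proof (rule wp_SeqI[where R = "\<lambda>t s' A'. t \<le> 3 \<and> I s' A' \<and> s' vI = 1"], goal_cases)
    case 1
    show ?case using k start by (simp add: I_def)
  next
    case (2 t1 s1 A1)
    note c1 = 2
    show ?case
    proof (rule wp_mono[OF loop], goal_cases)
      case 1
      show ?case using c1 by simp
    next
      case (2 t2 s2 A2)
      then have I2: "I s2 A2" by blast
      then have "s2 vI \<le> k + 1" unfolding I_def by blast
      then have i2: "s2 vI = k + 1" using 2 frame[OF I2] by simp
      have "t2 \<le> (csize narrow_body + 15) * (nat k + 1)"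
        using c1 by (intro order.trans[OF conjunct1[OF 2]] mult_le_mono) (auto simp: tcost_def)
      then have "t1 + t2 \<le> narrow_cost * (nat k + 1)"
        using c1 unfolding narrow_cost_def by (simp add: algebra_simps)
      moreover have "s2 vA \<le> y \<and> y < s2 vB \<longleftrightarrow> 0 \<le> y \<and> y \<le> k \<and> accepting A x y" for y
        using I2 i2 unfolding I_def accepting_def by (auto simp: Ball_def)
      ultimately show ?case using I2 unfolding I_def by blast
    qed
  qed
qed

lemma wp_final_prog:
  assumes ld: "loaded s A" and rng: "in_range A" and k: "0 \<le> k"
  shows "wp final_prog (\<lambda>t s' A'. t \<le> final_cost * (nat k + 1) * (nat k + 3) \<and>
    s' vOut = (if \<exists>px py. 0 \<le> px \<and> px \<le> k \<and> 0 \<le> py \<and> py \<le> k \<and> accepting A px py then 1 else 0)) s A"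
proof -
  define Z where "Z = (\<lambda>x. \<exists>py. 0 \<le> py \<and> py \<le> k \<and> accepting A x py)"
  define I where "I = (\<lambda>s' A'. A' = A \<and> eq_off {vOut, vLen, vX, vI, vA, vB, vMax, vMin, vV} s s' \<and> s' vLen = k \<and>
    0 \<le> s' vX \<and> s' vX \<le> k + 1 \<and> s' vOut = (if \<exists>px. 0 \<le> px \<and> px < s' vX \<and> Z px then 1 else 0))"
  have frame: "loaded s' A'" "A' = A" "s' vLen = k" "s' vK = k" if "I s' A'" for s' A'
  proof -
    have off: "eq_off {vOut, vLen, vX, vI, vA, vB, vMax, vMin, vV} s s'" "A' = A" "s' vLen = k"
      using that by (auto simp: I_def)
    show ld': "loaded s' A'"
      by (rule loaded_cong[OF ld]) (use off in \<open>auto simp: eq_off_def\<close>)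
    show "s' vK = k" using ld' by (simp add: loaded_def)
  qed (use that in \<open>auto simp: I_def\<close>)
  let ?T = "scan_cost * (nat k + 1) + narrow_cost * (nat k + 1) + 30"
  have loop: "wp (While (V vX) (Plus (V vK) (N 1)) final_body)
      (\<lambda>t s'' A''. t \<le> (?T + tcost (V vX) (Plus (V vK) (N 1)) + 2) * (nat (k + 1 - s' vX) + 1) \<and>
         I s'' A'' \<and> \<not> ev (V vX) s'' A'' < ev (Plus (V vK) (N 1)) s'' A'') s' A'"
    if "I s' A'" for s' A'
  proof (rule wp_While[where I = I and f = "\<lambda>s A. nat (k + 1 - s vX)"])
    show "I s' A'" by fact
    fix s1 A1 assume I1: "I s1 A1" and "ev (V vX) s1 A1 < ev (Plus (V vK) (N 1)) s1 A1"
    note fr = frame[OF I1]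
    have x: "0 \<le> s1 vX" "s1 vX \<le> k"
      using I1 fr(4) \<open>ev (V vX) s1 A1 < _\<close> unfolding I_def by (blast, simp)
    let ?x = "s1 vX"
    have off: "0 \<le> s1 vOff" and P: "(\<lambda>i. A1 0 (s1 vOff + i)) = P" using fr(1) by (auto simp: loaded_def)
    show "wp final_body (\<lambda>t s' A'. t \<le> ?T \<and> I s' A' \<and> nat (k + 1 - s' vX) < nat (k + 1 - s1 vX)) s1 A1"
      unfolding final_body_def
    proof (rule wp_SeqI[OF wp_scan[of A1 s1 k ?x, OF _ fr(3) refl x off]], goal_cases)
      case 1
      show ?case unfolding P by (rule perm)
    next
      case (2 t2 s2 A2)
      note c2 = 2
      have ld2: "loaded s2 A" "s2 vX = ?x"
        using c2 fr by (auto simp: eq_off_def loaded_def)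
      show ?case
      proof (rule wp_SeqI[OF wp_narrow_prog[of s2 A2 ?x]], goal_cases)
        case (6 t3 s3 A3)
        have off3: "eq_off {vI, vA, vB, vMax, vMin, vV} s1 s3"
          using c2 6 by (auto simp: eq_off_def)
        have "A2 = A" using c2 fr(2) by simp
        then have iff: "s3 vA \<le> y \<and> y < s3 vB \<longleftrightarrow> 0 \<le> y \<and> y \<le> k \<and> accepting A ?x y" for y
          using 6 by blast
        have "s3 vA < s3 vB \<longleftrightarrow> (\<exists>y. s3 vA \<le> y \<and> y < s3 vB)" by (auto intro: exI[of _ "s3 vA"])
        then have "s3 vA < s3 vB \<longleftrightarrow> Z ?x" unfolding iff Z_def .
        moreover have "(\<exists>px. 0 \<le> px \<and> px < ?x + 1 \<and> Z px) \<longleftrightarrow> (\<exists>px. 0 \<le> px \<and> px < ?x \<and> Z px) \<or> Z ?x"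
          using x by (metis less_add_one order_less_le zle_add1_eq_le)
        moreover have "s3 vX = ?x" "s3 vOut = s1 vOut" "s3 vLen = k"
          using off3 fr by (auto simp: eq_off_def)
        moreover have "eq_off {vOut, vLen, vX, vI, vA, vB, vMax, vMin, vV} s s3"
          using off3 I1 by (auto simp: I_def eq_off_def)
        moreover have "A3 = A" using 6 c2 fr by simp
        moreover have "t2 \<le> scan_cost * (nat k + 1)" "t3 \<le> narrow_cost * (nat k + 1)"
          using c2 6 by auto
        moreover have "s1 vOut = (if \<exists>px. 0 \<le> px \<and> px < ?x \<and> Z px then 1 else 0)"
          using I1 by (simp add: I_def)
        ultimately show ?case
          using x by (simp add: I_def tcost_def)
      qed (use c2 fr ld2 rng k P in auto)
    qed
  qed simp
  show ?thesis
    unfolding final_prog_def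
  proof (rule wp_SeqI[where R = "\<lambda>t s' A'. t \<le> 15 \<and> I s' A' \<and> s' vX = 0"], goal_cases)
    case 1
    have "s vK = k" using ld by (simp add: loaded_def)
    then show ?case using k by (simp add: I_def)
  next
    case (2 t1 s1 A1)
    note c1 = 2
    show ?case
    proof (rule wp_mono[OF loop], goal_cases)
      case 1
      show ?case using c1 by simp
    next
      case (2 t2 s2 A2)
      then have I2: "I s2 A2" by blast
      then have "s2 vX \<le> k + 1" unfolding I_def by blast
      then have i2: "s2 vX = k + 1" using 2 frame[OF I2] by simp
      have "?T + tcost (V vX) (Plus (V vK) (N 1)) + 2 \<le> final_cost * (nat k + 1)"
        by (simp add: tcost_def final_cost_def add_mult_distrib)
      moreover have "nat (k + 1 - s1 vX) + 1 = nat k + 2" using c1 k by simp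
      ultimately have "t2 \<le> (final_cost * (nat k + 1)) * (nat k + 2)"
        using 2 mult_le_mono1 order.trans by metis
      moreover have "15 \<le> final_cost * (nat k + 1)" by (simp add: final_cost_def)
      then have "t1 \<le> final_cost * (nat k + 1)" using c1 by linarith
      ultimately have "t1 + t2 \<le> final_cost * (nat k + 1) * (nat k + 3)"
        by (simp add: algebra_simps)
      moreover have "(\<exists>px. 0 \<le> px \<and> px < k + 1 \<and> Z px) \<longleftrightarrow>
          (\<exists>px py. 0 \<le> px \<and> px \<le> k \<and> 0 \<le> py \<and> py \<le> k \<and> accepting A px py)"
        unfolding Z_def by auto
      ultimately show ?case using I2 i2 unfolding I_def by simp
    qed
  qed
qed

end

section \<open>The complete algorithm\<close>

definition int_embed :: "(int \<Rightarrow> int) \<Rightarrow> int \<Rightarrow> (int \<Rightarrow> int) \<Rightarrow> int \<Rightarrow> (int \<Rightarrow> int) \<Rightarrow> bool" where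
  "int_embed T n P k e \<longleftrightarrow> (\<forall>p\<in>{1..k}. 1 \<le> e p \<and> e p \<le> n) \<and>
     (\<forall>p\<in>{1..k}. \<forall>q\<in>{1..k}. (p < q \<longrightarrow> e p < e q) \<and> (P p < P q \<longrightarrow> T (e p) < T (e q)))"

definition insert_centre :: "(int \<Rightarrow> int) \<Rightarrow> int \<Rightarrow> int \<Rightarrow> int \<Rightarrow> int" where
  "insert_centre T g y j = (if j < g then 2 * T (j + 1) else if j = g then 2 * y + 1 else 2 * T j)"

text \<open>Parity keeps every text value apart from the centre. Monotonicity of the arms is the cut
  condition of the outer point, after undoing the index shift and the doubling.\<close>

lemma matching_insert_centre:
  assumes T: "perm_on T n" and cut: "cut T n g y" and g: "0 \<le> g" "g \<le> n"
    and G: "\<And>j. 0 \<le> j \<Longrightarrow> j \<le> n \<Longrightarrow> G j = insert_centre T g y j"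
    and P: "perm_on P k" and Q: "\<And>p. 1 \<le> p \<Longrightarrow> p \<le> k \<Longrightarrow> Q (P p) = p"
  shows "matching G g n P Q k"
proof
  show "0 \<le> g" "g \<le> n" "perm_on P k" by fact+
  show "G j \<noteq> G g" if "0 \<le> j" "j \<le> n" "j \<noteq> g" for j
  proof -
    have "G j \<in> {2 * T (j + 1), 2 * T j}" "G g = 2 * y + 1"
      using G[of j] G[of g] that g by (auto simp: insert_centre_def)
    then show ?thesis by (auto; presburger)
  qed
  show "1 \<le> Q v \<and> Q v \<le> k \<and> P (Q v) = v" if v: "1 \<le> v" "v \<le> k" for v
  proof -
    have "v \<in> P ` {1..k}" using P v by (simp add: perm_on_def bij_betw_def)
    then show ?thesis using Q by auto
  qed
  show "sy * G i < sy * G j"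
    if s: "sx \<in> {1, -1}" "sy \<in> {1, -1}" and ij: "0 \<le> i" "i \<le> n" "0 \<le> j" "j \<le> n"
      "0 < sx * (i - g)" "sx * i < sx * j" "sy * G g < sy * G i" "sy * G g < sy * G j" for sx sy i j
  proof -
    \<comment> \<open>\<open>h\<close> maps an index of the text with centre back to the index in
      the text.\<close>
    define h where "h = (\<lambda>j. if j < g then j + 1 else j)"
    have ne: "i \<noteq> g" "j \<noteq> g" using s ij by auto
    have Gh: "G i = 2 * T (h i)" "G j = 2 * T (h j)" "G g = 2 * y + 1"
      using G[of i] G[of j] G[of g] ij ne g by (auto simp: insert_centre_def h_def)
    have h: "1 \<le> h i" "h i \<le> n" "1 \<le> h j" "h j \<le> n" "inner g (h j) (h i)" "h i \<noteq> h j"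
      using s(1) ij ne g by (auto simp: h_def inner_def)
    then have "T (h j) < T (h i) \<longrightarrow> T (h j) \<le> y" "T (h i) < T (h j) \<longrightarrow> y < T (h j)"
      using cut unfolding cut_def by (metis atLeastAtMost_iff)+
    moreover have "T (h i) \<noteq> T (h j)" using perm_on_eq[OF T h(1-4)] h(6) by simp
    ultimately show ?thesis using s(2) ij(7,8) unfolding Gh by auto
  qed
qed

context matching
begin

text \<open>Skipping slot \<open>g\<close> is an order isomorphism between \<open>1..n\<close> and
  the remaining indices of \<open>0..n\<close>, and doubling preserves the order of the
  values.\<close>

lemma embed_iff_int_embed:
  assumes G: "\<And>j. 0 \<le> j \<Longrightarrow> j \<le> n \<Longrightarrow> G j = insert_centre T g y j"
  shows "(\<exists>f. embed f) \<longleftrightarrow> (\<exists>e. int_embed T n P k e)"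
proof
  assume "\<exists>f. embed f"
  then obtain f where f: "embed f" by blast
  define e where "e = (\<lambda>p. if f p < g then f p + 1 else f p)"
  have Ge: "G (f p) = 2 * T (e p)" "1 \<le> e p" "e p \<le> n" if "1 \<le> p" "p \<le> k" for p
    using embedD(1-3)[OF f that] G[of "f p"] g by (auto simp: e_def insert_centre_def)
  have "e p < e q" if "1 \<le> p" "q \<le> k" "p < q" for p q
    using embedD(5)[OF f that(1) _ that(3,2)] embedD(3)[OF f, of q] that by (auto simp: e_def)
  moreover have "T (e p) < T (e q)" if "1 \<le> p" "p \<le> k" "1 \<le> q" "q \<le> k" "P p < P q" for p q
    using embedD(6)[OF f that] Ge(1)[of p] Ge(1)[of q] that by simp
  ultimately have "int_embed T n P k e" using Ge(2,3) by (auto simp: int_embed_def)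
  then show "\<exists>e. int_embed T n P k e" by blast
next
  assume "\<exists>e. int_embed T n P k e"
  then obtain e where e: "int_embed T n P k e" by blast
  define f where "f = (\<lambda>p. if e p \<le> g then e p - 1 else e p)"
  have Gf: "0 \<le> f p" "f p \<le> n" "f p \<noteq> g" "G (f p) = 2 * T (e p)" if "1 \<le> p" "p \<le> k" for p
  proof -
    have "1 \<le> e p" "e p \<le> n" using e that by (auto simp: int_embed_def)
    then show "0 \<le> f p" "f p \<le> n" "f p \<noteq> g" "G (f p) = 2 * T (e p)"
      using G[of "f p"] g by (auto simp: f_def insert_centre_def)
  qed
  have "f p < f q" if "1 \<le> p" "p \<le> k" "1 \<le> q" "q \<le> k" "p < q" for p q
  proof -
    have "e p < e q" using e that by (auto simp: int_embed_def)
    then show ?thesis by (auto simp: f_def)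
  qed
  moreover have "G (f p) < G (f q)" if "1 \<le> p" "p \<le> k" "1 \<le> q" "q \<le> k" "P p < P q" for p q
  proof -
    have "T (e p) < T (e q)" using e that by (auto simp: int_embed_def)
    then show ?thesis using Gf(4)[of p] Gf(4)[of q] that by simp
  qed
  ultimately have "embed f" using Gf(1-3) by (auto simp: embed_def)
  then show "\<exists>f. embed f" by blast
qed

lemma in_range_outermost:
  assumes "\<And>p. 1 \<le> p \<Longrightarrow> p \<le> k \<Longrightarrow> A 4 p = 0 \<and> A 5 p = 0 \<and> A 6 p = n \<and> A 7 p = n"
  shows "in_range A"
  using assms g by (auto simp: in_range_def aid_def)

lemma covers_outermost:
  assumes "\<And>p. 1 \<le> p \<Longrightarrow> p \<le> k \<Longrightarrow> A 4 p = 0 \<and> A 5 p = 0 \<and> A 6 p = n \<and> A 7 p = n"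
  shows "covers A"
  unfolding covers_def
proof (intro allI impI ballI)
  fix f px py p assume f: "embed f \<and> splits_at f px py" and p: "p \<in> {1..k}"
  then have "0 \<le> f p" "f p \<le> n" using embedD(1,2)[of f p] by auto
  then show "0 \<le> side px p * (A (aid (side px p) (side py (P p))) p - f p)"
    using assms[of p] p by (auto simp: side_def aid_def)
qed

end

section \<open>Assembling the algorithm and its cost\<close>

definition match_prog :: com where
  "match_prog =
     prefix_prog ;; (vOff ::= N 0 ;; vLen ::= V vN) ;; scan ;; vG ::= V vX ;; centre_prog ;;
     vOff ::= Plus (V vN) (N 1) ;; init_prog ;; work_prog ;; final_prog"

definition match_cost :: nat where
  "match_cost = 2 * prefix_cost + 2 * scan_cost + 2 * centre_cost + 2 * init_cost + 22 * work_cost +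
     8 * final_cost + 30"

text \<open>Every term of the phase bounds is absorbed by \<open>k * n\<close>, which needs both
  assumptions: \<open>n\<close> and 1 because the pattern is nonempty, \<open>k * k\<close> because
  it is no longer than the text. The 8 comes from \<open>k * k + 4 * k + 3\<close>, the 30 covers
  the assignments between phases.\<close>

lemma match_cost_bound:
  assumes k: "1 \<le> k" "k \<le> n"
    and t: "t1 \<le> prefix_cost * (n + 1)" "t3 \<le> scan_cost * (n + 1)" "t5 \<le> centre_cost * (n + 1)"
      "t7 \<le> init_cost * (k + 1)" "t8 \<le> work_cost * (k + 20 * k * n + 1)"
      "t9 \<le> final_cost * (k + 1) * (k + 3)"
  shows "t1 + t3 + t5 + t7 + t8 + t9 + 30 \<le> match_cost * (k * n)"
proof -
  have N: "n \<le> k * n" "k \<le> k * n" "1 \<le> k * n" "k * k \<le> k * n" using k by auto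
  have le: "n + 1 \<le> 2 * (k * n)" "k + 1 \<le> 2 * (k * n)" "k + 20 * k * n + 1 \<le> 22 * (k * n)"
    using N by linarith+
  have "t1 \<le> prefix_cost * (2 * (k * n))" "t3 \<le> scan_cost * (2 * (k * n))"
    "t5 \<le> centre_cost * (2 * (k * n))" "t7 \<le> init_cost * (2 * (k * n))"
    "t8 \<le> work_cost * (22 * (k * n))"
    using order.trans[OF t(1) mult_le_mono2[OF le(1)]] order.trans[OF t(2) mult_le_mono2[OF le(1)]]
      order.trans[OF t(3) mult_le_mono2[OF le(1)]] order.trans[OF t(4) mult_le_mono2[OF le(2)]]
      order.trans[OF t(5) mult_le_mono2[OF le(3)]] by simp_all
  moreover have "(k + 1) * (k + 3) = k * k + 4 * k + 3" by (simp add: algebra_simps)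
  then have "(k + 1) * (k + 3) \<le> 8 * (k * n)" using N by linarith
  then have "t9 \<le> final_cost * (8 * (k * n))"
    using order.trans[OF t(6)[unfolded mult.assoc] mult_le_mono2] by blast
  moreover have "match_cost * (k * n) = prefix_cost * (2 * (k * n)) + scan_cost * (2 * (k * n)) +
      centre_cost * (2 * (k * n)) + init_cost * (2 * (k * n)) + work_cost * (22 * (k * n)) +
      final_cost * (8 * (k * n)) + 30 * (k * n)"
    by (simp add: match_cost_def add_mult_distrib)
  ultimately show ?thesis using N(3) by linarith
qed

lemma wp_match_prog:
  assumes n: "s vN = n" and k: "s vK = k" "1 \<le> k" "k \<le> n"
    and T: "perm_on (A 0) n" and S: "merged (A 0) n S" and P: "perm_on (\<lambda>i. A 0 (n + 1 + i)) k"
  shows "wp match_prog (\<lambda>t s' A'. t \<le> match_cost * (nat k * nat n) \<and>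
    s' vOut = (if \<exists>e. int_embed (A 0) n (\<lambda>i. A 0 (n + 1 + i)) k e then 1 else 0)) s A"
proof -
  let ?T = "A 0"
  let ?P = "\<lambda>i. A 0 (n + 1 + i)"
  have n1: "1 \<le> n" using k by simp
  show ?thesis
    unfolding match_prog_def
  proof (rule wp_SeqI[OF wp_prefix_prog[where A = A and s = s, OF T n n1]], goal_cases)
    case (1 t1 s1 A1)
    note c1 = 1
    let ?g = "s1 vX"
    have A1: "A1 = A" and g: "0 \<le> ?g" "?g \<le> n" using c1 by auto
    obtain y0 where "left_cut ?T ?g y0" using c1 by blast
    then obtain y where y: "0 \<le> y" "y \<le> n" "cut ?T n ?g y"
      using merged_cut[OF T S g] c1 by blast
    have s1: "s1 vN = n" "s1 vK = k" using c1 n k by (auto simp: eq_off_def)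
    let ?s2 = "s1(vOff := 0, vLen := n)"
    show ?case
    proof (rule wp_SeqI[where R = "\<lambda>t s' A'. t \<le> 8 \<and> s' = ?s2 \<and> A' = A"], goal_cases)
      case 1
      show ?case using s1 A1 by simp
    next
      case (2 t2 s2 A2)
      then have c2: "t2 \<le> 8" "s2 = ?s2" "A2 = A" by auto
      have eqT: "(\<lambda>i. A2 0 (s2 vOff + i)) = ?T" using c2 by simp
      have "perm_on (\<lambda>i. A2 0 (s2 vOff + i)) n" unfolding eqT by (rule T)
      note scan = wp_scan[of A2 s2 n ?g, OF this, unfolded eqT]
      show ?case
      proof (rule wp_SeqI[OF scan], goal_cases)
        case (6 t3 s3 A3)
        have A3: "A3 = A" and off3: "eq_off {vI, vA, vB, vMax, vMin, vV} s2 s3"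
          and iff: "\<And>y. s3 vA \<le> y \<and> y < s3 vB \<longleftrightarrow> 0 \<le> y \<and> y \<le> n \<and> cut ?T n ?g y"
          using 6 c2 by auto
        note t3 = conjunct1[OF 6]
        \<comment> \<open>The interval is nonempty because it contains \<open>y\<close>; the program
          then uses its least height for the centre.\<close>
        have "s3 vA < s3 vB" using iff[of y] y by simp
        then have cy: "cut ?T n ?g (s3 vA)" using iff[of "s3 vA"] by simp
        have s3: "s3 vN = n" "s3 vK = k" "s3 vX = ?g" using off3 c2 s1 by (auto simp: eq_off_def)
        let ?s4 = "s3(vG := ?g)"
        show ?case
        proof (rule wp_SeqI[where R = "\<lambda>t s' A'. t \<le> 4 \<and> s' = ?s4 \<and> A' = A"], goal_cases)
          case 1
          show ?case using s3 A3 by simp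
        next
          case (2 t4 s4 A4)
          then have c4: "t4 \<le> 4" "s4 = ?s4" "A4 = A" by auto
          have s4: "s4 vN = n" "s4 vG = ?g" "s4 vK = k" "s4 vA = s3 vA" using c4 s3 by auto
          show ?case
          proof (rule wp_SeqI[OF wp_centre_prog[where A = A4 and s = s4, OF s4(1) n1 s4(2) g]], goal_cases)
            case (1 t5 s5 A5)
            note t5 = conjunct1[OF 1]
            have s5: "s5 vN = n" "s5 vG = ?g" "s5 vK = k" using 1 s4 by (auto simp: eq_off_def)
            have G: "A5 1 j = insert_centre ?T ?g (s3 vA) j" if "0 \<le> j" "j \<le> n" for j
              using 1 that s4(4) c4(3) by (simp add: insert_centre_def)
            have A5: "A5 0 = A 0" using 1 c4(3) by simp
            let ?s6 = "s5(vOff := n + 1)"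
            show ?case
            proof (rule wp_SeqI[where R = "\<lambda>t s' A'. t \<le> 6 \<and> s' = ?s6 \<and> A' = A5"], goal_cases)
              case 1
              show ?case using s5 by simp
            next
              case (2 t6 s6 A6)
              then have c6: "t6 \<le> 6" "s6 = ?s6" "A6 = A5" by auto
              have s6: "s6 vN = n" "s6 vG = ?g" "s6 vK = k" "s6 vOff = n + 1" "0 \<le> s6 vOff"
                using c6 s5 n1 by auto
              have eqP: "(\<lambda>i. A6 0 (s6 vOff + i)) = ?P" using c6 A5 by simp
              have "perm_on (\<lambda>i. A6 0 (s6 vOff + i)) k" unfolding eqP by (rule P)
              note init = wp_init_prog[where A = A6 and s = s6, OF s6(3) k(2) s6(1,5) this]
              show ?case
              proof (rule wp_SeqI[OF init], goal_cases)
                case (1 t7 s7 A7)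
                note t7 = conjunct1[OF 1]
                have A7: "A7 0 = A 0" "A7 1 = A5 1" "A7 2 0 = 0" "A7 2 (k + 1) = 0" "s7 vSp = k"
                  "eq_off {vI, vSp} s6 s7"
                  using 1 c6 A5 by auto
                have "A6 0 (s6 vOff + p) = ?P p" for p using eqP by (simp add: fun_eq_iff)
                then have init7: "A7 2 (?P p) = p" "A7 3 (p - 1) = p"
                  "A7 4 p = 0 \<and> A7 5 p = 0 \<and> A7 6 p = n \<and> A7 7 p = n" if "1 \<le> p" "p \<le> k" for p
                  using 1 that by auto
                interpret matching "A7 1" ?g n ?P "A7 2" k
                  by (rule matching_insert_centre[OF T cy g _ P init7(1)]) (simp_all only: A7(2) G)
                have ld: "loaded s7 A7"
                  unfolding loaded_def using A7 s6 by (auto simp: eq_off_def)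
                have "in_range A7" "covers A7"
                  using in_range_outermost[of A7] covers_outermost[of A7] init7(3) by blast+
                then have "work_inv s7 A7 s7 A7"
                  unfolding work_inv_def
                proof (intro conjI allI impI)
                  fix p sx sy :: int assume "1 \<le> p \<and> p \<le> k \<and> sx \<in> {1,-1} \<and> sy \<in> {1,-1} \<and> \<not> ok A7 sx sy p"
                  then show "\<exists>j. 0 \<le> j \<and> j < s7 vSp \<and> A7 3 j = p"
                    using init7(2)[of p] A7(5) by (intro exI[of _ "p - 1"]) auto
                qed (use A7(5) k in auto)
                note work = wp_work_prog[where A = A7 and s = s7, OF ld this _ A7(5)]
                show ?case
                proof (rule wp_SeqI[OF work], goal_cases)
                  case 1
                  show ?case using k by simp
                next
                  case (2 t8 s8 A8)
                  note t8 = conjunct1[OF 2]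
                  have "loaded s8 A8" "in_range A8" "covers A8" "stable A8" using 2 by auto
                  moreover have "0 \<le> k" using k by simp
                  ultimately have iff8: "(\<exists>px py. 0 \<le> px \<and> px \<le> k \<and> 0 \<le> py \<and> py \<le> k \<and> accepting A8 px py) \<longleftrightarrow>
                      (\<exists>e. int_embed ?T n ?P k e)"
                    and final: "wp final_prog (\<lambda>t s' A'. t \<le> final_cost * (nat k + 1) * (nat k + 3) \<and>
                      s' vOut = (if \<exists>px py. 0 \<le> px \<and> px \<le> k \<and> 0 \<le> py \<and> py \<le> k \<and> accepting A8 px py then 1 else 0)) s8 A8"
                    using accepting_iff_embed[of A8] embed_iff_int_embed[of ?T "s3 vA"] G A7(2)
                      wp_final_prog[of s8 A8] by auto
                  show ?case
                  proof (rule wp_mono[OF final], goal_cases)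
                    case (1 t9 s9 A9)
                    have "t1 + t3 + t5 + t7 + t8 + t9 + 30 \<le> match_cost * (nat k * nat n)"
                      using k c1 t3 t5 t7 t8 1 by (intro match_cost_bound) auto
                    then show ?case using 1 iff8 c2 c4 c6 by simp
                  qed
                qed
              qed
            qed
          qed
        qed
      qed (use c2 g s1 in auto)
    qed
  qed
qed

text \<open>The two shortcuts secure \<open>1 <= k <= n\<close>, under which linear work on the text
  and quadratic work on the pattern both fit into O(k n).\<close>

definition main_prog :: com where
  "main_prog =
     vN ::= Arr 0 (N 0) ;;
     vK ::= Arr 0 (Plus (V vN) (N 1)) ;;
     Cond (N 0) (V vK)
       (Cond (V vN) (V vK) (vOut ::= N 0) match_prog)
       (vOut ::= N 1)"

section \<open>From lists to functions on integer intervals\<close>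

lemma perm_on_if_is_perm:
  assumes "is_perm xs" and T: "\<And>i. i < length xs \<Longrightarrow> T (int i + 1) = int (xs ! i)"
  shows "perm_on T (int (length xs))"
  unfolding perm_on_def
proof (rule bij_betw_imageI)
  let ?n = "int (length xs)"
  have T': "T i = int (xs ! nat (i - 1))" "nat (i - 1) < length xs" if "i \<in> {1..?n}" for i
    using T[of "nat (i - 1)"] that by auto
  show "inj_on T {1..?n}"
  proof (rule inj_onI)
    fix i j assume ij: "i \<in> {1..?n}" "j \<in> {1..?n}" "T i = T j"
    then have "nat (i - 1) = nat (j - 1)"
      using T'[of i] T'[of j] assms(1) by (simp add: is_perm_def nth_eq_iff_index_eq)
    then show "i = j" using ij by auto
  qed
  have "T ` {1..?n} = int ` set xs"
  proof
    show "T ` {1..?n} \<subseteq> int ` set xs" using T' by auto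
    show "int ` set xs \<subseteq> T ` {1..?n}"
    proof
      fix v assume "v \<in> int ` set xs"
      then obtain i where "i < length xs" "v = int (xs ! i)" by (auto simp: in_set_conv_nth)
      then show "v \<in> T ` {1..?n}" using T[of i] by (intro image_eqI[of _ _ "int i + 1"]) auto
    qed
  qed
  also have "\<dots> = {1..?n}"
    using assms(1) by (auto simp: is_perm_def image_int_atLeastAtMost)
  finally show "T ` {1..?n} = {1..?n}" .
qed

lemma merged_if_skew_merged:
  assumes "skew_merged xs" and T: "\<And>i. i < length xs \<Longrightarrow> T (int i + 1) = int (xs ! i)"
  shows "\<exists>S. merged T (int (length xs)) S"
proof -
  obtain B where inc: "\<And>i j. i \<in> B \<Longrightarrow> j \<in> B \<Longrightarrow> i < j \<Longrightarrow> xs ! i < xs ! j"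
    and dec: "\<And>i j. \<lbrakk>i < length xs; j < length xs; i \<notin> B; j \<notin> B; i < j\<rbrakk> \<Longrightarrow> xs ! j < xs ! i"
    using assms(1) unfolding skew_merged_def by (metis Diff_iff lessThan_iff)
  have "merged T (int (length xs)) {i. nat (i - 1) \<in> B}"
    unfolding merged_def
  proof (intro allI impI)
    fix i j assume ij: "1 \<le> i \<and> i < j \<and> j \<le> int (length xs)"
    then have "T i = int (xs ! nat (i - 1))" "T j = int (xs ! nat (j - 1))"
      using T[of "nat (i - 1)"] T[of "nat (j - 1)"] by auto
    then show "(i \<in> {i. nat (i - 1) \<in> B} \<and> j \<in> {i. nat (i - 1) \<in> B} \<longrightarrow> T i < T j) \<and>
        (i \<notin> {i. nat (i - 1) \<in> B} \<and> j \<notin> {i. nat (i - 1) \<in> B} \<longrightarrow> T j < T i)"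
      using ij inc[of "nat (i - 1)" "nat (j - 1)"] dec[of "nat (i - 1)" "nat (j - 1)"] by auto
  qed
  then show ?thesis by blast
qed

text \<open>One-directional order conditions suffice because both orders are linear: reversing a
  strict inequality would contradict its mirror image. For values this uses that the entries of
  \<open>p\<close> are distinct.\<close>

lemma contains_iff_int_embed:
  assumes p: "is_perm p"
    and T: "\<And>i. i < length t \<Longrightarrow> T (int i + 1) = int (t ! i)"
    and P: "\<And>i. i < length p \<Longrightarrow> P (int i + 1) = int (p ! i)"
  shows "contains t p \<longleftrightarrow> (\<exists>e. int_embed T (int (length t)) P (int (length p)) e)"
proof
  assume "contains t p"
  then obtain f where f: "embedding p t f" by (auto simp: contains_def)
  define e where "e = (\<lambda>i. int (f (nat (i - 1))) + 1)"
  have rng: "f i < length t" if "i < length p" for i using f that by (simp add: embedding_def)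
  have ord: "i < j \<longleftrightarrow> f i < f j" "p ! i < p ! j \<longleftrightarrow> t ! f i < t ! f j"
    if "i < length p" "j < length p" for i j using f that by (simp_all add: embedding_def)
  have nat: "nat (i - 1) < length p" "P i = int (p ! nat (i - 1))" "T (e i) = int (t ! f (nat (i - 1)))"
    if "i \<in> {1..int (length p)}" for i
    using that P[of "nat (i - 1)"] T[of "f (nat (i - 1))"] rng[of "nat (i - 1)"] by (auto simp: e_def)
  have "int_embed T (int (length t)) P (int (length p)) e"
    unfolding int_embed_def
  proof (intro conjI ballI impI)
    fix i assume i: "i \<in> {1..int (length p)}"
    show "1 \<le> e i" "e i \<le> int (length t)" using rng[OF nat(1)[OF i]] by (auto simp: e_def)
    fix j assume j: "j \<in> {1..int (length p)}"
    show "e i < e j" if "i < j"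
      using ord(1)[OF nat(1)[OF i] nat(1)[OF j]] that i j by (auto simp: e_def)
    show "T (e i) < T (e j)" if "P i < P j"
      using ord(2)[OF nat(1)[OF i] nat(1)[OF j]] that nat(2,3)[OF i] nat(2,3)[OF j] by simp
  qed
  then show "\<exists>e. int_embed T (int (length t)) P (int (length p)) e" by blast
next
  assume "\<exists>e. int_embed T (int (length t)) P (int (length p)) e"
  then obtain e where e: "int_embed T (int (length t)) P (int (length p)) e" by blast
  define f where "f = (\<lambda>i. nat (e (int i + 1) - 1))"
  have rng: "1 \<le> e (int i + 1)" "e (int i + 1) \<le> int (length t)" if "i < length p" for i
    using e that by (auto simp: int_embed_def)
  have f: "f i < length t" "int (f i) + 1 = e (int i + 1)" if "i < length p" for i
    using rng[OF that] by (auto simp: f_def)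
  have Tf: "T (e (int i + 1)) = int (t ! f i)" if "i < length p" for i
    using T[OF f(1)[OF that]] f(2)[OF that] by simp
  have less: "f i < f j" if "i < length p" "j < length p" "i < j" for i j
  proof -
    have "e (int i + 1) < e (int j + 1)" using e that by (auto simp: int_embed_def)
    then show ?thesis using f(2)[OF that(1)] f(2)[OF that(2)] by linarith
  qed
  have val: "t ! f i < t ! f j" if "i < length p" "j < length p" "p ! i < p ! j" for i j
  proof -
    have "P (int i + 1) < P (int j + 1)" using P that by simp
    then have "T (e (int i + 1)) < T (e (int j + 1))" using e that by (auto simp: int_embed_def)
    then show ?thesis using Tf that by simp
  qed
  have "i < j \<longleftrightarrow> f i < f j" if "i < length p" "j < length p" for i j
    using less[OF that] less[OF that(2,1)] by (metis less_asym less_irrefl linorder_neqE_nat)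
  moreover have "p ! i < p ! j \<longleftrightarrow> t ! f i < t ! f j" if "i < length p" "j < length p" for i j
  proof (cases "i = j")
    case False
    then have "p ! i \<noteq> p ! j" using p that by (simp add: is_perm_def nth_eq_iff_index_eq)
    then show ?thesis using val[OF that] val[OF that(2,1)] by (metis less_asym linorder_neqE_nat)
  qed simp
  moreover have "inj_on f {..<length p}"
    by (rule inj_onI) (metis lessThan_iff less less_irrefl linorder_neqE_nat)
  ultimately have "embedding p t f" using f(1) by (simp add: embedding_def)
  then show "contains t p" by (auto simp: contains_def)
qed

theorem theorem2:
  shows "\<exists>(P :: instr list) (c :: nat). \<forall>tau pi.
     is_perm tau \<and> skew_merged tau \<and> is_perm pi \<and> skew_merged pi \<longrightarrow>
     (\<exists>t \<le> c * (length pi * length tau + 1).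
        halted P (run P t (init_config tau pi)) \<and>
        ram_output (run P t (init_config tau pi)) = (if contains tau pi then 1 else 0))"
\<comment> \<open>The additional 50 pays for reading the two lengths and for the case distinction of
  \<open>main_prog\<close>, including the cases without a matching phase.\<close>
proof (rule exI[of _ "com_code main_prog 0"], rule exI[of _ "match_cost + 50"], intro allI impI)
  fix tau pi assume *: "is_perm tau \<and> skew_merged tau \<and> is_perm pi \<and> skew_merged pi"
  let ?P = "com_code main_prog 0"
  let ?n = "int (length tau)" and ?k = "int (length pi)"
  let ?T = "input_mem tau pi"
  \<comment> \<open>All eight arrays are views of the initial memory through \<open>addr\<close>,
    which makes \<open>represents\<close> hold at the start.\<close>
  define A where "A = (\<lambda>j i. input_mem tau pi (addr j i))"
  have A0: "A 0 = ?T" by (simp add: A_def addr_def)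
  have n: "A 0 0 = ?n" and k: "A 0 (?n + 1) = ?k"
    by (simp_all add: A0 input_mem_def)
  have T: "?T (int i + 1) = int (tau ! i)" if "i < length tau" for i
    using that by (simp add: input_mem_def)
  have P: "?T (?n + 1 + (int i + 1)) = int (pi ! i)" if "i < length pi" for i
    using that by (simp add: input_mem_def)
  have "wp main_prog (\<lambda>t s' A'. t \<le> (match_cost + 50) * (length pi * length tau + 1) \<and>
      s' vOut = (if contains tau pi then 1 else 0)) (\<lambda>_. 0) A"
  proof -
    let ?s = "(\<lambda>_. 0)(vN := ?n, vK := ?k)"
    have cnt: "contains tau pi \<longleftrightarrow> (\<exists>e. int_embed ?T ?n (\<lambda>i. ?T (?n + 1 + i)) ?k e)"
      using contains_iff_int_embed[of pi tau ?T "\<lambda>i. ?T (?n + 1 + i)"] * T P by simp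
    consider "length pi = 0" | "length tau < length pi" | "1 \<le> length pi" "length pi \<le> length tau" by linarith
    then show ?thesis
    proof cases
      case 1
      then have "contains tau pi" by (simp add: contains_def embedding_def)
      then show ?thesis unfolding main_prog_def using 1 n k by (simp add: tcost_def acost_def)
    next
      case 2
      have "\<not> contains tau pi"
      proof
        assume "contains tau pi"
        then obtain f where "inj_on f {..<length pi}" "f ` {..<length pi} \<subseteq> {..<length tau}"
          by (auto simp: contains_def embedding_def)
        then have "length pi \<le> length tau" using card_inj_on_le[of f "{..<length pi}" "{..<length tau}"] by simp
        then show False using 2 by simp
      qed
      moreover have "pi \<noteq> []" using 2 by auto
      ultimately show ?thesis unfolding main_prog_def using 2 n k by (simp add: tcost_def acost_def)
    next
      case 3
      obtain S where S: "merged ?T ?n S" using merged_if_skew_merged[of tau ?T] * T by blast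
      have "perm_on (A 0) ?n" using perm_on_if_is_perm[of tau ?T] * T unfolding A0 by blast
      moreover have "perm_on (\<lambda>i. A 0 (?n + 1 + i)) ?k"
        using perm_on_if_is_perm[of pi "\<lambda>i. ?T (?n + 1 + i)"] * P unfolding A0 by blast
      ultimately have "wp match_prog (\<lambda>t s' A'. t \<le> match_cost * (nat ?k * nat ?n) \<and>
          s' vOut = (if \<exists>e. int_embed (A 0) ?n (\<lambda>i. A 0 (?n + 1 + i)) ?k e then 1 else 0)) ?s A"
        using 3 S unfolding A0[symmetric] by (intro wp_match_prog) auto
      then have "wp match_prog (\<lambda>t s' A'. t + 40 \<le> (match_cost + 50) * (length pi * length tau + 1) \<and>
          s' vOut = (if contains tau pi then 1 else 0)) ?s A"
        by (rule wp_mono) (simp add: A0 cnt add_mult_distrib)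
      then show ?thesis unfolding main_prog_def using 3 n k
        by (auto simp: tcost_def acost_def elim!: wp_mono)
    qed
  qed
  then obtain t s' A' where ex: "exec main_prog (\<lambda>_. 0) A t s' A'"
    and t: "t \<le> (match_cost + 50) * (length pi * length tau + 1)"
    and out: "s' vOut = (if contains tau pi then 1 else 0)"
    unfolding wp_def by blast
  have "represents (\<lambda>_. 0) A (\<lambda>_. 0) (input_mem tau pi)"
    by (simp add: represents_def A_def)
  moreover have "code_at ?P 0 ?P" by (simp add: code_at_def)
  ultimately obtain r m where r: "run ?P t (init_config tau pi) = (csize main_prog, r, m)"
    and rep: "represents s' A' r m"
    using run_com_code[OF ex] unfolding init_config_def by fastforce
  \<comment> \<open>Variable 0 lives in register 0, which is the output register.\<close>
  have "r 0 = s' 0" using rep unfolding represents_def by (metis mult_0_right)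
  then have "halted ?P (run ?P t (init_config tau pi)) \<and>
      ram_output (run ?P t (init_config tau pi)) = (if contains tau pi then 1 else 0)"
    unfolding r using out by (simp add: halted_def ram_output_def)
  then show "\<exists>t\<le>(match_cost + 50) * (length pi * length tau + 1).
      halted ?P (run ?P t (init_config tau pi)) \<and>
      ram_output (run ?P t (init_config tau pi)) = (if contains tau pi then 1 else 0)"
    using t by blast
qed

end
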